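(* Let $s,d\in\mathbb{N}$ (positive integers). Then there exist a constant $C_{s,d}$, depending only on $s$ and $d$, and a sequence of algorithms $(Q_n)_{n\ge 2}$, where each $Q_n$ is of the form $Q_n(f)=\sum_{j=1}^n a_j f(x^j)$ with nodes $x^1,\dots,x^n\in[0,1]^d$ and weights $a_1,\dots,a_n\in\mathbb{R}$ (nodes and weights may depend on $n$, but not on $f$), such that for all $n\ge 2$ \[ e(Q_n,\mathring{H}_d^{s,\mathrm{mix}})\;\le\; C_{s,d}\, n^{-s}\,(\log n)^{\frac{d-1}{2}} . \]
   Context: Functions are real-valued. For $\alpha\in\mathbb{N}_0^d$, $D^\alpha f$ denotes the usual partial derivative of $f$ (in the weak sense for limit functions), and \[ \|f\|_{s,\mathrm{mix}}^2:=\sum_{\alpha\in\mathbb{N}_0^d:\ \|\alpha\|_\infty\le s}\|D^\alpha f\|_{L_2([0,1]^d)}^2 . \] The class $H_d^{s,\mathrm{mix}}$ is the closure in $C([0,1]^d)$, with respect to $\|\cdot\|_{s,\mathrm{mix}}$, of the set of $sd$-times continuously differentiable functions $f\in C^{sd}([0,1]^d)$ with $\|f\|_{s,\mathrm{mix}}\le 1$. Furthermore, \[ \mathring{H}_d^{s,\mathrm{mix}}:=\{f\in H_d^{s,\mathrm{mix}}:\ \mathrm{supp}(f)\subset(0,1)^d\}, \] where $\mathrm{supp}(f)$ is the closure of $\{x: f(x)\ne0\}$. The integral is $I(f)=\int_{[0,1]^d}f(x)\,dx$, and the worst case error of $Q_n$ on a function class $H$ is $e(Q_n,H)=\sup_{f\in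 H}|I(f)-Q_n(f)|$. *)

theory Defs
  imports "HOL-Analysis.Analysis"
begin

(* A function on the closed unit cube is represented by a function on real ^ 'd of which only the
   values on the cube matter: no definition below looks at values outside the cube. *)

definition unit_cube :: "(real ^ 'd::finite) set" where
  "unit_cube = cbox 0 1"

definition supp :: "(real ^ 'd::finite \<Rightarrow> real) \<Rightarrow> (real ^ 'd) set" where
  "supp f = closure {x \<in> unit_cube. f x \<noteq> 0}"

definition midx_order :: "('d::finite \<Rightarrow> nat) \<Rightarrow> nat" where
  "midx_order \<alpha> = (\<Sum>i\<in>UNIV. \<alpha> i)"

(* The derivative is taken within the cube, hence one-sided at a face orthogonal to direction i. *)
definition has_partial_deriv ::
    "'d::finite \<Rightarrow> (real ^ 'd \<Rightarrow> real) \<Rightarrow> (real ^ 'd \<Rightarrow> real) \<Rightarrow> bool" where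
  "has_partial_deriv i f g \<longleftrightarrow>
     (\<forall>x\<in>unit_cube. ((\<lambda>t. f (x + t *\<^sub>R axis i 1)) has_real_derivative g x)
        (at 0 within {t. x + t *\<^sub>R axis i 1 \<in> unit_cube}))"

(* F lists the partial derivatives of f of all orders up to k, all of them continuous up to the
   boundary of the cube; F \<alpha> is relevant only for midx_order \<alpha> \<le> k. Requiring F at the successor
   multi-index to be the i-th partial derivative for every i loses nothing, since continuous mixed
   partial derivatives do not depend on the order of differentiation. *)
definition classical_derivs ::
    "nat \<Rightarrow> (real ^ 'd::finite \<Rightarrow> real) \<Rightarrow> (('d \<Rightarrow> nat) \<Rightarrow> real ^ 'd \<Rightarrow> real) \<Rightarrow> bool" where
  "classical_derivs k f F \<longleftrightarrow>
     (\<forall>x\<in>unit_cube. F (\<lambda>_. 0) x = f x) \<and>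
     (\<forall>\<alpha>. midx_order \<alpha> \<le> k \<longrightarrow> continuous_on unit_cube (F \<alpha>)) \<and>
     (\<forall>\<alpha> i. midx_order \<alpha> < k \<longrightarrow> has_partial_deriv i (F \<alpha>) (F (\<alpha>(i := Suc (\<alpha> i)))))"

definition C_k :: "nat \<Rightarrow> (real ^ 'd::finite \<Rightarrow> real) set" where
  "C_k k = {f. \<exists>F. classical_derivs k f F}"

(* Meaningful for f in C_k (midx_order \<alpha>); the choice of F does not affect the values on the
   cube, see classical_derivs_unique. *)
definition classical_deriv ::
    "('d::finite \<Rightarrow> nat) \<Rightarrow> (real ^ 'd \<Rightarrow> real) \<Rightarrow> (real ^ 'd \<Rightarrow> real)" where
  "classical_deriv \<alpha> f = (SOME F. classical_derivs (midx_order \<alpha>) f F) \<alpha>"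

lemma classical_derivs_unique:
  assumes "classical_derivs k f F" "classical_derivs k f G" "midx_order \<alpha> \<le> k" "x \<in> unit_cube"
  shows "F \<alpha> x = G \<alpha> x"
  using assms(3,4)
proof (induction "midx_order \<alpha>" arbitrary: \<alpha> x)
  case 0
  then have "\<alpha> = (\<lambda>_. 0)"
    by (auto simp: midx_order_def)
  then show ?case
    using assms(1,2) 0 by (simp add: classical_derivs_def)
next
  case (Suc m)
  from Suc.hyps(2) obtain i where i: "\<alpha> i \<noteq> 0"
    unfolding midx_order_def by (metis Zero_not_Suc sum.neutral)
  define \<beta> where "\<beta> = \<alpha>(i := \<alpha> i - 1)"
  have \<alpha>: "\<alpha> = \<beta>(i := Suc (\<beta> i))"
    using i by (auto simp: \<beta>_def)
  have "midx_order \<alpha> = \<alpha> i + sum \<alpha> (UNIV - {i})" "midx_order \<beta> = \<beta> i + sum \<beta> (UNIV - {i})"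
    unfolding midx_order_def by (simp_all add: sum.remove)
  moreover have "sum \<beta> (UNIV - {i}) = sum \<alpha> (UNIV - {i})"
    by (rule sum.cong) (auto simp: \<beta>_def)
  ultimately have m: "m = midx_order \<beta>" and lt: "midx_order \<beta> < k"
    using i Suc.hyps(2) Suc.prems(1) by (auto simp: \<beta>_def)
  define T where "T = {t. x + t *\<^sub>R axis i 1 \<in> unit_cube}"
  have dF: "((\<lambda>t. F \<beta> (x + t *\<^sub>R axis i 1)) has_real_derivative F \<alpha> x) (at 0 within T)"
    and dG: "((\<lambda>t. G \<beta> (x + t *\<^sub>R axis i 1)) has_real_derivative G \<alpha> x) (at 0 within T)"
    using assms(1,2) lt \<alpha> Suc.prems(2)
    unfolding classical_derivs_def has_partial_deriv_def T_def by metis+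
  have eq: "F \<beta> (x + t *\<^sub>R axis i 1) = G \<beta> (x + t *\<^sub>R axis i 1)" if "t \<in> T" for t
    using Suc.hyps(1)[OF m] lt that by (simp add: T_def)
  have x: "0 \<le> x $ j" "x $ j \<le> 1" for j
    using Suc.prems(2) by (auto simp: unit_cube_def mem_box_cart)
  have T: "T = {- (x $ i) .. 1 - x $ i}"
  proof -
    have "t \<in> T \<longleftrightarrow> (\<forall>j. 0 \<le> x $ j + (if j = i then t else 0) \<and> x $ j + (if j = i then t else 0) \<le> 1)" for t
      by (auto simp: T_def unit_cube_def mem_box_cart axis_def if_distrib cong: if_cong)
    then show ?thesis
      using x by (auto split: if_splits)
  qed
  have 0: "0 \<in> T"
    using x[of i] by (simp add: T)
  have nt: "at 0 within T \<noteq> bot"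
    using x[of i] by (simp add: T trivial_limit_within islimpt_Icc)
  have "((\<lambda>t. F \<beta> (x + t *\<^sub>R axis i 1)) has_real_derivative G \<alpha> x) (at 0 within T)"
    by (rule has_field_derivative_transform_within[OF dG zero_less_one 0]) (simp add: eq)
  with dF nt show ?case
    by (metis has_real_derivative_iff_has_vector_derivative vector_derivative_unique_within)
qed

(* Smooth functions with compact support in the open unit cube. *)
definition test_functions :: "(real ^ 'd::finite \<Rightarrow> real) set" where
  "test_functions = {\<phi>. (\<forall>k. \<phi> \<in> C_k k) \<and> supp \<phi> \<subseteq> box 0 1}"

definition L2 :: "(real ^ 'd::finite \<Rightarrow> real) set" where
  "L2 = {g. set_borel_measurable lborel unit_cube g \<and>
            set_integrable lborel unit_cube (\<lambda>x. (g x)\<^sup>2)}"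

definition L2_norm :: "(real ^ 'd::finite \<Rightarrow> real) \<Rightarrow> real" where
  "L2_norm g = sqrt (LINT x:unit_cube|lborel. (g x)\<^sup>2)"

(* g is a square integrable weak derivative of f; it is unique up to null sets. *)
definition L2_weak_deriv ::
    "('d::finite \<Rightarrow> nat) \<Rightarrow> (real ^ 'd \<Rightarrow> real) \<Rightarrow> (real ^ 'd \<Rightarrow> real) \<Rightarrow> bool" where
  "L2_weak_deriv \<alpha> f g \<longleftrightarrow> g \<in> L2 \<and>
     (\<forall>\<phi>\<in>test_functions.
        (LINT x:unit_cube|lborel. f x * classical_deriv \<alpha> \<phi> x) =
        (-1) ^ midx_order \<alpha> * (LINT x:unit_cube|lborel. g x * \<phi> x))"

definition deriv_D :: "('d::finite \<Rightarrow> nat) \<Rightarrow> (real ^ 'd \<Rightarrow> real) \<Rightarrow> (real ^ 'd \<Rightarrow> real)" where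
  "deriv_D \<alpha> f =
     (if f \<in> C_k (midx_order \<alpha>) then classical_deriv \<alpha> f else (SOME g. L2_weak_deriv \<alpha> f g))"

definition mix_indices :: "nat \<Rightarrow> ('d::finite \<Rightarrow> nat) set" where
  "mix_indices s = {\<alpha>. \<forall>i. \<alpha> i \<le> s}"

lemma finite_mix_indices: "finite (mix_indices s :: ('d::finite \<Rightarrow> nat) set)"
proof -
  have "mix_indices s = (PiE UNIV (\<lambda>_. {..s}) :: ('d \<Rightarrow> nat) set)"
    by (auto simp: mix_indices_def PiE_def)
  then show ?thesis
    by (simp add: finite_PiE)
qed

definition mix_norm :: "nat \<Rightarrow> (real ^ 'd::finite \<Rightarrow> real) \<Rightarrow> real" where
  "mix_norm s f = sqrt (\<Sum>\<alpha>\<in>mix_indices s. (L2_norm (deriv_D \<alpha> f))\<^sup>2)"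

(* The continuous functions for which mix_norm s is defined (and finite). *)
definition mix_space :: "nat \<Rightarrow> (real ^ 'd::finite \<Rightarrow> real) set" where
  "mix_space s = {f. continuous_on unit_cube f \<and> (\<forall>\<alpha>\<in>mix_indices s. \<exists>g. L2_weak_deriv \<alpha> f g)}"

definition mix_ball :: "nat \<Rightarrow> (real ^ 'd::finite \<Rightarrow> real) set" where
  "mix_ball s = {f \<in> C_k (s * CARD('d)). mix_norm s f \<le> 1}"

definition H_mix :: "nat \<Rightarrow> (real ^ 'd::finite \<Rightarrow> real) set" where
  "H_mix s = {f \<in> mix_space s. \<forall>\<epsilon>>0. \<exists>g\<in>mix_ball s. mix_norm s (\<lambda>x. f x - g x) < \<epsilon>}"

definition H_mix_ring :: "nat \<Rightarrow> (real ^ 'd::finite \<Rightarrow> real) set" where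
  "H_mix_ring s = {f \<in> H_mix s. supp f \<subseteq> box 0 1}"

definition cube_integral :: "(real ^ 'd::finite \<Rightarrow> real) \<Rightarrow> real" where
  "cube_integral f = (LINT x:unit_cube|lborel. f x)"

definition cubature ::
    "nat \<Rightarrow> (nat \<Rightarrow> real) \<Rightarrow> (nat \<Rightarrow> real ^ 'd::finite) \<Rightarrow> (real ^ 'd \<Rightarrow> real) \<Rightarrow> real" where
  "cubature n a x f = (\<Sum>j=1..n. a j * f (x j))"

(* Extended real valued, so that an unbounded error is infinity. *)
definition worst_case_error ::
    "((real ^ 'd::finite \<Rightarrow> real) \<Rightarrow> real) \<Rightarrow> (real ^ 'd \<Rightarrow> real) set \<Rightarrow> ereal" where
  "worst_case_error Q H = (SUP f\<in>H. ereal \<bar>cube_integral f - Q f\<bar>)"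

end

theory Submission
  imports Defs
begin

text \<open>The nodes form a lattice whose dual lattice consists of the vectors of conjugates \<open>k\<close> of the
  integers of an order in a totally real number field, dilated by \<open>a\<close>: apart from \<open>k = 0\<close> they satisfy
  \<open>\<bar>k\<^sub>1 \<cdots> k\<^sub>d\<bar> \<ge> a\<^sup>d\<close>. Let \<open>K\<^sub>N\<close> be a nonnegative periodic trigonometric kernel concentrating at the lattice
  points. Then \<open>\<integral> f K\<^sub>N\<close> tends to the cubature sum, while \<open>K\<^sub>N - 1\<close> is a finite combination, with
  coefficients in \<open>[0, 1]\<close>, of the plane waves with frequencies \<open>k \<noteq> 0\<close>; this replaces Poisson summation.
  Integrating the plane wave by parts \<open>s\<close> times in each coordinate with \<open>\<bar>k\<^sub>i\<bar> \<ge> 1\<close> gives a factor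
  \<open>\<Prod> max(1, \<bar>k\<^sub>i\<bar>)\<^sup>-\<^sup>s\<close>. By orthogonality of the characters, the error is bounded by the norm of \<open>f\<close> times the
  square root of \<open>\<Sum> \<Prod> max(1, \<bar>k\<^sub>i\<bar>)\<^sup>-\<^sup>2\<^sup>s\<close>, and a dyadic decomposition shows that this sum is of order
  \<open>a\<^sup>-\<^sup>2\<^sup>s\<^sup>d (log a)\<^sup>d\<^sup>-\<^sup>1\<close>, with \<open>a\<^sup>d\<close> of the order of the number of nodes.\<close>

section \<open>A matrix with norm form bounded below\<close>

text \<open>Members of the class are only limits of smooth functions, so every estimate is phrased
  as a pairing with test functions. Three points shape the argument. The error of the kernel
  integral is bounded uniformly in N, using only that the coefficients lie in [0, 1]; hence the
  bound survives the limit in which the kernel turns into the cubature sum. One weak derivative can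
  serve many frequencies at once only if they share the multi-index, so the frequencies are sorted
  into 2^d classes by the set of coordinates with |k_i| >= 1, and in each class one weak derivative
  is paired with one trigonometric polynomial. This pairing costs a square root of a sum over
  frequencies, which halves the exponent d - 1; that exponent counts the ways of distributing a
  total dyadic level among d coordinates. The support condition enters twice: it removes all
  boundary terms, and it makes the extension of f by zero continuous, so that the concentrating
  kernel may be tested against it.\<close>

definition ipoly_real :: "int poly \<Rightarrow> real \<Rightarrow> real" where
  "ipoly_real p x = (\<Sum>i\<le>degree p. of_int (coeff p i) * x ^ i)"

lemma ipoly_real_altdef:
  assumes "degree p \<le> n"
  shows "ipoly_real p x = (\<Sum>i\<le>n. of_int (coeff p i) * x ^ i)"
  unfolding ipoly_real_def
  by (rule sum.mono_neutral_left) (use assms in \<open>auto intro: coeff_eq_0\<close>)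

lemma ipoly_real_0 [simp]: "ipoly_real 0 x = 0"
  by (simp add: ipoly_real_def)

lemma ipoly_real_const [simp]: "ipoly_real [:a:] x = of_int a"
  by (simp add: ipoly_real_def)

lemma ipoly_real_pCons [simp]: "ipoly_real (pCons a p) x = of_int a + x * ipoly_real p x"
  by (subst ipoly_real_altdef[OF degree_pCons_le], subst sum.atMost_Suc_shift)
    (simp add: ipoly_real_def sum_distrib_left mult_ac)

lemma ipoly_real_add [simp]: "ipoly_real (p + q) x = ipoly_real p x + ipoly_real q x"
  by (subst (1 2 3) ipoly_real_altdef[where n = "max (degree p) (degree q)"])
    (auto simp: degree_add_le sum.distrib algebra_simps)

lemma ipoly_real_smult [simp]: "ipoly_real (smult c p) x = of_int c * ipoly_real p x"
  by (subst (1 2) ipoly_real_altdef[where n = "degree p"])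
    (auto simp: degree_smult_le sum_distrib_left mult_ac)

lemma ipoly_real_minus [simp]: "ipoly_real (- p) x = - ipoly_real p x"
  using ipoly_real_smult[of "-1" p x] by simp

lemma ipoly_real_diff [simp]: "ipoly_real (p - q) x = ipoly_real p x - ipoly_real q x"
  using ipoly_real_add[of p "- q" x] by simp

lemma ipoly_real_mult [simp]: "ipoly_real (p * q) x = ipoly_real p x * ipoly_real q x"
  by (induction p) (simp_all add: algebra_simps)

lemma ipoly_real_one [simp]: "ipoly_real 1 x = 1"
  by (simp add: ipoly_real_def)

lemma ipoly_real_prod: "ipoly_real (\<Prod>i\<in>I. f i) x = (\<Prod>i\<in>I. ipoly_real (f i) x)"
  by (induction I rule: infinite_finite_induct) simp_all

lemma ipoly_real_monom [simp]: "ipoly_real (monom c n) x = of_int c * x ^ n"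
  by (induction n) (simp_all add: monom_0 monom_Suc mult_ac)

lemma ipoly_real_sum: "ipoly_real (\<Sum>i\<in>I. f i) x = (\<Sum>i\<in>I. ipoly_real (f i) x)"
  by (induction I rule: infinite_finite_induct) simp_all

text \<open>The nodes 0, 4, ..., 4(d - 1) are so far apart that the product has absolute value at
  least 2 halfway between them, so subtracting 1 preserves the d sign changes and all roots are
  real. Taking the value -1 at d integers is what forces irreducibility.\<close>

definition frolov_poly :: "nat \<Rightarrow> int poly" where
  "frolov_poly d = (\<Prod>i<d. [:- 4 * int i, 1:]) - 1"

lemma degree_frolov_poly: "degree (frolov_poly d) = d"
  and lead_coeff_frolov_poly: "d > 0 \<Longrightarrow> lead_coeff (frolov_poly d) = 1"
proof -
  let ?Q = "\<Prod>i<d. [:- 4 * int i, 1:]"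
  have deg: "degree ?Q = d"
    by (subst degree_prod_eq_sum_degree) auto
  have lc: "lead_coeff ?Q = 1"
    by (simp add: lead_coeff_prod)
  show 1: "degree (frolov_poly d) = d"
  proof (cases "d = 0")
    case False
    then have "degree (?Q + - 1) = degree ?Q"
      using deg by (intro degree_add_eq_left) auto
    then show ?thesis using deg by (simp add: frolov_poly_def)
  qed (simp add: frolov_poly_def)
  show "lead_coeff (frolov_poly d) = 1" if "d > 0"
    unfolding 1 using that lc deg by (simp add: frolov_poly_def)
qed

lemma poly_frolov_poly_node: "i < d \<Longrightarrow> poly (frolov_poly d) (4 * int i) = - 1"
  by (auto simp: frolov_poly_def poly_prod prod_zero_iff)

text \<open>The points 4i - 2 interlace with the nodes: exactly d - i factors are negative and each
  has absolute value at least 2. The product therefore has absolute value at least 2^d >= 2, and the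
  subtracted 1 cannot change its sign.\<close>

lemma frolov_poly_sign:
  assumes "i \<le> d" "d > 0"
  shows "(-1) ^ (d - i) * ipoly_real (frolov_poly d) (4 * real i - 2) > 0"
proof -
  let ?x = "4 * real i - 2"
  have split: "{..<d} = {..<i} \<union> {i..<d}"
    using assms by auto
  have "(\<Prod>j<d. ?x - 4 * real j) = (\<Prod>j<i. ?x - 4 * real j) * (\<Prod>j\<in>{i..<d}. ?x - 4 * real j)"
    unfolding split by (rule prod.union_disjoint) auto
  also have "(\<Prod>j\<in>{i..<d}. ?x - 4 * real j) = (\<Prod>j\<in>{i..<d}. (-1) * (4 * real j - ?x))"
    by (intro prod.cong) auto
  also have "\<dots> = (-1) ^ (d - i) * (\<Prod>j\<in>{i..<d}. 4 * real j - ?x)"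
    by (subst prod.distrib) simp
  finally have eq: "(\<Prod>j<d. ?x - 4 * real j) =
      (-1) ^ (d - i) * ((\<Prod>j<i. ?x - 4 * real j) * (\<Prod>j\<in>{i..<d}. 4 * real j - ?x))"
    by (simp add: mult_ac)
  have "(\<Prod>j<i. 2 :: real) \<le> (\<Prod>j<i. ?x - 4 * real j)"
  proof (rule prod_mono)
    fix j assume "j \<in> {..<i}"
    then have "real j + 1 \<le> real i" by auto
    then show "0 \<le> (2::real) \<and> 2 \<le> ?x - 4 * real j" by auto
  qed
  moreover have "(\<Prod>j\<in>{i..<d}. 2 :: real) \<le> (\<Prod>j\<in>{i..<d}. 4 * real j - ?x)"
    by (rule prod_mono) auto
  ultimately have "2 ^ i * 2 ^ (d - i) \<le>
      (\<Prod>j<i. ?x - 4 * real j) * (\<Prod>j\<in>{i..<d}. 4 * real j - ?x)"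
    by (intro mult_mono) (auto intro: order_trans[rotated])
  moreover have "(2::real) ^ i * 2 ^ (d - i) = 2 ^ d"
    using assms by (simp flip: power_add)
  moreover have "(2::real) ^ 1 \<le> 2 ^ d"
    using assms by (intro power_increasing) auto
  ultimately have ge: "2 \<le> (\<Prod>j<i. ?x - 4 * real j) * (\<Prod>j\<in>{i..<d}. 4 * real j - ?x)"
    by simp
  have "(-1) ^ (d - i) * ipoly_real (frolov_poly d) ?x = (-1) ^ (d - i) * (\<Prod>j<d. ?x - 4 * real j) - (-1) ^ (d - i)"
    by (simp add: frolov_poly_def ipoly_real_prod algebra_simps)
  also have "\<dots> = (\<Prod>j<i. ?x - 4 * real j) * (\<Prod>j\<in>{i..<d}. 4 * real j - ?x) - (-1) ^ (d - i)"
    unfolding eq by (simp flip: mult.assoc power_add add: mult_2[symmetric])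
  also have "\<dots> \<ge> 2 - 1"
    using ge by (intro diff_mono) (auto simp: minus_one_power_iff)
  finally show ?thesis by simp
qed

lemma continuous_on_ipoly_real [continuous_intros]: "continuous_on S (ipoly_real p)"
  unfolding ipoly_real_def by (intro continuous_intros)

text \<open>The signs at 4i - 2 and 4i + 2 are opposite, so the intermediate value theorem puts one
  root into each of d disjoint open intervals.\<close>

lemma frolov_poly_roots:
  obtains \<xi> :: "nat \<Rightarrow> real" where "inj_on \<xi> {..<d}" "\<And>i. i < d \<Longrightarrow> ipoly_real (frolov_poly d) (\<xi> i) = 0"
proof -
  have "\<exists>x. 4 * real i - 2 < x \<and> x < 4 * real i + 2 \<and> ipoly_real (frolov_poly d) x = 0" if "i < d" for i
  proof -
    let ?g = "\<lambda>x. (-1) ^ (d - i) * ipoly_real (frolov_poly d) x"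
    have a: "?g (4 * real i - 2) > 0"
      using frolov_poly_sign[of i d] that by simp
    have "d - i = Suc (d - Suc i)"
      using that by simp
    then have b: "?g (4 * real i + 2) < 0"
      using frolov_poly_sign[of "Suc i" d] that by (simp add: algebra_simps)
    obtain x where x: "4 * real i - 2 \<le> x" "x \<le> 4 * real i + 2" "?g x = 0"
      using IVT2'[of ?g "4 * real i + 2" 0 "4 * real i - 2"] a b
      by (fastforce intro!: continuous_intros)
    moreover have "x \<noteq> 4 * real i - 2" "x \<noteq> 4 * real i + 2"
      using x a b by auto
    ultimately show ?thesis
      by (intro exI[of _ x]) auto
  qed
  then obtain \<xi> where \<xi>: "\<And>i. i < d \<Longrightarrow> 4 * real i - 2 < \<xi> i \<and> \<xi> i < 4 * real i + 2 \<and> ipoly_real (frolov_poly d) (\<xi> i) = 0"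
    by metis
  show ?thesis
  proof
    show "inj_on \<xi> {..<d}"
    proof (rule linorder_inj_onI)
      fix i j assume "i < j" "i \<in> {..<d}" "j \<in> {..<d}"
      then show "\<xi> i \<noteq> \<xi> j"
        using \<xi>[of i] \<xi>[of j] by (smt (verit) lessThan_iff of_nat_less_iff of_nat_Suc Suc_leI of_nat_mono)
    qed auto
  qed (use \<xi> in auto)
qed

text \<open>A factorisation \<^term>\<open>frolov_poly d = g * h\<close> has \<^term>\<open>g = - h\<close> at the \<^term>\<open>d\<close> nodes, hence
  \<^term>\<open>g = - h\<close>, contradicting that the leading coefficient is positive.\<close>

lemma frolov_poly_no_factor:
  assumes "d > 0" "frolov_poly d = g * h" "degree g < d" "degree h < d"
  shows False
proof -
  have "g + h = 0"
  proof (rule ccontr)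
    assume nz: "g + h \<noteq> 0"
    have "(\<lambda>i. 4 * int i) ` {..<d} \<subseteq> {x. poly (g + h) x = 0}"
    proof safe
      fix i assume "i < d"
      then have "poly g (4 * int i) * poly h (4 * int i) = - 1"
        using poly_frolov_poly_node[of i d] assms(2) by simp
      then show "poly (g + h) (4 * int i) = 0"
        by (auto dest: pos_zmult_eq_1_iff_lemma simp: zmult_eq_neg1_iff)
    qed
    then have "card ((\<lambda>i. 4 * int i) ` {..<d}) \<le> card {x. poly (g + h) x = 0}"
      by (intro card_mono poly_roots_finite nz)
    moreover have "card ((\<lambda>i. 4 * int i) ` {..<d}) = d"
      by (subst card_image) (auto simp: inj_on_def)
    moreover have "card {x. poly (g + h) x = 0} < d"
      using card_poly_roots_bound[OF nz] degree_add_less[of g d h] assms by linarith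
    ultimately show False by simp
  qed
  then have "h = - g"
    by (simp add: eq_neg_iff_add_eq_0 add.commute)
  then have "lead_coeff (frolov_poly d) = - (lead_coeff g ^ 2)"
    using assms(2) by (simp add: lead_coeff_mult power2_eq_square)
  moreover have "lead_coeff g ^ 2 \<ge> 0" by simp
  ultimately show False
    using lead_coeff_frolov_poly[OF assms(1)] by linarith
qed

text \<open>Irreducibility over the rationals, carried out with integer polynomials: the primitive
  part of a polynomial of least degree vanishing at \<open>x\<close> divides
  \<open>frolov_poly d\<close> by Gauss's lemma, and a divisor of positive degree below
  \<open>d\<close> contradicts \<open>frolov_poly_no_factor\<close>.\<close>

lemma frolov_poly_root_degree:
  assumes "d > 0" "ipoly_real (frolov_poly d) x = 0" "g \<noteq> 0" "ipoly_real g x = 0"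
  shows "degree g \<ge> d"
proof (rule ccontr)
  assume "\<not> degree g \<ge> d"
  define P where "P = (\<lambda>g. g \<noteq> 0 \<and> ipoly_real g x = 0)"
  obtain q where q: "P q" "\<And>r. P r \<Longrightarrow> degree q \<le> degree r"
    using ex_has_least_nat[of P g degree] assms by (auto simp: P_def)
  define p where "p = primitive_part q"
  have "ipoly_real q x = of_int (content q) * ipoly_real p x"
    unfolding p_def by (metis content_times_primitive_part ipoly_real_smult)
  then have p: "P p" "degree p = degree q" "content p = 1"
    using q(1) by (auto simp: P_def p_def)
  have dp: "degree p < d"
    using q(2)[of g] assms \<open>\<not> degree g \<ge> d\<close> p by (simp add: P_def)
  have "degree p > 0"
  proof (rule ccontr)
    assume "\<not> degree p > 0"
    then obtain a where "p = [:a:]"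
      by (metis degree_eq_zeroE gr0I)
    then show False using p by (auto simp: P_def)
  qed
  have p0: "p \<noteq> 0" using p by (simp add: P_def)
  \<comment> \<open>Pseudo-division stays inside the integers at the price of the factor
    \<open>a\<close>. The remainder vanishes at \<open>x\<close> too, so minimality of the degree
    makes it zero.\<close>
  obtain a h where ah: "a \<noteq> 0" "smult a (frolov_poly d) = p * h + pseudo_mod (frolov_poly d) p"
    using pseudo_mod(1)[OF p0] by blast
  have "pseudo_mod (frolov_poly d) p = 0"
  proof (rule ccontr)
    assume nz: "pseudo_mod (frolov_poly d) p \<noteq> 0"
    have "ipoly_real (smult a (frolov_poly d)) x = ipoly_real (p * h + pseudo_mod (frolov_poly d) p) x"
      using ah(2) by simp
    then have "P (pseudo_mod (frolov_poly d) p)"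
      using assms(2) p nz by (simp add: P_def)
    then show False
      using q(2) pseudo_mod(2)[OF p0] nz p(2) by (metis not_le)
  qed
  with ah have eq: "smult a (frolov_poly d) = p * h" by simp
  \<comment> \<open>A monic polynomial is primitive. Comparing contents in \<open>eq\<close> shows
    that \<open>h\<close> carries the whole factor \<open>a\<close> up to sign, so it can be
    cancelled.\<close>
  have "content (frolov_poly d) = 1"
    using lead_coeff_frolov_poly[OF assms(1)] content_dvd_coeff[of "frolov_poly d" "degree (frolov_poly d)"]
      is_unit_normalize[of "content (frolov_poly d)"] normalize_content[of "frolov_poly d"] by metis
  then have "content h = normalize a"
    using arg_cong[OF eq, of content] p(3) by (simp add: content_mult)
  then have "smult a (frolov_poly d) = p * smult (normalize a) (primitive_part h)"
    by (metis eq content_times_primitive_part)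
  then have "smult a (frolov_poly d) = smult a (p * smult (unit_factor a) (primitive_part h))"
    by (simp add: abs_mult_sgn flip: abs_sgn)
  then have fac: "frolov_poly d = p * smult (unit_factor a) (primitive_part h)"
    by (rule smult_cancel[OF ah(1)])
  define h' where "h' = smult (unit_factor a) (primitive_part h)"
  have "h' \<noteq> 0"
    using fac lead_coeff_frolov_poly[OF assms(1)] by (auto simp: h'_def)
  then have "degree h' + degree p = d"
    using fac p0 degree_frolov_poly[of d] by (metis h'_def degree_mult_eq add.commute)
  then show False
    using frolov_poly_no_factor[OF assms(1) fac[folded h'_def] dp] \<open>degree p > 0\<close> by linarith
qed

lemma degree_sum_monom_less:
  fixes h :: "'d::finite \<Rightarrow> nat" and c :: "'d \<Rightarrow> 'a::comm_monoid_add"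
  assumes "\<And>j. h j < d"
  shows "degree (\<Sum>j\<in>UNIV. monom (c j) (h j)) < d"
proof (rule le_less_trans)
  have "0 < d" using assms[of undefined] by simp
  then show "d - 1 < d" by simp
  show "degree (\<Sum>j\<in>UNIV. monom (c j) (h j)) \<le> d - 1"
  proof (rule degree_sum_le)
    fix j
    have "h j \<le> d - 1" using assms[of j] by linarith
    then show "degree (monom (c j) (h j)) \<le> d - 1"
      by (rule order_trans[OF degree_monom_le])
  qed simp
qed

lemma coeff_sum_monom_inj:
  fixes h :: "'d::finite \<Rightarrow> nat" and c :: "'d \<Rightarrow> 'a::comm_monoid_add"
  assumes "inj h"
  shows "coeff (\<Sum>j\<in>UNIV. monom (c j) (h j)) (h i) = c i"
  using assms by (simp add: coeff_sum inj_eq)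

lemma ipoly_real_index:
  fixes h :: "'d::finite \<Rightarrow> nat"
  assumes h: "bij_betw h UNIV {..<d}" and "degree p < d"
  shows "ipoly_real p x = (\<Sum>j\<in>UNIV. of_int (coeff p (h j)) * x ^ h j)"
proof -
  have "{..d - 1} = {..<d}" using assms(2) by auto
  then have "ipoly_real p x = (\<Sum>i<d. of_int (coeff p i) * x ^ i)"
    using ipoly_real_altdef[of p "d - 1" x] assms(2) by simp
  then show ?thesis
    by (simp add: sum.reindex_bij_betw[OF h, of "\<lambda>i. of_int (coeff p i) * x ^ i"])
qed

lemma det_in_Ints:
  fixes N :: "real ^ 'd ^ 'd"
  assumes "\<And>i j. N $ i $ j \<in> \<int>"
  shows "det N \<in> \<int>"
  unfolding det_def using assms by (intro Ints_sum Ints_mult Ints_prod Ints_of_int) auto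

abbreviation abs_norm_form :: "real ^ 'd::finite ^ 'd \<Rightarrow> ('d \<Rightarrow> int) \<Rightarrow> real" where
  "abs_norm_form A m \<equiv> \<bar>\<Prod>i\<in>UNIV. (\<Sum>j\<in>UNIV. A $ i $ j * of_int (m j))\<bar>"

text \<open>The columns of the matrix are the conjugates of a power basis. The product of the coordinates
  of \<^term>\<open>A *v m\<close> is the norm of an algebraic integer: it equals the determinant of the integer matrix
  of multiplication by that integer on the basis.\<close>

theorem norm_form_matrix:
  obtains A :: "real ^ 'd::finite ^ 'd" where "det A \<noteq> 0"
    "\<And>m :: 'd \<Rightarrow> int. m \<noteq> (\<lambda>_. 0) \<Longrightarrow> abs_norm_form A m \<ge> 1"
proof -
  define d where "d = CARD('d)"
  have d: "d > 0" by (simp add: d_def)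
  obtain h :: "'d \<Rightarrow> nat" where h: "bij_betw h UNIV {..<d}"
    using ex_bij_betw_finite_nat[of "UNIV :: 'd set"] by (auto simp: d_def atLeast0LessThan)
  have hlt: "h j < d" for j using h by (auto simp: bij_betw_def)
  have injh: "inj h" using h by (simp add: bij_betw_def)
  obtain \<xi> where \<xi>: "inj_on \<xi> {..<d}" "\<And>i. i < d \<Longrightarrow> ipoly_real (frolov_poly d) (\<xi> i) = 0"
    using frolov_poly_roots[of d] by blast
  define A :: "real ^ 'd ^ 'd" where "A = (\<chi> i j. \<xi> (h i) ^ h j)"
  \<comment> \<open>A Vandermonde argument: a kernel vector of \<open>A\<close> lists the
    coefficients of a polynomial of degree below \<open>d\<close> that vanishes at \<open>d\<close>
    distinct points.\<close>
  have detA: "det A \<noteq> 0"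
  proof
    assume "det A = 0"
    then have "\<not> invertible A" by (simp add: invertible_det_nz)
    then obtain x where x: "A *v x = 0" "x \<noteq> 0"
      using matrix_left_invertible_ker[of A] invertible_left_inverse[of A] by blast
    define p where "p = (\<Sum>j\<in>UNIV. monom (x $ j) (h j))"
    obtain i where "x $ i \<noteq> 0" using x(2) by (metis vec_eq_iff zero_index)
    then have p0: "p \<noteq> 0"
      using coeff_sum_monom_inj[OF injh, of "\<lambda>j. x $ j" i] by (auto simp: p_def)
    have "\<xi> ` {..<d} \<subseteq> {t. poly p t = 0}"
    proof safe
      fix k assume "k < d"
      then obtain i where i: "k = h i" using h by (auto simp: bij_betw_def)
      have "(A *v x) $ i = 0" using x by simp
      then show "poly p (\<xi> k) = 0"
        by (simp add: p_def poly_sum poly_monom i matrix_vector_mult_def A_def mult_ac)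
    qed
    then have "card (\<xi> ` {..<d}) \<le> card {t. poly p t = 0}"
      by (intro card_mono poly_roots_finite p0)
    also have "\<dots> \<le> degree p" by (rule card_poly_roots_bound[OF p0])
    also have "\<dots> < d" unfolding p_def by (rule degree_sum_monom_less) (rule hlt)
    finally show False using card_image[OF \<xi>(1)] by simp
  qed
  moreover have "abs_norm_form A m \<ge> 1"
    if m: "m \<noteq> (\<lambda>_. 0)" for m :: "'d \<Rightarrow> int"
  proof -
    define g where "g = (\<Sum>j\<in>UNIV. monom (m j) (h j))"
    have g0: "g \<noteq> 0"
      using m coeff_sum_monom_inj[OF injh, of m] by (metis coeff_0 g_def)
    have dg: "degree g < d" unfolding g_def by (rule degree_sum_monom_less) (rule hlt)
    have eg: "ipoly_real g (\<xi> (h i)) = (\<Sum>j\<in>UNIV. A $ i $ j * of_int (m j))" for i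
      by (simp add: g_def ipoly_real_sum A_def mult_ac)
    have nz: "ipoly_real g (\<xi> (h i)) \<noteq> 0" for i
      using frolov_poly_root_degree[OF d \<xi>(2)[OF hlt] g0] dg by fastforce
    \<comment> \<open>Reduction of g x^j modulo \<open>frolov_poly d\<close>. Since the divisor is
      monic, pseudo-division is genuine division, and the remainder has integer coefficients: they
      form the column of the multiplication matrix \<open>N\<close> belonging to
      \<open>j\<close>.\<close>
    have "\<exists>r. degree r < d \<and> (\<forall>i. ipoly_real r (\<xi> (h i)) = ipoly_real g (\<xi> (h i)) * \<xi> (h i) ^ h j)" for j
    proof -
      let ?f = "g * monom 1 (h j)"
      have P0: "frolov_poly d \<noteq> 0" using lead_coeff_frolov_poly[OF d] by auto
      obtain q r where qr: "pseudo_divmod ?f (frolov_poly d) = (q, r)" by fastforce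
      have "?f = frolov_poly d * q + r"
        using pseudo_divmod(1)[OF P0 qr] lead_coeff_frolov_poly[OF d] by simp
      then have "ipoly_real ?f (\<xi> (h i)) = ipoly_real (frolov_poly d * q + r) (\<xi> (h i))" for i
        by simp
      then have "ipoly_real r (\<xi> (h i)) = ipoly_real g (\<xi> (h i)) * \<xi> (h i) ^ h j" for i
        using \<xi>(2)[OF hlt] by simp
      moreover have "degree r < d"
        using pseudo_divmod(2)[OF P0 qr] d by (auto simp: degree_frolov_poly)
      ultimately show ?thesis by blast
    qed
    then obtain r where r: "\<And>j. degree (r j) < d"
      "\<And>i j. ipoly_real (r j) (\<xi> (h i)) = ipoly_real g (\<xi> (h i)) * \<xi> (h i) ^ h j"
      by metis
    define N :: "real ^ 'd ^ 'd" where "N = (\<chi> k j. of_int (coeff (r j) (h k)))"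
    define D :: "real ^ 'd ^ 'd" where "D = (\<chi> i j. if i = j then ipoly_real g (\<xi> (h i)) else 0)"
    have "D ** A = A ** N"
    \<comment> \<open>The rows of \<open>A\<close> are left eigenvectors of multiplication by
      \<open>g\<close>, with the conjugates of \<open>g\<close> as eigenvalues.\<close>
    proof -
      have "(D ** A) $ i $ j = (A ** N) $ i $ j" for i j
      proof -
        have "(D ** A) $ i $ j = (\<Sum>k\<in>UNIV. (if i = k then ipoly_real g (\<xi> (h i)) else 0) * A $ k $ j)"
          by (simp add: matrix_matrix_mult_def D_def)
        also have "\<dots> = (\<Sum>k\<in>UNIV. if k = i then ipoly_real g (\<xi> (h i)) * A $ k $ j else 0)"
          by (rule sum.cong) auto
        also have "\<dots> = ipoly_real g (\<xi> (h i)) * \<xi> (h i) ^ h j"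
          by (simp add: A_def)
        also have "\<dots> = (\<Sum>k\<in>UNIV. of_int (coeff (r j) (h k)) * \<xi> (h i) ^ h k)"
          using r(2)[of j i] ipoly_real_index[OF h r(1)[of j]] by metis
        finally show ?thesis
          by (simp add: matrix_matrix_mult_def A_def N_def mult_ac)
      qed
      then show ?thesis by (simp add: vec_eq_iff)
    qed
    then have "det D * det A = det A * det N"
      using det_mul by metis
    then have "det D = det N"
      using detA by simp
    moreover have "det D = (\<Prod>i\<in>UNIV. ipoly_real g (\<xi> (h i)))"
      by (subst det_diagonal) (auto simp: D_def)
    moreover have "det N \<in> \<int>"
      by (rule det_in_Ints) (simp add: N_def)
    ultimately have "(\<Prod>i\<in>UNIV. ipoly_real g (\<xi> (h i))) \<in> \<int>" by simp
    moreover have "(\<Prod>i\<in>UNIV. ipoly_real g (\<xi> (h i))) \<noteq> 0"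
      using nz by (simp add: prod_zero_iff)
    ultimately show ?thesis
      unfolding eg by (rule Ints_nonzero_abs_ge1)
  qed
  ultimately show ?thesis by (rule that)
qed

section \<open>Sums over norm-separated sets\<close>

text \<open>Differentiating the series for exponent k termwise gives coefficients (n + 1)(n + 2)^k,
  which dominate (n + 1)^(k + 1).\<close>

lemma summable_poly_geometric:
  fixes x :: real
  assumes "\<bar>x\<bar> < 1"
  shows "summable (\<lambda>n. real (n + 1) ^ k * x ^ n)"
  using assms
proof (induction k arbitrary: x)
  case 0
  then show ?case by (simp add: summable_geometric)
next
  case (Suc k)
  have "summable (\<lambda>n. diffs (\<lambda>n. real (n + 1) ^ k) n * \<bar>x\<bar> ^ n)"
    by (rule termdiff_converges[where K = 1]) (use Suc in auto)
  then show ?case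
  proof (rule summable_comparison_test'[where N = 0])
    fix n
    have "real (n + 1) ^ k \<le> real (n + 2) ^ k"
      by (intro power_mono) auto
    then show "norm (real (n + 1) ^ Suc k * x ^ n) \<le> diffs (\<lambda>n. real (n + 1) ^ k) n * \<bar>x\<bar> ^ n"
      by (auto simp: diffs_def abs_mult power_abs intro!: mult_mono)
  qed
qed

text \<open>Pigeonhole principle: the box is cut along a single coordinate \<open>i0\<close> into
  slabs of volume 2^L. Two points in one slab would have coordinate differences whose product is
  below that volume, against the separation. Apart from the separation nothing about the structure
  of \<open>K\<close> enters.\<close>

lemma card_box_le:
  fixes K :: "(real ^ 'd::finite) set" and r :: "'d \<Rightarrow> nat"
  assumes K: "finite K" and r: "\<And>x i. x \<in> K \<Longrightarrow> \<bar>x $ i\<bar> < 2 ^ r i"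
    and sep: "\<And>x y. x \<in> K \<Longrightarrow> y \<in> K \<Longrightarrow> x \<noteq> y \<Longrightarrow> (\<Prod>i\<in>UNIV. \<bar>x $ i - y $ i\<bar>) \<ge> 2 ^ L"
    and L: "L \<le> sum r UNIV"
  shows "card K \<le> 2 ^ (sum r UNIV + CARD('d) - L)"
proof -
  \<comment> \<open>The box has volume 2^(sum r + d), so this many slabs give each the volume 2^L;
    \<open>L\<close> keeps the subtraction from being truncated. The map \<open>\<phi>\<close>
    numbers the slabs.\<close>
  define N :: nat where "N = 2 ^ (sum r UNIV + CARD('d) - L)"
  obtain i0 :: 'd where True by simp
  define \<phi> where "\<phi> x = \<lfloor>real N * (x $ i0 + 2 ^ r i0) / 2 ^ (r i0 + 1)\<rfloor>" for x :: "real ^ 'd"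
  have N: "N > 0" by (simp add: N_def)
  have "\<phi> ` K \<subseteq> {0..<int N}"
  proof safe
    fix x assume x: "x \<in> K"
    then have "0 < x $ i0 + 2 ^ r i0" "x $ i0 + 2 ^ r i0 < 2 ^ (r i0 + 1)"
      using r[OF x, of i0] by auto
    then have "0 \<le> real N * (x $ i0 + 2 ^ r i0) / 2 ^ (r i0 + 1)"
      "real N * ((x $ i0 + 2 ^ r i0) / 2 ^ (r i0 + 1)) < real N * 1"
      using N by (intro divide_nonneg_pos mult_nonneg_nonneg mult_strict_left_mono; simp)+
    then show "\<phi> x \<in> {0..<int N}"
      by (auto simp: \<phi>_def floor_less_iff)
  qed
  moreover have "inj_on \<phi> K"
  proof (rule inj_onI, rule ccontr)
    fix x y assume xy: "x \<in> K" "y \<in> K" "\<phi> x = \<phi> y" "x \<noteq> y"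
    have "\<bar>real N * (x $ i0 + 2 ^ r i0) / 2 ^ (r i0 + 1) - real N * (y $ i0 + 2 ^ r i0) / 2 ^ (r i0 + 1)\<bar> < 1"
      using xy(3) unfolding \<phi>_def by linarith
    then have "\<bar>real N * (x $ i0 - y $ i0) / 2 ^ (r i0 + 1)\<bar> < 1"
      by (simp add: diff_divide_distrib[symmetric] right_diff_distrib[symmetric])
    then have 1: "\<bar>x $ i0 - y $ i0\<bar> < 2 ^ (r i0 + 1) / real N"
      using N by (simp add: abs_mult pos_less_divide_eq mult.commute)
    have 2: "(\<Prod>i\<in>UNIV - {i0}. \<bar>x $ i - y $ i\<bar>) \<le> (\<Prod>i\<in>UNIV - {i0}. 2 ^ (r i + 1))"
    proof (rule prod_mono)
      fix i
      show "0 \<le> \<bar>x $ i - y $ i\<bar> \<and> \<bar>x $ i - y $ i\<bar> \<le> 2 ^ (r i + 1)"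
        using r[OF xy(1), of i] r[OF xy(2), of i] by auto
    qed
    have "(\<Prod>i\<in>UNIV. \<bar>x $ i - y $ i\<bar>) = \<bar>x $ i0 - y $ i0\<bar> * (\<Prod>i\<in>UNIV - {i0}. \<bar>x $ i - y $ i\<bar>)"
      by (simp add: prod.remove)
    also have "\<dots> \<le> \<bar>x $ i0 - y $ i0\<bar> * (\<Prod>i\<in>UNIV - {i0}. 2 ^ (r i + 1))"
      using 2 by (intro mult_left_mono) auto
    also have "\<dots> < 2 ^ (r i0 + 1) / real N * (\<Prod>i\<in>UNIV - {i0}. 2 ^ (r i + 1))"
      using 1 by (intro mult_strict_right_mono) (auto intro!: prod_pos)
    also have "\<dots> = (\<Prod>i\<in>UNIV. 2 ^ (r i + 1)) / real N"
      by (subst (2) prod.remove[where x = i0]) auto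
    also have "(\<Prod>i\<in>UNIV. 2 ^ (r i + 1) :: real) = 2 ^ (sum r UNIV + CARD('d))"
      by (simp only: power_sum[symmetric] sum.distrib) simp
    also have "\<dots> / real N = 2 ^ L"
      using L by (simp add: N_def field_simps flip: power_add)
    finally show False using sep[OF xy(1,2,4)] by simp
  qed
  ultimately have "card K \<le> card {0..<int N}"
    by (metis card_image card_mono finite_atLeastLessThan_int)
  then have "card K \<le> N" by simp
  then show ?thesis unfolding N_def .
qed

text \<open>All but one of the entries determine the last one. This is the origin of the exponent d
  - 1 of the logarithm.\<close>

lemma card_compositions_le:
  "finite {r :: 'd::finite \<Rightarrow> nat. sum r UNIV = l}"
  "card {r :: 'd::finite \<Rightarrow> nat. sum r UNIV = l} \<le> (l + 1) ^ (CARD('d) - 1)"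
proof -
  obtain i0 :: 'd where True by simp
  let ?A = "{r :: 'd \<Rightarrow> nat. sum r UNIV = l}"
  let ?f = "\<lambda>r. restrict r (UNIV - {i0})"
  have le: "r i \<le> l" if "r \<in> ?A" for r :: "'d \<Rightarrow> nat" and i
    using that member_le_sum[of i UNIV r] by auto
  have sub: "?f ` ?A \<subseteq> PiE (UNIV - {i0}) (\<lambda>_. {..l})"
    by (intro image_subsetI PiE_I) (use le in \<open>auto simp del: mem_Collect_eq\<close>)
  have inj: "inj_on ?f ?A"
  proof (rule inj_onI, rule ext)
    fix r r' :: "'d \<Rightarrow> nat" and i
    assume r: "r \<in> ?A" "r' \<in> ?A" and eq: "?f r = ?f r'"
    have off: "r j = r' j" if "j \<noteq> i0" for j
      using fun_cong[OF eq, of j] that by simp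
    have "sum r (UNIV - {i0}) = sum r' (UNIV - {i0})"
      by (rule sum.cong) (use off in auto)
    moreover have "r i0 + sum r (UNIV - {i0}) = r' i0 + sum r' (UNIV - {i0})"
      using r by (simp add: sum.remove[symmetric])
    ultimately show "r i = r' i" using off by (cases "i = i0") auto
  qed
  have fin: "finite (PiE (UNIV - {i0}) (\<lambda>_. {..l}))" by (rule finite_PiE) auto
  show "finite ?A" by (rule finite_imageD[OF finite_subset[OF sub fin] inj])
  have "card ?A \<le> card (PiE (UNIV - {i0}) (\<lambda>_. {..l}))"
    by (rule card_inj_on_le[OF inj sub fin])
  also have "\<dots> = (l + 1) ^ (CARD('d) - 1)"
    by (subst card_PiE) auto
  finally show "card ?A \<le> (l + 1) ^ (CARD('d) - 1)" .
qed

text \<open>All |t| < 1 share the value 0, while a value n > 0 means 2^(n - 1) <= |t| < 2^n. Thus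
  2^n is comparable to max 1 |t|, and finitely many blocks cover any bounded set.\<close>

definition dyadic_order :: "real \<Rightarrow> nat" where
  "dyadic_order t = (LEAST n. \<bar>t\<bar> < 2 ^ n)"

lemma dyadic_order: "\<bar>t\<bar> < 2 ^ dyadic_order t" "2 ^ dyadic_order t \<le> 2 * max 1 \<bar>t\<bar>"
proof -
  obtain n where n: "\<bar>t\<bar> < 2 ^ n" using real_arch_pow[of 2 "\<bar>t\<bar>"] by auto
  show "\<bar>t\<bar> < 2 ^ dyadic_order t"
    unfolding dyadic_order_def by (rule LeastI[of "\<lambda>n. \<bar>t\<bar> < 2 ^ n", OF n])
  show "2 ^ dyadic_order t \<le> 2 * max 1 \<bar>t\<bar>"
  proof (cases "dyadic_order t")
    case (Suc m)
    then have "\<not> \<bar>t\<bar> < 2 ^ m"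
      unfolding dyadic_order_def by (metis lessI not_less_Least)
    then show ?thesis using Suc by auto
  qed auto
qed

abbreviation max_one_prod :: "real ^ 'd::finite \<Rightarrow> real" where
  "max_one_prod x \<equiv> \<Prod>i\<in>UNIV. max 1 \<bar>x $ i\<bar>"

text \<open>Points are grouped by their total dyadic level, which is at least L. Level L + i
  consists of at most (L + i + 1)^(d - 1) boxes with at most 2^(i + d) points each, and every
  summand there is at most a constant times 2^(-2s(L + i)). The sum over i converges, so only the
  lowest level determines the order.\<close>

lemma sparse_set_sum_bound:
  fixes s :: nat
  assumes s: "s \<ge> 1"
  obtains C :: real where "C > 0"
    "\<And>L (K :: (real ^ 'd::finite) set). finite K \<Longrightarrow>
      (\<And>x. x \<in> K \<Longrightarrow> (\<Prod>i\<in>UNIV. \<bar>x $ i\<bar>) \<ge> 2 ^ L) \<Longrightarrow>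
      (\<And>x y. x \<in> K \<Longrightarrow> y \<in> K \<Longrightarrow> x \<noteq> y \<Longrightarrow> (\<Prod>i\<in>UNIV. \<bar>x $ i - y $ i\<bar>) \<ge> 2 ^ L) \<Longrightarrow>
      (\<Sum>x\<in>K. 1 / max_one_prod x ^ (2 * s)) \<le> C * real (L + 1) ^ (CARD('d) - 1) / 2 ^ (2 * s * L)"
proof
  define d where "d = CARD('d)"
  define S where "S = (\<Sum>i. real (i + 1) ^ (d - 1) * (1/2) ^ i)"
  define C where "C = 2 ^ (d + 2 * s * d) * S"
  have "S > 0"
    unfolding S_def by (rule suminf_pos[OF summable_poly_geometric]) auto
  then show "C > 0" by (simp add: C_def)
  fix L :: nat and K :: "(real ^ 'd) set"
  assume K: "finite K"
    and big: "\<And>x. x \<in> K \<Longrightarrow> (\<Prod>i\<in>UNIV. \<bar>x $ i\<bar>) \<ge> 2 ^ L"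
    and sep: "\<And>x y. x \<in> K \<Longrightarrow> y \<in> K \<Longrightarrow> x \<noteq> y \<Longrightarrow> (\<Prod>i\<in>UNIV. \<bar>x $ i - y $ i\<bar>) \<ge> 2 ^ L"
  define r where "r x = (\<lambda>i. dyadic_order (x $ i))" for x :: "real ^ 'd"
  define l where "l x = sum (r x) UNIV" for x
  have lL: "L \<le> l x" if "x \<in> K" for x
  proof -
    have "2 ^ L \<le> (\<Prod>i\<in>UNIV. \<bar>x $ i\<bar>)" by (rule big[OF that])
    also have "\<dots> \<le> (\<Prod>i\<in>UNIV. 2 ^ r x i)"
      by (intro prod_mono) (auto simp: r_def intro: less_imp_le dyadic_order)
    also have "\<dots> = 2 ^ l x" by (simp add: l_def power_sum)
    finally show ?thesis by simp
  qed
  have summand: "1 / max_one_prod x ^ (2 * s) \<le> 2 ^ (2 * s * d) / 2 ^ (2 * s * l x)" for x :: "real ^ 'd"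
  proof -
    have "2 ^ l x = (\<Prod>i\<in>UNIV. 2 ^ r x i :: real)" by (simp add: l_def power_sum)
    also have "\<dots> \<le> (\<Prod>i\<in>UNIV. 2 * max 1 \<bar>x $ i\<bar>)"
      by (intro prod_mono) (auto simp: r_def dyadic_order)
    also have "\<dots> = 2 ^ d * max_one_prod x"
      by (simp add: prod.distrib d_def)
    finally have "(2 ^ l x) ^ (2 * s) \<le> (2 ^ d * max_one_prod x) ^ (2 * s)"
      by (intro power_mono) auto
    then have "2 ^ (2 * s * l x) \<le> 2 ^ (2 * s * d) * max_one_prod x ^ (2 * s)"
      by (simp add: power_mult_distrib mult.commute flip: power_mult)
    moreover have "max_one_prod x > 0"
      by (rule prod_pos) auto
    ultimately show ?thesis by (simp add: field_simps)
  qed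
  have count: "real (card {x \<in> K. l x = k}) \<le> real (k + 1) ^ (d - 1) * 2 ^ (k + d - L)" if "L \<le> k" for k
  proof -
    let ?R = "{\<rho> :: 'd \<Rightarrow> nat. sum \<rho> UNIV = k}"
    have eq: "{x \<in> K. l x = k} = (\<Union>\<rho>\<in>?R. {x \<in> K. r x = \<rho>})"
      by (auto simp: l_def)
    have "card {x \<in> K. l x = k} \<le> (\<Sum>\<rho>\<in>?R. card {x \<in> K. r x = \<rho>})"
      unfolding eq by (rule card_UN_le[OF card_compositions_le(1)])
    also have "\<dots> \<le> (\<Sum>\<rho>\<in>?R. 2 ^ (k + d - L))"
    proof (rule sum_mono)
      fix \<rho> assume \<rho>: "\<rho> \<in> ?R"
      show "card {x \<in> K. r x = \<rho>} \<le> 2 ^ (k + d - L)"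
        using card_box_le[of "{x \<in> K. r x = \<rho>}" \<rho> L] K \<rho> sep that dyadic_order(1)
        by (fastforce simp: d_def r_def)
    qed
    also have "\<dots> \<le> (k + 1) ^ (d - 1) * 2 ^ (k + d - L)"
      using card_compositions_le(2)[where ?'d = 'd, of k] by (simp add: d_def)
    finally show ?thesis
      by (metis (mono_tags) of_nat_le_iff of_nat_mult of_nat_numeral of_nat_power)
  qed
  have inj: "inj_on (\<lambda>k. k - L) (l ` K)"
    by (rule inj_on_diff_nat) (use lL in auto)
  have "(\<Sum>x\<in>K. 1 / max_one_prod x ^ (2 * s)) \<le> (\<Sum>x\<in>K. 2 ^ (2 * s * d) / 2 ^ (2 * s * l x))"
    by (intro sum_mono summand)
  also have "\<dots> = (\<Sum>k\<in>l ` K. \<Sum>x\<in>{x \<in> K. l x = k}. 2 ^ (2 * s * d) / 2 ^ (2 * s * l x))"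
    by (rule sum.image_gen[OF K])
  also have "\<dots> = (\<Sum>k\<in>l ` K. real (card {x \<in> K. l x = k}) * (2 ^ (2 * s * d) / 2 ^ (2 * s * k)))"
    by (intro sum.cong) auto
  also have "\<dots> \<le> (\<Sum>k\<in>l ` K. (2 ^ (d + 2 * s * d) * real (L + 1) ^ (d - 1) / 2 ^ (2 * s * L)) *
      (real (k - L + 1) ^ (d - 1) * (1/2) ^ (k - L)))"
  proof (rule sum_mono)
    fix k assume "k \<in> l ` K"
    then have Lk: "L \<le> k" using lL by auto
    then obtain i where i: "k = L + i" using le_Suc_ex by blast
    \<comment> \<open>Separates the dependence on \<open>L\<close> from that on \<open>i\<close>, so
      that the remaining series in \<open>i\<close> is a constant.\<close>
    have "real (k + 1) \<le> real (L + 1) * real (i + 1)"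
      by (simp add: i algebra_simps)
    then have "real (k + 1) ^ (d - 1) \<le> (real (L + 1) * real (i + 1)) ^ (d - 1)"
      by (intro power_mono) auto
    then have a: "real (card {x \<in> K. l x = k}) \<le> (real (L + 1) * real (i + 1)) ^ (d - 1) * 2 ^ (i + d)"
      using count[OF Lk] by (auto simp: i intro: order_trans mult_right_mono)
    \<comment> \<open>Here s >= 1 enters: the growth 2^i of the number of points is beaten by
      2^(-2si), leaving at most 2^(-i).\<close>
    have "2 ^ (i + i) \<le> (2 ^ (2 * s * i) :: real)"
      using s by (intro power_increasing) (auto simp flip: mult_2)
    then have b: "2 ^ i / 2 ^ (2 * s * i) \<le> (1 / 2 ^ i :: real)"
      by (simp add: field_simps power_add)
    have "real (card {x \<in> K. l x = k}) * (2 ^ (2 * s * d) / 2 ^ (2 * s * k)) \<le>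
      ((real (L + 1) * real (i + 1)) ^ (d - 1) * 2 ^ (i + d)) * (2 ^ (2 * s * d) / 2 ^ (2 * s * k))"
      using a by (intro mult_right_mono) auto
    also have "\<dots> = (2 ^ (d + 2 * s * d) * real (L + 1) ^ (d - 1) / 2 ^ (2 * s * L)) * real (i + 1) ^ (d - 1) * (2 ^ i / 2 ^ (2 * s * i))"
      unfolding i power_mult_distrib[of "real (L + 1)"] add_mult_distrib2 power_add by simp
    also have "\<dots> \<le> (2 ^ (d + 2 * s * d) * real (L + 1) ^ (d - 1) / 2 ^ (2 * s * L)) * real (i + 1) ^ (d - 1) * (1 / 2 ^ i)"
      using b by (intro mult_left_mono) auto
    finally show "real (card {x \<in> K. l x = k}) * (2 ^ (2 * s * d) / 2 ^ (2 * s * k)) \<le>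
      (2 ^ (d + 2 * s * d) * real (L + 1) ^ (d - 1) / 2 ^ (2 * s * L)) * (real (k - L + 1) ^ (d - 1) * (1/2) ^ (k - L))"
      by (simp add: i power_divide)
  qed
  also have "\<dots> = (2 ^ (d + 2 * s * d) * real (L + 1) ^ (d - 1) / 2 ^ (2 * s * L)) *
      (\<Sum>i\<in>(\<lambda>k. k - L) ` l ` K. real (i + 1) ^ (d - 1) * (1/2) ^ i)"
    unfolding sum_distrib_left sum.reindex[OF inj] o_def ..
  also have "\<dots> \<le> (2 ^ (d + 2 * s * d) * real (L + 1) ^ (d - 1) / 2 ^ (2 * s * L)) * S"
    unfolding S_def using K
    by (intro mult_left_mono sum_le_suminf[OF summable_poly_geometric]) auto
  finally show "(\<Sum>x\<in>K. 1 / max_one_prod x ^ (2 * s)) \<le> C * real (L + 1) ^ (CARD('d) - 1) / 2 ^ (2 * s * L)"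
    by (simp add: C_def d_def mult_ac)
qed

section \<open>Characters on boxes and linear changes of variables\<close>

text \<open>Lebesgue measure on vectors is the image of the product measure over
  \<open>Basis\<close>, whose elements \<open>axis i 1\<close> correspond to the coordinates; so
  Fubini for finite products applies after reindexing.\<close>

lemma
  fixes g :: "'d::finite \<Rightarrow> real \<Rightarrow> complex"
  assumes g: "\<And>i. integrable lborel (g i)"
  shows integrable_prod_vec: "integrable lborel (\<lambda>y :: real ^ 'd. \<Prod>i\<in>UNIV. g i (y $ i))"
    and integral_prod_vec: "(LINT y|lborel. (\<Prod>i\<in>UNIV. g i ((y :: real ^ 'd) $ i))) = (\<Prod>i\<in>UNIV. LINT t|lborel. g i t)"
proof -
  interpret product_sigma_finite "\<lambda>_ :: real ^ 'd. lborel :: real measure" ..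
  let ?e = "\<lambda>i :: 'd. axis i (1 :: real)"
  let ?T = "\<lambda>f. \<Sum>b\<in>Basis. f b *\<^sub>R (b :: real ^ 'd)"
  have inj: "inj ?e" by (auto simp: inj_on_def axis_eq_axis)
  have Basis: "Basis = range ?e" by (auto simp: Basis_vec_def)
  define G where "G b = g (inv ?e b)" for b
  have G: "G (?e i) = g i" for i by (simp add: G_def inv_f_f[OF inj])
  have T: "?T f $ i = f (?e i)" for f i
    unfolding Basis sum.reindex[OF inj] o_def
    by (simp add: axis_def if_distrib cong: if_cong)
  have eq: "(\<Prod>i\<in>UNIV. g i (?T f $ i)) = (\<Prod>b\<in>Basis. G b (f b))" for f
    unfolding Basis prod.reindex[OF inj] o_def G by (simp only: T Basis[symmetric])
  have [measurable]: "g i \<in> borel_measurable borel" for i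
    using borel_measurable_integrable[OF g[of i]] by simp
  have GI: "integrable lborel (G b)" for b
    unfolding G_def by (rule g)
  have "integrable (Pi\<^sub>M Basis (\<lambda>_. lborel)) (\<lambda>f. \<Prod>b\<in>Basis. G b (f b))"
    by (rule product_integrable_prod) (auto simp: GI)
  then show "integrable lborel (\<lambda>y :: real ^ 'd. \<Prod>i\<in>UNIV. g i (y $ i))"
    by (subst lborel_eq, subst integrable_distr_eq) (simp_all add: eq del: sum_component)
  have "(LINT f|Pi\<^sub>M Basis (\<lambda>_. lborel). (\<Prod>b\<in>Basis. G b (f b))) = (\<Prod>b\<in>Basis. LINT t|lborel. G b t)"
    by (rule product_integral_prod) (auto simp: GI)
  also have "\<dots> = (\<Prod>i\<in>UNIV. LINT t|lborel. g i t)"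
    unfolding Basis prod.reindex[OF inj] o_def G ..
  finally show "(LINT y|lborel. (\<Prod>i\<in>UNIV. g i ((y :: real ^ 'd) $ i))) = (\<Prod>i\<in>UNIV. LINT t|lborel. g i t)"
    by (subst lborel_eq, subst integral_distr) (simp_all add: eq del: sum_component)
qed

lemma cis_has_vector_derivative:
  "((\<lambda>t. cis (w * t)) has_vector_derivative \<i> * of_real w * cis (w * t)) (at t within S)"
proof -
  have eq: "cis (w * t) = exp (t *\<^sub>R (\<i> * of_real w))" for t
    by (simp add: cis_conv_exp scaleR_conv_of_real mult_ac)
  show ?thesis
    unfolding eq using exp_scaleR_has_vector_derivative_right[of "\<i> * of_real w" t S]
    by (simp add: mult.commute)
qed

lemma integral_cis_period:
  fixes j :: int and b :: real and n :: nat
  shows "has_bochner_integral lborel (\<lambda>t. indicator {b..<b + real n} t *\<^sub>R cis (2 * pi * of_int j * t))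
    (if j = 0 then of_nat n else 0)"
proof (rule has_bochner_integralI_AE)
  \<comment> \<open>The fundamental theorem of calculus is stated for closed intervals; the extra
    endpoint is a null set.\<close>
  show "AE t in lborel. indicator {b..b + real n} t *\<^sub>R cis (2 * pi * of_int j * t) =
      indicator {b..<b + real n} t *\<^sub>R cis (2 * pi * of_int j * t)"
    using AE_lborel_singleton[of "b + real n"] by eventually_elim (auto simp: indicator_def)
  show "has_bochner_integral lborel (\<lambda>t. indicator {b..b + real n} t *\<^sub>R cis (2 * pi * of_int j * t))
    (if j = 0 then of_nat n else 0)"
  proof (cases "j = 0")
    case True
    have "has_bochner_integral lborel (\<lambda>t. indicator {b..b + real n} t *\<^sub>R (1::complex)) (of_real (b + real n) - of_real b)"
      by (rule has_bochner_integral_FTC_Icc)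
        (auto intro!: derivative_eq_intros continuous_intros simp: has_vector_derivative_def scaleR_conv_of_real fun_eq_iff)
    then show ?thesis using True by simp
  next
    case False
    let ?w = "2 * pi * of_int j :: real"
    let ?F = "\<lambda>t. cis (?w * t) / (\<i> * of_real ?w)"
    have nz: "?w \<noteq> 0" using False by simp
    have "has_bochner_integral lborel (\<lambda>t. indicator {b..b + real n} t *\<^sub>R cis (?w * t)) (?F (b + real n) - ?F b)"
    proof (rule has_bochner_integral_FTC_Icc)
      fix t
      have "(?F has_vector_derivative (\<i> * of_real ?w * cis (?w * t)) / (\<i> * of_real ?w)) (at t within {b..b + real n})"
        by (rule has_vector_derivative_divide[OF cis_has_vector_derivative])
      then show "(?F has_vector_derivative cis (?w * t)) (at t within {b..b + real n})"
        using nz by simp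
    qed (auto intro!: continuous_intros)
    moreover have "cis (?w * (b + real n)) = cis (?w * b)"
    proof -
      have "cis (?w * (b + real n)) = cis (?w * b) * cis (2 * pi * of_int (j * int n))"
        by (simp add: cis_mult algebra_simps)
      then show ?thesis by (simp add: cis_multiple_2pi)
    qed
    ultimately show ?thesis using False by simp
  qed
  show "(\<lambda>t. indicator {b..<b + real n} t *\<^sub>R cis (2 * pi * of_int j * t)) \<in> borel_measurable lborel"
    unfolding cis_conv_exp by measurable
qed

section \<open>Characters and Parseval's identity\<close>

definition character :: "('d::finite \<Rightarrow> int) \<Rightarrow> real ^ 'd \<Rightarrow> complex" where
  "character m y = cis (2 * pi * (\<Sum>i\<in>UNIV. of_int (m i) * y $ i))"

lemma cis_sum: "finite A \<Longrightarrow> cis (\<Sum>i\<in>A. f i) = (\<Prod>i\<in>A. cis (f i))"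
  by (induction A rule: finite_induct) (simp_all add: cis_mult[symmetric])

lemma character_altdef: "character m y = (\<Prod>i\<in>UNIV. cis (2 * pi * of_int (m i) * y $ i))"
  by (simp add: character_def sum_distrib_left cis_sum mult.assoc)

lemma continuous_on_character [continuous_intros]: "continuous_on S (character m)"
  unfolding character_def by (intro continuous_intros)

lemma character_zero [simp]: "character (\<lambda>_. 0) y = 1"
  by (simp add: character_def)

lemma character_mult_cnj: "character m y * cnj (character m' y) = character (\<lambda>i. m i - m' i) y"
  by (simp add: character_def cis_cnj cis_mult left_diff_distrib sum_subtractf right_diff_distrib)

text \<open>Half-open, so that translates of the unit box by integer vectors tile the space without
  overlap.\<close>

definition hbox :: "real ^ 'd::finite \<Rightarrow> real \<Rightarrow> (real ^ 'd) set" where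
  "hbox b r = {y. \<forall>i. y $ i \<in> {b $ i..<b $ i + r}}"

lemma sets_hbox [measurable]: "hbox b r \<in> sets borel"
  unfolding hbox_def by measurable

lemma indicator_hbox:
  "indicator (hbox b r) y = (\<Prod>i\<in>UNIV. indicator {b $ i..<b $ i + r} (y $ i) :: 'a::comm_semiring_1)"
proof (cases "y \<in> hbox b r")
  case False
  then obtain i where "y $ i \<notin> {b $ i..<b $ i + r}" by (auto simp: hbox_def)
  then have "indicator {b $ i..<b $ i + r} (y $ i) = (0 :: 'a)" by simp
  then have "(\<Prod>i\<in>UNIV. indicator {b $ i..<b $ i + r} (y $ i)) = (0 :: 'a)"
    by (intro prod_zero bexI[of _ i]) auto
  with False show ?thesis by simp
next
  case True
  then have "y $ i \<in> {b $ i..<b $ i + r}" for i by (simp add: hbox_def)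
  then show ?thesis using True by simp
qed

lemma integral_character:
  fixes m :: "'d::finite \<Rightarrow> int"
  shows "has_bochner_integral lborel (\<lambda>y. indicator (hbox b (real n)) y *\<^sub>R character m y)
    (if m = (\<lambda>_. 0) then of_nat n ^ CARD('d) else 0)"
proof -
  let ?g = "\<lambda>i t. indicator {b $ i..<b $ i + real n} t *\<^sub>R cis (2 * pi * of_int (m i) * t)"
  have eq: "indicator (hbox b (real n)) y *\<^sub>R character m y = (\<Prod>i\<in>UNIV. ?g i (y $ i))" for y
    by (simp add: indicator_hbox character_altdef scaleR_conv_of_real prod.distrib)
  have g: "has_bochner_integral lborel (?g i) (if m i = 0 then of_nat n else 0)" for i
    by (rule integral_cis_period)
  then have gi: "integrable lborel (?g i)" and gv: "(LINT t|lborel. ?g i t) = (if m i = 0 then of_nat n else 0)" for i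
    using has_bochner_integral_iff by blast+
  have "(\<Prod>i\<in>UNIV. if m i = 0 then of_nat n else 0) = (if m = (\<lambda>_. 0) then of_nat n ^ CARD('d) else 0 :: complex)"
  proof (cases "m = (\<lambda>_. 0)")
    case False
    then obtain i where "m i \<noteq> 0" by blast
    then have "(\<Prod>i\<in>UNIV. if m i = 0 then of_nat n else 0) = (0::complex)"
      by (intro prod_zero) (auto intro!: bexI[of _ i])
    with False show ?thesis by simp
  qed simp
  then show ?thesis
    unfolding has_bochner_integral_iff eq
    using integrable_prod_vec[of ?g, OF gi] integral_prod_vec[of ?g, OF gi] gv by simp
qed

text \<open>Parseval's identity: the squared modulus expands into characters with frequency m - m',
  whose integrals over whole periods vanish off the diagonal; a box of integer side n contains n^d
  periods.\<close>

lemma integral_norm_trig_poly: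
  fixes F :: "('d::finite \<Rightarrow> int) set" and c :: "('d \<Rightarrow> int) \<Rightarrow> complex"
  assumes "finite F"
  shows "has_bochner_integral lborel
    (\<lambda>y. indicator (hbox b (real n)) y * (norm (\<Sum>m\<in>F. c m * character m y))\<^sup>2)
    (real n ^ CARD('d) * (\<Sum>m\<in>F. (norm (c m))\<^sup>2))"
proof -
  let ?I = "indicator (hbox b (real n))"
  have "has_bochner_integral lborel (\<lambda>y. \<Sum>m\<in>F. \<Sum>m'\<in>F. (c m * cnj (c m')) * (?I y *\<^sub>R character (\<lambda>i. m i - m' i) y))
     (\<Sum>m\<in>F. \<Sum>m'\<in>F. (c m * cnj (c m')) * (if (\<lambda>i. m i - m' i) = (\<lambda>_. 0) then of_nat n ^ CARD('d) else 0))"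
    by (intro has_bochner_integral_sum has_bochner_integral_mult_right integral_character)
  also have "(\<Sum>m\<in>F. \<Sum>m'\<in>F. (c m * cnj (c m')) * (if (\<lambda>i. m i - m' i) = (\<lambda>_. 0) then of_nat n ^ CARD('d) else 0))
      = (\<Sum>m\<in>F. \<Sum>m'\<in>F. if m' = m then (c m * cnj (c m')) * of_nat n ^ CARD('d) else 0)"
    by (intro sum.cong refl) (auto simp: fun_eq_iff)
  also have "\<dots> = of_real (real n ^ CARD('d) * (\<Sum>m\<in>F. (norm (c m))\<^sup>2))"
    using assms by (simp add: sum_distrib_left complex_norm_square[symmetric] mult.commute)
  finally have *: "has_bochner_integral lborel (\<lambda>y. \<Sum>m\<in>F. \<Sum>m'\<in>F. (c m * cnj (c m')) * (?I y *\<^sub>R character (\<lambda>i. m i - m' i) y))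
     (of_real (real n ^ CARD('d) * (\<Sum>m\<in>F. (norm (c m))\<^sup>2)))" .
  have "(\<Sum>m\<in>F. \<Sum>m'\<in>F. (c m * cnj (c m')) * (?I y *\<^sub>R character (\<lambda>i. m i - m' i) y)) =
    of_real (?I y * (norm (\<Sum>m\<in>F. c m * character m y))\<^sup>2)" for y
  proof -
    have "of_real ((norm (\<Sum>m\<in>F. c m * character m y))\<^sup>2) =
       (\<Sum>m\<in>F. c m * character m y) * cnj (\<Sum>m\<in>F. c m * character m y)"
      by (rule complex_norm_square)
    also have "\<dots> = (\<Sum>m\<in>F. \<Sum>m'\<in>F. (c m * character m y) * (cnj (c m') * cnj (character m' y)))"
      by (simp add: cnj_sum sum_product)
    also have "\<dots> = (\<Sum>m\<in>F. \<Sum>m'\<in>F. (c m * cnj (c m')) * character (\<lambda>i. m i - m' i) y)"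
      by (intro sum.cong refl) (simp add: character_mult_cnj[symmetric])
    finally show ?thesis
      by (simp add: scaleR_conv_of_real sum_distrib_left mult_ac)
  qed
  with * have "has_bochner_integral lborel (\<lambda>y. complex_of_real (?I y * (norm (\<Sum>m\<in>F. c m * character m y))\<^sup>2))
     (of_real (real n ^ CARD('d) * (\<Sum>m\<in>F. (norm (c m))\<^sup>2)))"
    by simp
  from has_bochner_integral_bounded_linear[OF bounded_linear_Re this] show ?thesis
    by (simp only: Re_complex_of_real)
qed

text \<open>Uniqueness of Lebesgue measure among translation invariant measures: both sides are obtained by
  integrating the indicator of \<^term>\<open>{(x, y). x \<in> E \<and> x + T y \<in> F}\<close> in the two possible orders.\<close>

lemma emeasure_vimage_linear_exchange:
  fixes T :: "'a::euclidean_space \<Rightarrow> 'a" and E F :: "'a set"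
  assumes T: "linear T" "bij T" and E [measurable]: "E \<in> sets borel" and F [measurable]: "F \<in> sets borel"
  shows "emeasure lborel E * emeasure lborel (T -` F) = emeasure lborel F * emeasure lborel (T -` E)"
proof -
  have [measurable]: "T \<in> borel_measurable borel"
    using T by (intro borel_measurable_continuous_onI linear_continuous_on linear_conv_bounded_linear[THEN iffD1])
  have surj: "\<exists>z. x = T z" for x using T(2) by (metis bij_def surj_def)
  \<comment> \<open>Writing \<open>x = T z\<close> turns the translation by \<open>x\<close> in the
    image into a translation by \<open>z\<close> in the domain, under which Lebesgue measure is
    invariant. This is where surjectivity is used.\<close>
  have shift: "(\<integral>\<^sup>+y. indicator F (x + T y) \<partial>lborel) = emeasure lborel (T -` F)" if [measurable]: "F \<in> sets borel" for x F
  proof -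
    obtain z where z: "x = T z" using surj by blast
    have "emeasure lborel (T -` F) = (\<integral>\<^sup>+y. indicator F (T y) \<partial>distr lborel borel ((+) z))"
    proof -
      have "T -` F \<in> sets borel"
        using measurable_sets[of T borel borel F] by simp
      then have "emeasure lborel (T -` F) = (\<integral>\<^sup>+y. indicator (T -` F) y \<partial>lborel)"
        by simp
      also have "\<dots> = (\<integral>\<^sup>+y. indicator F (T y) \<partial>distr lborel borel ((+) z))"
        unfolding lborel_distr_plus by (rule nn_integral_cong) (simp add: indicator_def)
      finally show ?thesis .
    qed
    also have "\<dots> = (\<integral>\<^sup>+y. indicator F (T (z + y)) \<partial>lborel)"
      by (subst nn_integral_distr) auto
    finally show ?thesis by (simp add: z linear_add[OF T(1)])
  qed
  have reflect: "(\<integral>\<^sup>+y. indicator E (x - T y) \<partial>lborel) = emeasure lborel (T -` E)" for x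
  proof -
    have "(\<integral>\<^sup>+y. indicator E (x - T y) \<partial>lborel) = (\<integral>\<^sup>+y. indicator E (x + T (-1 *\<^sub>R y)) \<partial>lborel)"
      using linear_scale[OF T(1), of "-1"] by simp
    also have "\<dots> = (\<integral>\<^sup>+y. indicator E (x + T y) \<partial>distr lborel borel (\<lambda>y. 0 + -1 *\<^sub>R y))"
      by (subst nn_integral_distr) auto
    also have "distr lborel borel (\<lambda>y. 0 + -1 *\<^sub>R y) = (lborel :: 'a measure)"
      using lborel_affine[of "-1" "0 :: 'a"] by (simp add: density_1)
    finally show ?thesis by (simp add: shift)
  qed
  have "emeasure lborel E * emeasure lborel (T -` F) = (\<integral>\<^sup>+x. indicator E x * (\<integral>\<^sup>+y. indicator F (x + T y) \<partial>lborel) \<partial>lborel)"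
    by (subst shift) (auto simp: nn_integral_multc)
  also have "\<dots> = (\<integral>\<^sup>+x. \<integral>\<^sup>+y. indicator E x * indicator F (x + T y) \<partial>lborel \<partial>lborel)"
    by (subst nn_integral_cmult) auto
  also have "\<dots> = (\<integral>\<^sup>+y. \<integral>\<^sup>+x. indicator E x * indicator F (x + T y) \<partial>lborel \<partial>lborel)"
    by (rule lborel_pair.Fubini'[symmetric]) simp
  also have "\<dots> = (\<integral>\<^sup>+y. \<integral>\<^sup>+x. indicator E (x - T y) * indicator F x \<partial>lborel \<partial>lborel)"
  proof (rule nn_integral_cong)
    fix y
    have "(\<integral>\<^sup>+x. indicator E (x - T y) * indicator F x \<partial>lborel) =
      (\<integral>\<^sup>+x. indicator E (x - T y) * indicator F x \<partial>distr lborel borel ((+) (T y)))"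
      by (subst lborel_distr_plus) simp
    also have "\<dots> = (\<integral>\<^sup>+x. indicator E x * indicator F (x + T y) \<partial>lborel)"
      by (subst nn_integral_distr) (auto simp: add.commute)
    finally show "(\<integral>\<^sup>+x. indicator E x * indicator F (x + T y) \<partial>lborel) =
      (\<integral>\<^sup>+x. indicator E (x - T y) * indicator F x \<partial>lborel)" ..
  qed
  also have "\<dots> = (\<integral>\<^sup>+x. \<integral>\<^sup>+y. indicator E (x - T y) * indicator F x \<partial>lborel \<partial>lborel)"
    by (rule lborel_pair.Fubini') simp
  also have "\<dots> = (\<integral>\<^sup>+x. (\<integral>\<^sup>+y. indicator E (x - T y) \<partial>lborel) * indicator F x \<partial>lborel)"
    by (subst nn_integral_multc) auto
  also have "\<dots> = emeasure lborel F * emeasure lborel (T -` E)"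
    unfolding reflect by (subst mult.commute, subst nn_integral_cmult) simp_all
  finally show ?thesis .
qed

text \<open>The unit cube has measure 1, so taking it as \<open>E\<close> in the exchange identity
  makes the measure of a preimage proportional to the measure of the set. The factor
  \<open>c\<close> is the measure of the preimage of the cube, that is, the reciprocal of |det
  T|.\<close>

lemma lborel_distr_linear:
  fixes T :: "'a::euclidean_space \<Rightarrow> 'a"
  assumes T: "linear T" "bij T"
  obtains c :: real where "c > 0" "distr lborel borel T = density lborel (\<lambda>_. ennreal c)"
proof -
  have Tm [measurable]: "T \<in> borel_measurable borel"
    using T by (intro borel_measurable_continuous_onI linear_continuous_on linear_conv_bounded_linear[THEN iffD1])
  let ?E = "cbox 0 One :: 'a set"
  have E: "emeasure lborel ?E = 1"
    by (simp add: emeasure_lborel_cbox)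
  have sets_T: "T -` F \<in> sets borel" if "F \<in> sets borel" for F
    using measurable_sets[OF Tm that] by simp
  have scale: "emeasure lborel (T -` F) = emeasure lborel F * emeasure lborel (T -` ?E)" if "F \<in> sets borel" for F
    using emeasure_vimage_linear_exchange[OF T _ that, of ?E] E by simp
  have "linear (inv T)"
    using T by (intro inj_linear_imp_inv_linear) (auto simp: bij_def)
  then have "bounded (inv T ` ?E)"
    by (intro bounded_linear_image) (auto simp: linear_conv_bounded_linear)
  moreover have "T -` ?E = inv T ` ?E"
    using bij_vimage_eq_inv_image[OF T(2)] .
  ultimately have fin: "emeasure lborel (T -` ?E) < \<infinity>"
    using emeasure_bounded_finite by metis
  \<comment> \<open>Otherwise the preimage of \<open>UNIV\<close>, which is the whole space, would
    be a null set.\<close>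
  have pos: "emeasure lborel (T -` ?E) \<noteq> 0"
    using scale[of UNIV] by (auto simp: emeasure_lborel_UNIV)
  show ?thesis
  proof
    let ?c = "enn2real (emeasure lborel (T -` ?E))"
    have c: "ennreal ?c = emeasure lborel (T -` ?E)"
      using fin by simp
    show "?c > 0"
      using fin pos by (simp add: enn2real_positive_iff zero_less_iff_neq_zero)
    show "distr lborel borel T = density lborel (\<lambda>_. ennreal ?c)"
    proof (rule measure_eqI)
      fix F assume "F \<in> sets (distr lborel borel T)"
      then have F: "F \<in> sets borel" by simp
      then show "emeasure (distr lborel borel T) F = emeasure (density lborel (\<lambda>_. ennreal ?c)) F"
        using scale[OF F] by (simp add: emeasure_distr emeasure_density_const c mult.commute)
    qed simp
  qed
qed

text \<open>The constant depends on \<open>T\<close> alone; the dilation contributes exactly a^(-d).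
  This uniformity in \<open>a\<close> lets the density of the lattice grow later without changing
  constants.\<close>

lemma integral_scaled_linear:
  fixes T :: "'a::euclidean_space \<Rightarrow> 'a"
  assumes T: "linear T" "bij T"
  obtains c :: real where "c > 0"
    "\<And>(f :: 'a \<Rightarrow> real) a. integrable lborel f \<Longrightarrow> a > 0 \<Longrightarrow>
      has_bochner_integral lborel (\<lambda>x. f (a *\<^sub>R T x)) (c / a ^ DIM('a) * integral\<^sup>L lborel f)"
proof -
  have Tm [measurable]: "T \<in> borel_measurable borel"
    using T by (intro borel_measurable_continuous_onI linear_continuous_on linear_conv_bounded_linear[THEN iffD1])
  obtain c where c: "c > 0" "distr lborel borel T = density lborel (\<lambda>_. ennreal c)"
    using lborel_distr_linear[OF T] .
  show ?thesis
  proof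
    fix f :: "'a \<Rightarrow> real" and a :: real
    assume f: "integrable lborel f" and a: "a > 0"
    have [measurable]: "f \<in> borel_measurable borel"
      using borel_measurable_integrable[OF f] by simp
    have aff: "lborel = density (distr lborel borel (\<lambda>x :: 'a. a *\<^sub>R x)) (\<lambda>_. ennreal (a ^ DIM('a)))"
      using lborel_affine[of a "0 :: 'a"] a by simp
    have "integrable (density (distr lborel borel (\<lambda>x :: 'a. a *\<^sub>R x)) (\<lambda>_. ennreal (a ^ DIM('a)))) f"
      using f aff by simp
    then have 1: "integrable lborel (\<lambda>x. f (a *\<^sub>R x))"
      using a by (simp add: integrable_density integrable_distr_eq)
    have "integral\<^sup>L lborel f = integral\<^sup>L (density (distr lborel borel (\<lambda>x :: 'a. a *\<^sub>R x)) (\<lambda>_. ennreal (a ^ DIM('a)))) f"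
      using aff by simp
    also have "\<dots> = a ^ DIM('a) * (LINT x|lborel. f (a *\<^sub>R x))"
      using a by (simp add: integral_density integral_distr)
    finally have 2: "(LINT x|lborel. f (a *\<^sub>R x)) = integral\<^sup>L lborel f / a ^ DIM('a)"
      using a by simp
    have "integrable (distr lborel borel T) (\<lambda>x. f (a *\<^sub>R x))"
      using 1 c by (simp add: integrable_density)
    then have 3: "integrable lborel (\<lambda>x. f (a *\<^sub>R T x))"
      by (simp add: integrable_distr_eq)
    have "(LINT x|lborel. f (a *\<^sub>R T x)) = (LINT x|distr lborel borel T. f (a *\<^sub>R x))"
      by (simp add: integral_distr)
    also have "\<dots> = c * (LINT x|lborel. f (a *\<^sub>R x))"
      using c by (simp add: integral_density)
    finally show "has_bochner_integral lborel (\<lambda>x. f (a *\<^sub>R T x)) (c / a ^ DIM('a) * integral\<^sup>L lborel f)"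
      using 2 3 by (simp add: has_bochner_integral_iff)
  qed (rule c)
qed

section \<open>A concentrating trigonometric kernel\<close>

text \<open>The de la Vallee-Poussin kernel. The factor in front normalises the mean over a period
  to 1; an even power of a cosine is nonnegative, and its Fourier coefficients are binomial
  coefficients, hence nonnegative as well.\<close>

definition cos_kernel :: "nat \<Rightarrow> real \<Rightarrow> real" where
  "cos_kernel N t = 4 ^ N / real (2 * N choose N) * cos (pi * t) ^ (2 * N)"

text \<open>The frequencies run from -N to N, so the shift by \<open>N\<close> makes
  \<open>nat\<close> exact on the range of the expansion. Division by the central, largest binomial
  coefficient yields values in [0, 1] with value 1 at frequency 0.\<close>

definition cos_kernel_coeff :: "nat \<Rightarrow> int \<Rightarrow> real" where
  "cos_kernel_coeff N j = real (2 * N choose nat (j + int N)) / real (2 * N choose N)"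

lemma central_binomial_pos: "(2 * N choose N) > 0"
  by (simp add: zero_less_binomial)

lemma cos_kernel_coeff:
  "0 \<le> cos_kernel_coeff N j" "cos_kernel_coeff N j \<le> 1" "cos_kernel_coeff N 0 = 1"
  using central_binomial_pos[of N] binomial_maximum[of "2 * N" "nat (j + int N)"]
  by (auto simp: cos_kernel_coeff_def)

text \<open>The binomial theorem for the power 2N of (cis(pi t) + cis(-pi t)) / 2; the k-th term has
  frequency k - N.\<close>

lemma cos_kernel_expand:
  "complex_of_real (cos_kernel N t) =
    (\<Sum>j\<in>{- int N..int N}. of_real (cos_kernel_coeff N j) * cis (2 * pi * of_int j * t))"
proof -
  have "complex_of_real (cos (pi * t)) = (cis (pi * t) + cis (- (pi * t))) / 2"
    by (simp add: complex_eq_iff)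
  then have "complex_of_real (cos (pi * t) ^ (2 * N)) = ((cis (pi * t) + cis (- (pi * t))) / 2) ^ (2 * N)"
    by (simp only: of_real_power)
  also have "\<dots> = (cis (pi * t) + cis (- (pi * t))) ^ (2 * N) / 4 ^ N"
    by (simp add: power_divide power_mult)
  also have "(cis (pi * t) + cis (- (pi * t))) ^ (2 * N) =
      (\<Sum>k\<le>2 * N. of_nat (2 * N choose k) * cis (pi * t) ^ k * cis (- (pi * t)) ^ (2 * N - k))"
    by (rule binomial_ring)
  also have "\<dots> = (\<Sum>j\<in>{- int N..int N}. of_nat (2 * N choose nat (j + int N)) * cis (2 * pi * of_int j * t))"
  proof (rule sum.reindex_bij_witness[of _ "\<lambda>j. nat (j + int N)" "\<lambda>k. int k - int N"])
    fix k assume k: "k \<in> {..2 * N}"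
    have "cis (pi * t) ^ k * cis (- (pi * t)) ^ (2 * N - k) =
        cis (real k * (pi * t) + real (2 * N - k) * (- (pi * t)))"
      by (simp only: Complex.DeMoivre cis_mult)
    also have "real k * (pi * t) + real (2 * N - k) * (- (pi * t)) = 2 * pi * of_int (int k - int N) * t"
      using k by (simp add: of_nat_diff algebra_simps)
    finally show "of_nat (2 * N choose nat (int k - int N + int N)) * cis (2 * pi * of_int (int k - int N) * t) =
      of_nat (2 * N choose k) * cis (pi * t) ^ k * cis (- (pi * t)) ^ (2 * N - k)"
      by (simp add: mult.assoc)
  qed auto
  finally show ?thesis
    by (simp add: cos_kernel_def cos_kernel_coeff_def sum_distrib_left sum_divide_distrib mult_ac)
qed

lemma cos_kernel_nonneg: "cos_kernel N t \<ge> 0"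
  by (simp add: cos_kernel_def power_mult)

lemma cos_kernel_factor_le:
  assumes "N \<ge> 1"
  shows "4 ^ N / real (2 * N choose N) \<le> 2 * real N"
  using central_binomial_lower_bound[of N] central_binomial_pos[of N] assms
  by (simp add: field_simps)

lemma cos_kernel_le:
  assumes "N \<ge> 1"
  shows "cos_kernel N t \<le> 2 * real N"
proof -
  have "cos (pi * t) ^ (2 * N) \<le> 1"
    by (simp add: power_mult power_le_one abs_square_le_1)
  then have "cos_kernel N t \<le> 2 * real N * 1"
    unfolding cos_kernel_def by (intro mult_mono cos_kernel_factor_le[OF assms]) (auto simp: power_mult)
  then show ?thesis by simp
qed

text \<open>At distance at least \<open>\<delta>\<close> from the nearest integer the cosine is
  bounded away from 1, so its powers decay geometrically, whereas the normalising factor grows at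
  most linearly in N.\<close>

lemma cos_kernel_far:
  assumes "N \<ge> 1" "0 < \<delta>" "\<delta> \<le> \<bar>t - of_int z\<bar>" "\<bar>t - of_int z\<bar> \<le> 1/2"
  shows "cos_kernel N t \<le> 2 * real N * ((cos (pi * \<delta>))\<^sup>2) ^ N"
proof -
  let ?u = "\<bar>t - of_int z\<bar>"
  have "\<bar>cos (pi * t)\<bar> = cos (pi * ?u)"
  proof -
    have "cos (pi * t) = cos (pi * (t - of_int z) + pi * of_int z)" by (simp add: algebra_simps)
    also have "\<dots> = cos (pi * (t - of_int z)) * cos (pi * of_int z)"
      by (simp add: cos_add sin_times_pi_eq_0 mult.commute[of pi "of_int z"])
    finally have "\<bar>cos (pi * t)\<bar> = \<bar>cos (pi * (t - of_int z))\<bar> * \<bar>cos (pi * of_int z)\<bar>"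
      by (simp add: abs_mult)
    also have "\<bar>cos (pi * of_int z)\<bar> = 1"
    proof -
      have "sin (pi * of_int z) = 0"
        by (simp add: mult.commute[of pi "of_int z"] sin_times_pi_eq_0)
      then have "(cos (pi * of_int z))\<^sup>2 = 1"
        using sin_cos_squared_add[of "pi * of_int z"] by simp
      then show ?thesis by (simp add: abs_square_eq_1)
    qed
    also have "\<bar>cos (pi * (t - of_int z))\<bar> = \<bar>cos (pi * ?u)\<bar>"
      by (cases "t - of_int z \<ge> 0") (auto simp: abs_if algebra_simps cos_diff)
    also have "\<dots> = cos (pi * ?u)"
    proof -
      have "pi * ?u \<le> pi * (1/2)" using assms by (intro mult_left_mono) auto
      moreover have "- (pi / 2) \<le> 0" "0 \<le> pi * ?u" by auto
      ultimately have "cos (pi * ?u) \<ge> 0" by (intro cos_ge_zero) linarith+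
      then show ?thesis by simp
    qed
    finally show ?thesis by simp
  qed
  moreover have "cos (pi * ?u) \<le> cos (pi * \<delta>)"
  proof (rule cos_monotone_0_pi_le)
    show "0 \<le> pi * \<delta>" "pi * \<delta> \<le> pi * ?u" using assms by auto
    have "pi * ?u \<le> pi * 1" using assms by (intro mult_left_mono) auto
    then show "pi * ?u \<le> pi" by simp
  qed
  ultimately have "(cos (pi * t))\<^sup>2 \<le> (cos (pi * \<delta>))\<^sup>2"
    by (metis abs_ge_zero power2_abs power_mono)
  then have "cos (pi * t) ^ (2 * N) \<le> ((cos (pi * \<delta>))\<^sup>2) ^ N"
    by (simp add: power_mult power_mono)
  then show ?thesis
    unfolding cos_kernel_def using cos_kernel_factor_le[OF assms(1)]
    by (intro mult_mono) (auto simp: power_mult)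
qed

section \<open>The tensor product kernel and its concentration at integer points\<close>

definition prod_kernel :: "nat \<Rightarrow> real ^ 'd::finite \<Rightarrow> real" where
  "prod_kernel N y = (\<Prod>i\<in>UNIV. cos_kernel N (y $ i))"

definition kernel_freqs :: "nat \<Rightarrow> ('d::finite \<Rightarrow> int) set" where
  "kernel_freqs N = PiE UNIV (\<lambda>_. {- int N..int N})"

definition prod_kernel_coeff :: "nat \<Rightarrow> ('d::finite \<Rightarrow> int) \<Rightarrow> real" where
  "prod_kernel_coeff N m = (\<Prod>i\<in>UNIV. cos_kernel_coeff N (m i))"

lemma finite_kernel_freqs [simp]: "finite (kernel_freqs N)"
  unfolding kernel_freqs_def by (rule finite_PiE) auto

lemma zero_in_kernel_freqs [simp]: "(\<lambda>_. 0) \<in> kernel_freqs N"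
  by (simp add: kernel_freqs_def PiE_iff)

lemma prod_kernel_coeff:
  "0 \<le> prod_kernel_coeff N m" "prod_kernel_coeff N m \<le> 1" "prod_kernel_coeff N (\<lambda>_. 0) = 1"
  by (auto simp: prod_kernel_coeff_def cos_kernel_coeff intro!: prod_nonneg prod_le_1)

lemma prod_kernel_expand:
  "complex_of_real (prod_kernel N y) = (\<Sum>m\<in>kernel_freqs N. of_real (prod_kernel_coeff N m) * character m y)"
proof -
  have "complex_of_real (prod_kernel N y) =
     (\<Prod>i\<in>UNIV. \<Sum>j\<in>{- int N..int N}. of_real (cos_kernel_coeff N j) * cis (2 * pi * of_int j * y $ i))"
    by (simp add: prod_kernel_def cos_kernel_expand)
  also have "\<dots> = (\<Sum>m\<in>kernel_freqs N. \<Prod>i\<in>UNIV. of_real (cos_kernel_coeff N (m i)) * cis (2 * pi * of_int (m i) * y $ i))"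
    unfolding kernel_freqs_def by (rule prod_sum_PiE) auto
  also have "\<dots> = (\<Sum>m\<in>kernel_freqs N. of_real (prod_kernel_coeff N m) * character m y)"
    by (simp add: prod.distrib prod_kernel_coeff_def character_altdef)
  finally show ?thesis .
qed

lemma prod_kernel_nonneg: "prod_kernel N y \<ge> 0"
  unfolding prod_kernel_def by (intro prod_nonneg) (simp add: cos_kernel_nonneg)

text \<open>A single coordinate away from the integers suffices: its geometric decay beats the
  factors of size at most 2N from the others.\<close>

lemma prod_kernel_far:
  fixes y :: "real ^ 'd::finite"
  assumes "N \<ge> 1" "0 < \<delta>" "\<delta> \<le> \<bar>y $ i - of_int z\<bar>" "\<bar>y $ i - of_int z\<bar> \<le> 1/2"
  shows "prod_kernel N y \<le> (2 * real N) ^ CARD('d) * ((cos (pi * \<delta>))\<^sup>2) ^ N"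
proof -
  have "prod_kernel N y = cos_kernel N (y $ i) * (\<Prod>i\<in>UNIV - {i}. cos_kernel N (y $ i))"
    unfolding prod_kernel_def by (rule prod.remove) auto
  also have "\<dots> \<le> (2 * real N * ((cos (pi * \<delta>))\<^sup>2) ^ N) * (\<Prod>i\<in>UNIV - {i}. 2 * real N)"
    by (intro mult_mono cos_kernel_far[where z = z] assms prod_mono conjI cos_kernel_nonneg cos_kernel_le prod_nonneg) auto
  also have "\<dots> = (2 * real N) ^ Suc (CARD('d) - 1) * ((cos (pi * \<delta>))\<^sup>2) ^ N"
    by (simp only: prod_constant card_Diff_singleton[OF UNIV_I] power_Suc mult_ac)
  also have "Suc (CARD('d) - 1) = CARD('d)"
    by simp
  finally show ?thesis .
qed

lemma continuous_on_prod_kernel [continuous_intros]: "continuous_on S (prod_kernel N)"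
  unfolding prod_kernel_def cos_kernel_def by (intro continuous_intros)

lemma borel_measurable_prod_kernel [measurable]: "prod_kernel N \<in> borel_measurable borel"
  by (rule borel_measurable_continuous_onI[OF continuous_on_prod_kernel])

lemma integral_prod_kernel:
  fixes b :: "real ^ 'd::finite"
  shows "has_bochner_integral lborel (\<lambda>y. indicator (hbox b 1) y * prod_kernel N y) 1"
proof -
  have "has_bochner_integral lborel (\<lambda>y. \<Sum>m\<in>kernel_freqs N. of_real (prod_kernel_coeff N m) * (indicator (hbox b (real 1)) y *\<^sub>R character m y))
    (\<Sum>m\<in>(kernel_freqs N :: ('d \<Rightarrow> int) set). of_real (prod_kernel_coeff N m) * (if m = (\<lambda>_. 0) then of_nat 1 ^ CARD('d) else 0))"
    by (intro has_bochner_integral_sum has_bochner_integral_mult_right integral_character)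
  also have "(\<Sum>m\<in>(kernel_freqs N :: ('d \<Rightarrow> int) set). of_real (prod_kernel_coeff N m) * (if m = (\<lambda>_. 0) then of_nat 1 ^ CARD('d) else 0)) = (1 :: complex)"
    by (simp add: if_distrib prod_kernel_coeff cong: if_cong)
  also have "(\<lambda>y. \<Sum>m\<in>kernel_freqs N. of_real (prod_kernel_coeff N m) * (indicator (hbox b (real 1)) y *\<^sub>R character m y)) =
     (\<lambda>y. complex_of_real (indicator (hbox b 1) y * prod_kernel N y))"
    by (simp add: prod_kernel_expand sum_distrib_left scaleR_conv_of_real mult_ac)
  finally have "has_bochner_integral lborel (\<lambda>y. complex_of_real (indicator (hbox b 1) y * prod_kernel N y)) 1" .
  from has_bochner_integral_bounded_linear[OF bounded_linear_Re this] show ?thesis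
    by (simp only: Re_complex_of_real one_complex.sel)
qed

lemma poly_times_geometric_tendsto_0:
  fixes q :: real
  assumes "\<bar>q\<bar> < 1"
  shows "(\<lambda>N. C * ((2 * real N) ^ k * q ^ N)) \<longlonglongrightarrow> 0"
proof -
  have "(\<lambda>n. real (n + 1) ^ k * \<bar>q\<bar> ^ n) \<longlonglongrightarrow> 0"
    using assms by (intro summable_LIMSEQ_zero summable_poly_geometric) auto
  then have "(\<lambda>n. real n ^ k * q ^ n) \<longlonglongrightarrow> 0"
  proof (rule Lim_null_comparison[rotated])
    show "\<forall>\<^sub>F n in sequentially. norm (real n ^ k * q ^ n) \<le> real (n + 1) ^ k * \<bar>q\<bar> ^ n"
      by (intro always_eventually allI) (auto simp: abs_mult power_abs intro!: mult_right_mono power_mono)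
  qed
  then have "(\<lambda>n. C * 2 ^ k * (real n ^ k * q ^ n)) \<longlonglongrightarrow> C * 2 ^ k * 0"
    by (intro tendsto_mult tendsto_const)
  then show ?thesis by (simp add: power_mult_distrib mult_ac)
qed

text \<open>An approximate identity argument: on the unit box around \<open>z\<close> the kernel is
  nonnegative with integral 1 and tends to 0 uniformly outside any cube around
  \<open>z\<close>.\<close>

lemma prod_kernel_concentration:
  fixes h :: "real ^ 'd::finite \<Rightarrow> real"
  assumes cont: "continuous_on UNIV h" and z: "\<And>i. z $ i \<in> \<int>"
  shows "(\<lambda>N. LINT y|lborel. indicator (hbox (z - vec (1/2)) 1) y * (prod_kernel N y * h y)) \<longlonglongrightarrow> h z"
proof (rule tendstoI)
  fix \<epsilon> :: real assume \<epsilon>: "\<epsilon> > 0"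
  let ?Q = "hbox (z - vec (1/2)) 1"
  have Q: "\<bar>y $ i - z $ i\<bar> \<le> 1/2" if "y \<in> ?Q" for y i
  proof -
    have "y $ i \<in> {(z - vec (1/2)) $ i..<(z - vec (1/2)) $ i + 1}"
      using that unfolding hbox_def by blast
    then show ?thesis by (auto simp: abs_if)
  qed
  obtain \<eta> where \<eta>: "\<eta> > 0" "\<And>y. dist y z < \<eta> \<Longrightarrow> dist (h y) (h z) < \<epsilon> / 2"
    using cont \<epsilon> unfolding continuous_on_iff by (metis UNIV_I half_gt_zero)
  \<comment> \<open>The second term makes the l1-distance, and so the Euclidean distance, of a point
    in the small cube smaller than \<open>\<eta>\<close>. The bound 1/4 keeps pi times
    \<open>\<delta>\<close> inside (0, pi), where the sine is positive.\<close>
  define \<delta> where "\<delta> = min (1/4) (\<eta> / (2 * real CARD('d)))"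
  have \<delta>: "0 < \<delta>" "\<delta> < 1/2" using \<eta> by (auto simp: \<delta>_def)
  define q where "q = (cos (pi * \<delta>))\<^sup>2"
  have q: "0 \<le> q" "q < 1"
  proof -
    have "0 < pi * \<delta>" "pi * \<delta> < pi" using \<delta> by auto
    then have "sin (pi * \<delta>) > 0" by (rule sin_gt_zero)
    then have "(sin (pi * \<delta>))\<^sup>2 > 0" by simp
    then show "q < 1" unfolding q_def cos_squared_eq by linarith
  qed (simp add: q_def)
  have near: "\<bar>h y - h z\<bar> < \<epsilon> / 2" if "\<And>i. \<bar>y $ i - z $ i\<bar> < \<delta>" for y
  proof -
    have "norm (y - z) \<le> (\<Sum>i\<in>UNIV. \<bar>(y - z) $ i\<bar>)" by (rule norm_le_l1_cart)
    also have "\<dots> \<le> (\<Sum>i\<in>(UNIV :: 'd set). \<eta> / (2 * real CARD('d)))"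
    proof (rule sum_mono)
      fix i
      show "\<bar>(y - z) $ i\<bar> \<le> \<eta> / (2 * real CARD('d))"
        using that[of i] by (simp add: \<delta>_def)
    qed
    also have "\<dots> < \<eta>" using \<eta> by simp
    finally show ?thesis using \<eta>(2)[of y] by (simp add: dist_norm)
  qed
  have "compact (h ` cbox (z - vec (1/2)) (z + vec (1/2)))"
    by (intro compact_continuous_image continuous_on_subset[OF cont]) auto
  then obtain B where B: "\<And>y. y \<in> cbox (z - vec (1/2)) (z + vec (1/2)) \<Longrightarrow> \<bar>h y\<bar> \<le> B"
    using compact_imp_bounded[THEN bounded_iff[THEN iffD1]] by (metis image_eqI real_norm_def)
  have QB: "\<bar>h y\<bar> \<le> B" if "y \<in> ?Q" for y
  proof (rule B)
    have "z $ i - 1/2 \<le> y $ i \<and> y $ i \<le> z $ i + 1/2" for i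
      using Q[OF that, of i] by linarith
    then show "y \<in> cbox (z - vec (1/2)) (z + vec (1/2))"
      by (simp add: mem_box_cart)
  qed
  have zQ: "z \<in> ?Q" by (simp add: hbox_def)
  have [measurable]: "h \<in> borel_measurable borel"
    by (rule borel_measurable_continuous_onI[OF cont])
  have bound: "\<bar>(LINT y|lborel. indicator ?Q y * (prod_kernel N y * h y)) - h z\<bar> \<le>
      \<epsilon> / 2 + 2 * B * ((2 * real N) ^ CARD('d) * q ^ N)" if N: "N \<ge> 1" for N
  proof -
    let ?E = "2 * B * ((2 * real N) ^ CARD('d) * q ^ N)"
    have E: "?E \<ge> 0" using QB[OF zQ] q by auto
    \<comment> \<open>Near \<open>z\<close> continuity of \<open>h\<close> gives the first term,
      elsewhere smallness of the kernel gives the second. Over a box of volume 1 the majorant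
      integrates to its two constants.\<close>
    have pt: "\<bar>prod_kernel N y * (h y - h z)\<bar> \<le> \<epsilon> / 2 * prod_kernel N y + ?E" if y: "y \<in> ?Q" for y
    proof (cases "\<forall>i. \<bar>y $ i - z $ i\<bar> < \<delta>")
      case True
      then have "\<bar>h y - h z\<bar> \<le> \<epsilon> / 2" using near[of y] by fastforce
      then have "prod_kernel N y * \<bar>h y - h z\<bar> \<le> prod_kernel N y * (\<epsilon> / 2)"
        by (intro mult_left_mono prod_kernel_nonneg)
      then show ?thesis using E by (simp add: abs_mult prod_kernel_nonneg mult.commute)
    next
      case False
      then obtain i where i: "\<delta> \<le> \<bar>y $ i - z $ i\<bar>" by (auto simp: not_less)
      obtain k where k: "z $ i = of_int k" using z[of i] Ints_cases by blast
      have "prod_kernel N y \<le> (2 * real N) ^ CARD('d) * q ^ N"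
        unfolding q_def using N \<delta> i Q[OF y, of i] k by (intro prod_kernel_far[where i = i and z = k]) auto
      moreover have "\<bar>h y - h z\<bar> \<le> 2 * B" using QB[OF y] QB[OF zQ] by linarith
      ultimately have "prod_kernel N y * \<bar>h y - h z\<bar> \<le> ((2 * real N) ^ CARD('d) * q ^ N) * (2 * B)"
        using q by (intro mult_mono) auto
      moreover have "0 \<le> \<epsilon> / 2 * prod_kernel N y"
        using \<epsilon> by (simp add: prod_kernel_nonneg)
      ultimately show ?thesis by (simp add: abs_mult prod_kernel_nonneg mult_ac)
    qed
    have K: "has_bochner_integral lborel (\<lambda>y. indicator ?Q y * prod_kernel N y) 1"
      by (rule integral_prod_kernel)
    have one: "has_bochner_integral lborel (indicator ?Q) (1::real)"
    proof -
      have "has_bochner_integral lborel (\<lambda>y. indicator (hbox (z - vec (1/2)) (real 1)) y *\<^sub>R character (\<lambda>_. 0) y) (of_nat 1 ^ CARD('d))"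
        using integral_character[of "z - vec (1/2)" 1 "\<lambda>_. 0"] by simp
      from has_bochner_integral_bounded_linear[OF bounded_linear_Re this] show ?thesis by simp
    qed
    have maj: "has_bochner_integral lborel (\<lambda>y. \<epsilon> / 2 * (indicator ?Q y * prod_kernel N y) + ?E * indicator ?Q y) (\<epsilon> / 2 * 1 + ?E * 1)"
      by (intro has_bochner_integral_add has_bochner_integral_mult_right K one)
    have maj': "norm (indicator ?Q y * (prod_kernel N y * (h y - h z))) \<le> \<epsilon> / 2 * (indicator ?Q y * prod_kernel N y) + ?E * indicator ?Q y" for y
      using pt[of y] by (cases "y \<in> ?Q") auto
    have int: "integrable lborel (\<lambda>y. indicator ?Q y * (prod_kernel N y * (h y - h z)))"
    proof (rule Bochner_Integration.integrable_bound)
      show "integrable lborel (\<lambda>y. \<epsilon> / 2 * (indicator ?Q y * prod_kernel N y) + ?E * indicator ?Q y)"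
        by (rule integrable.intros[OF maj])
      show "AE y in lborel. norm (indicator ?Q y * (prod_kernel N y * (h y - h z))) \<le>
          norm (\<epsilon> / 2 * (indicator ?Q y * prod_kernel N y) + ?E * indicator ?Q y)"
        by (intro always_eventually allI order_trans[OF maj']) (simp only: real_norm_def abs_ge_self)
    qed measurable
    have "has_bochner_integral lborel (\<lambda>y. indicator ?Q y * (prod_kernel N y * (h y - h z)) + h z * (indicator ?Q y * prod_kernel N y))
      ((LINT y|lborel. indicator ?Q y * (prod_kernel N y * (h y - h z))) + h z * 1)"
      by (intro has_bochner_integral_add has_bochner_integral_mult_right K has_bochner_integral_integrable int)
    note split = has_bochner_integral_integral_eq[OF this]
    have "indicator ?Q y * (prod_kernel N y * (h y - h z)) + h z * (indicator ?Q y * prod_kernel N y) =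
        indicator ?Q y * (prod_kernel N y * h y)" for y
      by (simp add: algebra_simps)
    with split have "(LINT y|lborel. indicator ?Q y * (prod_kernel N y * h y)) - h z =
        (LINT y|lborel. indicator ?Q y * (prod_kernel N y * (h y - h z)))"
      by (simp only: mult_1_right add_diff_cancel_right')
    then have "\<bar>(LINT y|lborel. indicator ?Q y * (prod_kernel N y * h y)) - h z\<bar> =
        norm (LINT y|lborel. indicator ?Q y * (prod_kernel N y * (h y - h z)))"
      by (simp only: real_norm_def)
    also have "\<dots> \<le> (LINT y|lborel. \<epsilon> / 2 * (indicator ?Q y * prod_kernel N y) + ?E * indicator ?Q y)"
      by (rule Bochner_Integration.integral_norm_bound_integral[OF int integrable.intros[OF maj] maj'])
    also have "\<dots> = \<epsilon> / 2 + ?E"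
      using has_bochner_integral_integral_eq[OF maj] by (simp only: mult_1_right)
    finally show ?thesis .
  qed
  have "(\<lambda>N. 2 * B * ((2 * real N) ^ CARD('d) * q ^ N)) \<longlonglongrightarrow> 0"
    by (rule poly_times_geometric_tendsto_0) (use q in auto)
  then have "\<forall>\<^sub>F N in sequentially. 2 * B * ((2 * real N) ^ CARD('d) * q ^ N) < \<epsilon> / 2"
    using \<epsilon> by (intro order_tendstoD) auto
  then show "\<forall>\<^sub>F N in sequentially. dist (LINT y|lborel. indicator ?Q y * (prod_kernel N y * h y)) (h z) < \<epsilon>"
    using eventually_ge_at_top[of 1]
  proof eventually_elim
    case (elim N)
    then show ?case using bound[of N] by (simp add: dist_real_def)
  qed
qed

section \<open>Weak derivatives of functions in the class\<close>

text \<open>Difference quotients have integral 0 by translation invariance, and dominated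
  convergence carries this over to the derivative. The mean value theorem bounds the quotients by
  \<open>M\<close>, and they vanish outside a fixed ball. Thus integration by parts needs no slicing
  into lines.\<close>

lemma integral_directional_derivative_zero:
  fixes W W' :: "'a::euclidean_space \<Rightarrow> real" and e a b :: 'a
  assumes meas [measurable]: "W \<in> borel_measurable borel" "W' \<in> borel_measurable borel"
    and der: "\<And>x. ((\<lambda>t. W (x + t *\<^sub>R e)) has_real_derivative W' x) (at 0)"
    and bound: "\<And>x. \<bar>W' x\<bar> \<le> M"
    and int: "integrable lborel W"
    and supp: "\<And>x. x \<notin> cbox a b \<Longrightarrow> W x = 0"
  shows "(LINT x|lborel. W' x) = 0"
proof -
  define r where "r n = 1 / real (Suc n)" for n
  have r: "r n > 0" "r n \<le> 1" for n by (auto simp: r_def)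
  define q where "q n x = (W (x + r n *\<^sub>R e) - W x) / r n" for n x
  have der_t: "((\<lambda>t. W (x + t *\<^sub>R e)) has_real_derivative W' (x + t *\<^sub>R e)) (at t)" for x t
    using der[of "x + t *\<^sub>R e"] DERIV_shift[of "\<lambda>t. W (x + t *\<^sub>R e)" _ 0 t]
    by (simp add: algebra_simps)
  obtain R where R: "cbox a b \<subseteq> cball 0 R" "R > 0"
    using bounded_subset_ballD[OF bounded_cbox[of a b], of 0] ball_subset_cball by (metis subset_trans)
  have W_bounded: "\<bar>W (x + t *\<^sub>R e) - W x\<bar> \<le> M * \<bar>t\<bar>" for x t
  proof -
    have "norm (W (x + t *\<^sub>R e) - W (x + 0 *\<^sub>R e)) \<le> M * norm (t - 0)"
      by (rule field_differentiable_bound[of UNIV "\<lambda>t. W (x + t *\<^sub>R e)" "\<lambda>t. W' (x + t *\<^sub>R e)"])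
        (auto intro: der_t bound)
    then show ?thesis by simp
  qed
  \<comment> \<open>Steps are at most 1, so this ball contains the support of \<open>W\<close>
    together with all the translates that occur.\<close>
  let ?S = "cball (0 :: 'a) (R + norm e)"
  have q_le: "\<bar>q n x\<bar> \<le> M * indicator ?S x" for n x
  proof (cases "x \<in> ?S")
    case True
    have "\<bar>q n x\<bar> \<le> M * \<bar>r n\<bar> / r n"
      unfolding q_def abs_divide using W_bounded[of x "r n"] r[of n] by (simp add: pos_divide_le_eq)
    then show ?thesis using True r[of n] by simp
  next
    case False
    have "norm x - norm (r n *\<^sub>R e) \<le> norm (x + r n *\<^sub>R e)"
      using norm_triangle_ineq4[of "x + r n *\<^sub>R e" "r n *\<^sub>R e"] by simp
    moreover have "norm (r n *\<^sub>R e) \<le> norm e"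
      using r[of n] by (simp add: mult_left_le_one_le)
    moreover have "norm x > R + norm e" using False by simp
    ultimately have "norm (x + r n *\<^sub>R e) > R" "norm x > R"
      using norm_ge_zero[of e] by linarith+
    then have "x + r n *\<^sub>R e \<notin> cbox a b" "x \<notin> cbox a b"
      using R(1) by (meson mem_cball_0 not_le subsetD)+
    then show ?thesis using False supp by (simp add: q_def)
  qed
  have shift: "has_bochner_integral lborel (\<lambda>x. W (x + c)) (integral\<^sup>L lborel W)" for c
  proof -
    have "integrable lborel (\<lambda>x. W (c + x))"
      using int lborel_distr_plus[of c] integrable_distr_eq[of "(+) c" lborel borel W] by simp
    moreover have "integral\<^sup>L lborel (\<lambda>x. W (c + x)) = integral\<^sup>L lborel W"
      using integral_distr[of "(+) c" lborel borel W] lborel_distr_plus[of c] by simp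
    ultimately have "has_bochner_integral lborel (\<lambda>x. W (c + x)) (integral\<^sup>L lborel W)"
      unfolding has_bochner_integral_iff by (rule conjI)
    then show ?thesis by (simp only: add.commute)
  qed
  have "has_bochner_integral lborel (q n) ((integral\<^sup>L lborel W - integral\<^sup>L lborel W) / r n)" for n
    unfolding q_def by (intro has_bochner_integral_divide has_bochner_integral_diff shift
        has_bochner_integral_integrable[OF int])
  then have q0: "integral\<^sup>L lborel (q n) = 0" for n
    using has_bochner_integral_integral_eq[of lborel "q n"] by fastforce
  have lim: "(\<lambda>n. q n x) \<longlonglongrightarrow> W' x" for x
  proof -
    have "((\<lambda>h. (W (x + h *\<^sub>R e) - W x) / h) \<longlongrightarrow> W' x) (at 0)"
      using der[of x] by (simp add: has_field_derivative_iff)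
    moreover have "filterlim r (at 0) sequentially"
    proof (rule filterlim_atI)
      show "r \<longlonglongrightarrow> 0" unfolding r_def by (rule LIMSEQ_Suc[OF lim_1_over_n])
      show "\<forall>\<^sub>F n in sequentially. r n \<noteq> 0"
        using r by (intro always_eventually allI) (metis less_irrefl)
    qed
    ultimately show ?thesis
      unfolding q_def by (rule filterlim_compose)
  qed
  have "(\<lambda>n. integral\<^sup>L lborel (q n)) \<longlonglongrightarrow> integral\<^sup>L lborel W'"
  proof (rule integral_dominated_convergence)
    show "integrable lborel (\<lambda>x. M * indicator ?S x)"
      by (intro integrable_mult_right integrable_real_indicator emeasure_bounded_finite) auto
    show "AE x in lborel. (\<lambda>n. q n x) \<longlonglongrightarrow> W' x"
      by (intro always_eventually allI lim)
    show "AE x in lborel. norm (q n x) \<le> M * indicator ?S x" for n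
      by (intro always_eventually allI) (simp only: real_norm_def q_le)
    show "q n \<in> borel_measurable lborel" for n
      unfolding q_def by measurable
  qed measurable
  then show ?thesis by (simp add: q0 LIMSEQ_const_iff)
qed

section \<open>Functions vanishing near the boundary and integration by parts\<close>

abbreviation inner_cube :: "real \<Rightarrow> (real ^ 'd::finite) set" where
  "inner_cube \<delta> \<equiv> cbox (vec \<delta>) (vec (1 - \<delta>))"

text \<open>A quantitative form of having support in the open cube. It refers only to values inside
  the cube and, unlike a statement about \<open>supp\<close>, passes to derivatives with the same
  margin.\<close>

definition vanishes_near_boundary :: "real \<Rightarrow> (real ^ 'd::finite \<Rightarrow> real) \<Rightarrow> bool" where
  "vanishes_near_boundary \<delta> v \<longleftrightarrow> (\<forall>x\<in>unit_cube. x \<notin> inner_cube \<delta> \<longrightarrow> v x = 0)"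

lemma mem_unit_cube: "x \<in> unit_cube \<longleftrightarrow> (\<forall>i. 0 \<le> x $ i \<and> x $ i \<le> 1)"
  by (auto simp: unit_cube_def mem_box_cart)

lemma line_in_unit_cube:
  assumes "x \<in> unit_cube"
  shows "{t. x + t *\<^sub>R axis i 1 \<in> unit_cube} = {- (x $ i)..1 - x $ i}"
proof -
  have "x + t *\<^sub>R axis i 1 \<in> unit_cube \<longleftrightarrow> 0 \<le> x $ i + t \<and> x $ i + t \<le> 1" for t
  proof -
    have "x + t *\<^sub>R axis i 1 \<in> unit_cube \<longleftrightarrow> (\<forall>j. 0 \<le> x $ j + (if j = i then t else 0) \<and> x $ j + (if j = i then t else 0) \<le> 1)"
      by (auto simp: mem_unit_cube axis_def if_distrib cong: if_cong)
    also have "\<dots> \<longleftrightarrow> 0 \<le> x $ i + t \<and> x $ i + t \<le> 1"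
      using assms by (auto simp: mem_unit_cube dest: spec[of _ i])
    finally show ?thesis .
  qed
  then have "{t. x + t *\<^sub>R axis i 1 \<in> unit_cube} = {t. 0 \<le> x $ i + t \<and> x $ i + t \<le> 1}"
    by (simp only:)
  also have "\<dots> = {- (x $ i)..1 - x $ i}" by auto
  finally show ?thesis .
qed

lemma open_line:
  fixes x :: "real ^ 'd::finite"
  assumes "open S" "x \<in> S"
  obtains \<epsilon> where "\<epsilon> > 0" "\<And>t. \<bar>t\<bar> < \<epsilon> \<Longrightarrow> x + t *\<^sub>R axis i 1 \<in> S"
proof -
  obtain \<epsilon> where \<epsilon>: "\<epsilon> > 0" "ball x \<epsilon> \<subseteq> S"
    using assms open_contains_ball by metis
  show ?thesis
  proof (rule that[OF \<epsilon>(1)])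
    fix t :: real assume "\<bar>t\<bar> < \<epsilon>"
    then have "x + t *\<^sub>R axis i 1 \<in> ball x \<epsilon>" by (simp add: dist_norm norm_axis_1)
    then show "x + t *\<^sub>R axis i 1 \<in> S" using \<epsilon>(2) by blast
  qed
qed

text \<open>The complement of \<open>inner_cube \<delta>\<close> is open, so close to such a point
  the function is 0 along the line, and the derivative within a nondegenerate interval is unique
  even at a face.\<close>

lemma vanishes_near_boundary_deriv:
  assumes d: "has_partial_deriv i v v'" and v: "vanishes_near_boundary \<delta> v"
  shows "vanishes_near_boundary \<delta> v'"
  unfolding vanishes_near_boundary_def
proof (intro ballI impI)
  fix x :: "real ^ 'a" assume x: "x \<in> unit_cube" "x \<notin> inner_cube \<delta>"
  let ?T = "{t. x + t *\<^sub>R axis i 1 \<in> unit_cube}"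
  have dv: "((\<lambda>t. v (x + t *\<^sub>R axis i 1)) has_real_derivative v' x) (at 0 within ?T)"
    using d x by (simp add: has_partial_deriv_def)
  obtain \<epsilon> where \<epsilon>: "\<epsilon> > 0" "\<And>t. \<bar>t\<bar> < \<epsilon> \<Longrightarrow> x + t *\<^sub>R axis i 1 \<in> - inner_cube \<delta>"
    by (rule open_line[of "- inner_cube \<delta>" x i]) (use x(2) in \<open>auto simp: open_Compl closed_cbox\<close>)
  have d0: "((\<lambda>t. v (x + t *\<^sub>R axis i 1)) has_real_derivative 0) (at 0 within ?T)"
  proof (rule has_field_derivative_transform_within[OF DERIV_const[of 0] \<epsilon>(1)])
    show "0 \<in> ?T" using x by simp
    fix t assume "t \<in> ?T" "dist t 0 < \<epsilon>"
    then show "0 = v (x + t *\<^sub>R axis i 1)"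
      using \<epsilon>(2)[of t] v by (auto simp: vanishes_near_boundary_def dist_real_def)
  qed
  have "0 \<le> x $ i" "x $ i \<le> 1" using x by (auto simp: mem_unit_cube)
  then have "at 0 within ?T \<noteq> bot"
    by (simp add: line_in_unit_cube[OF x(1)] trivial_limit_within islimpt_Icc)
  with dv d0 show "v' x = 0"
    by (metis has_real_derivative_iff_has_vector_derivative vector_derivative_unique_within)
qed

lemma continuous_on_unit_cube_integrable:
  fixes f :: "real ^ 'd::finite \<Rightarrow> real"
  assumes "continuous_on unit_cube f"
  shows "set_integrable lborel unit_cube f"
  unfolding set_integrable_def
  by (rule borel_integrable_compact) (use assms in \<open>auto simp: unit_cube_def\<close>)

lemma continuous_on_unit_cube_bounded:
  fixes f :: "real ^ 'd::finite \<Rightarrow> real"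
  assumes "continuous_on unit_cube f"
  obtains B where "B \<ge> 0" "\<And>x. x \<in> unit_cube \<Longrightarrow> \<bar>f x\<bar> \<le> B"
proof -
  have "compact (f ` unit_cube)"
    using assms by (intro compact_continuous_image) (auto simp: unit_cube_def)
  then obtain B where "\<forall>y\<in>f ` unit_cube. norm y \<le> B"
    using compact_imp_bounded bounded_iff by metis
  then show ?thesis
    by (intro that[of "max B 0"]) (auto simp: le_max_iff_disj)
qed

text \<open>Since \<open>v\<close> vanishes near the boundary, the product extended by zero is
  differentiable in direction i on the whole space, and the integral of that derivative is
  0.\<close>

lemma partial_integration:
  assumes u: "has_partial_deriv i u u'" and v: "has_partial_deriv i v v'"
    and cont: "continuous_on unit_cube u" "continuous_on unit_cube u'" "continuous_on unit_cube v" "continuous_on unit_cube v'"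
    and \<delta>: "\<delta> > 0" and van: "vanishes_near_boundary \<delta> v"
  shows "(LINT x:unit_cube|lborel. u x * v' x) = - (LINT x:unit_cube|lborel. u' x * v x)"
proof -
  define W where "W x = indicator unit_cube x *\<^sub>R (u x * v x)" for x
  define W' where "W' x = indicator unit_cube x *\<^sub>R (u' x * v x + u x * v' x)" for x
  have uc: "unit_cube \<in> sets borel" "unit_cube \<in> sets lborel" by (auto simp: unit_cube_def)
  have c1: "continuous_on unit_cube (\<lambda>x. u x * v x)" "continuous_on unit_cube (\<lambda>x. u' x * v x + u x * v' x)"
    by (intro continuous_intros cont)+
  have van': "vanishes_near_boundary \<delta> v'"
    by (rule vanishes_near_boundary_deriv[OF v van])
  obtain M where M: "M \<ge> 0" "\<And>x. x \<in> unit_cube \<Longrightarrow> \<bar>u' x * v x + u x * v' x\<bar> \<le> M"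
    using continuous_on_unit_cube_bounded[OF c1(2)] by blast
  have "(LINT x|lborel. W' x) = 0"
  proof (rule integral_directional_derivative_zero[where W = W and e = "axis i 1" and M = M and a = 0 and b = 1])
    show "W \<in> borel_measurable borel" "W' \<in> borel_measurable borel"
      unfolding W_def W'_def by (intro borel_measurable_continuous_on_indicator uc c1)+
    show "\<bar>W' x\<bar> \<le> M" for x
      using M by (cases "x \<in> unit_cube") (simp_all add: W'_def)
    show "integrable lborel W"
      using continuous_on_unit_cube_integrable[OF c1(1)] unfolding W_def set_integrable_def .
    show "W x = 0" if "x \<notin> cbox 0 1" for x
      using that by (simp add: W_def unit_cube_def)
    show "((\<lambda>t. W (x + t *\<^sub>R axis i 1)) has_real_derivative W' x) (at 0)" for x
    \<comment> \<open>In the inner cube the line can be followed in both directions, so the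
      derivative within the cube is a two-sided one. Outside it, the zero extension vanishes in a
      neighbourhood.\<close>
    proof (cases "x \<in> inner_cube \<delta>")
      case True
      then have xi: "\<delta> \<le> x $ j" "x $ j \<le> 1 - \<delta>" for j by (auto simp: mem_box_cart)
      have "0 \<le> x $ j \<and> x $ j \<le> 1" for j
        using xi[of j] \<delta> by linarith
      then have x: "x \<in> unit_cube" by (simp add: mem_unit_cube)
      let ?T = "{t. x + t *\<^sub>R axis i 1 \<in> unit_cube}"
      have "at 0 within ?T = at 0"
        unfolding line_in_unit_cube[OF x] using xi[of i] \<delta>
        by (intro at_within_interior) auto
      moreover have "((\<lambda>t. u (x + t *\<^sub>R axis i 1) * v (x + t *\<^sub>R axis i 1)) has_real_derivative u' x * v x + u x * v' x) (at 0 within ?T)"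
      proof -
        have "((\<lambda>t. u (x + t *\<^sub>R axis i 1)) has_real_derivative u' x) (at 0 within ?T)"
          "((\<lambda>t. v (x + t *\<^sub>R axis i 1)) has_real_derivative v' x) (at 0 within ?T)"
          using u v x by (simp_all add: has_partial_deriv_def)
        from DERIV_mult[OF this] show ?thesis by (simp add: mult_ac add_ac)
      qed
      ultimately have "((\<lambda>t. u (x + t *\<^sub>R axis i 1) * v (x + t *\<^sub>R axis i 1)) has_real_derivative W' x) (at 0)"
        using x by (simp add: W'_def)
      then show ?thesis
      proof (rule has_field_derivative_transform_within[where d = \<delta>])
        fix t :: real assume t: "dist t 0 < \<delta>"
        then have "t \<in> ?T"
          unfolding line_in_unit_cube[OF x] using xi[of i] by (auto simp: dist_real_def)
        then show "u (x + t *\<^sub>R axis i 1) * v (x + t *\<^sub>R axis i 1) = W (x + t *\<^sub>R axis i 1)"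
          by (simp add: W_def)
      qed (use \<delta> in auto)
    next
      case False
      have W0: "W y = 0" "W' y = 0" if "y \<notin> inner_cube \<delta>" for y
        using that van van' by (cases "y \<in> unit_cube"; simp add: W_def W'_def vanishes_near_boundary_def)+
      obtain \<epsilon> where \<epsilon>: "\<epsilon> > 0" "\<And>t. \<bar>t\<bar> < \<epsilon> \<Longrightarrow> x + t *\<^sub>R axis i 1 \<in> - inner_cube \<delta>"
        by (rule open_line[of "- inner_cube \<delta>" x i]) (use False in \<open>auto simp: open_Compl closed_cbox\<close>)
      have "((\<lambda>t. 0 :: real) has_real_derivative W' x) (at 0)"
        using W0(2)[OF False] by simp
      then show ?thesis
        by (rule has_field_derivative_transform_within[OF _ \<epsilon>(1)]) (use \<epsilon>(2) W0(1) in \<open>auto simp: dist_real_def\<close>)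
    qed
  qed
  moreover have "(LINT x|lborel. W' x) = (LINT x:unit_cube|lborel. u' x * v x) + (LINT x:unit_cube|lborel. u x * v' x)"
  proof -
    have "set_integrable lborel unit_cube (\<lambda>x. u' x * v x)" "set_integrable lborel unit_cube (\<lambda>x. u x * v' x)"
      by (intro continuous_on_unit_cube_integrable continuous_intros cont)+
    from set_integral_add(2)[OF this] show ?thesis
      unfolding W'_def set_lebesgue_integral_def .
  qed
  ultimately show ?thesis by simp
qed

section \<open>Multi-indices and repeated integration by parts\<close>

lemma midx_order_Suc: "midx_order (\<alpha>(i := Suc (\<alpha> i))) = Suc (midx_order \<alpha>)"
proof -
  have "sum (\<alpha>(i := Suc (\<alpha> i))) (UNIV - {i}) = sum \<alpha> (UNIV - {i})"
    by (rule sum.cong) auto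
  then show ?thesis
    by (simp add: midx_order_def sum.remove[of UNIV i])
qed

lemma midx_order_SucE:
  assumes "midx_order \<alpha> = Suc n"
  obtains \<beta> i where "\<alpha> = \<beta>(i := Suc (\<beta> i))" "midx_order \<beta> = n"
proof -
  from assms obtain i where i: "\<alpha> i \<noteq> 0"
    unfolding midx_order_def by (metis Zero_not_Suc sum.neutral)
  define \<beta> where "\<beta> = \<alpha>(i := \<alpha> i - 1)"
  have eq: "\<alpha> = \<beta>(i := Suc (\<beta> i))"
    using i by (auto simp: \<beta>_def)
  then have "midx_order \<beta> = n"
    using assms midx_order_Suc[of \<beta> i] by simp
  with eq show ?thesis by (rule that)
qed

lemma classical_derivs_mono: "classical_derivs k f F \<Longrightarrow> k' \<le> k \<Longrightarrow> classical_derivs k' f F"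
  unfolding classical_derivs_def by (meson le_trans less_le_trans)

lemma C_k_mono: "f \<in> C_k k \<Longrightarrow> k' \<le> k \<Longrightarrow> f \<in> C_k k'"
  unfolding C_k_def using classical_derivs_mono by blast

text \<open>Turns the derivatives of \<open>f\<close> into those of its i-th partial derivative,
  which lets an induction on the order peel off derivatives at the inner end. Increments in two
  directions commute, also when the directions coincide.\<close>

lemma classical_derivs_shift:
  assumes "classical_derivs (Suc n) f F"
  shows "classical_derivs n (F ((\<lambda>_. 0)(i := Suc 0))) (\<lambda>\<gamma>. F (\<gamma>(i := Suc (\<gamma> i))))"
proof -
  have swap: "(\<gamma>(j := Suc (\<gamma> j)))(i := Suc ((\<gamma>(j := Suc (\<gamma> j))) i)) =
      (\<gamma>(i := Suc (\<gamma> i)))(j := Suc ((\<gamma>(i := Suc (\<gamma> i))) j))" for \<gamma> :: "'a \<Rightarrow> nat" and j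
    by (cases "i = j") (auto simp: fun_eq_iff)
  have cont: "\<And>\<alpha>. midx_order \<alpha> \<le> Suc n \<Longrightarrow> continuous_on unit_cube (F \<alpha>)"
    and der: "\<And>\<alpha> i. midx_order \<alpha> < Suc n \<Longrightarrow> has_partial_deriv i (F \<alpha>) (F (\<alpha>(i := Suc (\<alpha> i))))"
    using assms unfolding classical_derivs_def by blast+
  show ?thesis
    unfolding classical_derivs_def
  proof (intro conjI allI impI)
    fix \<alpha> :: "'a \<Rightarrow> nat" and j assume "midx_order \<alpha> < n"
    then show "has_partial_deriv j (F (\<alpha>(i := Suc (\<alpha> i))))
        (F ((\<alpha>(j := Suc (\<alpha> j)))(i := Suc ((\<alpha>(j := Suc (\<alpha> j))) i))))"
      unfolding swap by (intro der) (simp add: midx_order_Suc)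
  qed (auto intro!: cont simp: midx_order_Suc)
qed

lemma classical_derivs_partial_integration:
  assumes "classical_derivs k (F (\<lambda>_. 0)) F" "midx_order \<alpha> \<le> k"
    and "classical_derivs (midx_order \<alpha>) (\<Psi> (\<lambda>_. 0)) \<Psi>"
    and "\<delta> > 0" "vanishes_near_boundary \<delta> (\<Psi> (\<lambda>_. 0))"
  shows "(LINT x:unit_cube|lborel. F (\<lambda>_. 0) x * \<Psi> \<alpha> x) =
    (-1) ^ midx_order \<alpha> * (LINT x:unit_cube|lborel. F \<alpha> x * \<Psi> (\<lambda>_. 0) x)"
  using assms(2,3,5)
proof (induction "midx_order \<alpha>" arbitrary: \<alpha> \<Psi>)
  case 0
  then have "\<alpha> = (\<lambda>_. 0)" by (auto simp: midx_order_def)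
  then show ?case using 0 by simp
next
  case (Suc n)
  obtain \<beta> i where \<beta>: "\<alpha> = \<beta>(i := Suc (\<beta> i))" "midx_order \<beta> = n"
    using Suc.hyps(2) by (metis midx_order_SucE)
  let ?\<epsilon> = "(\<lambda>_. 0)(i := Suc 0)"
  have \<Psi>: "classical_derivs (Suc n) (\<Psi> (\<lambda>_. 0)) \<Psi>"
    using Suc.prems(2) Suc.hyps(2) by simp
  have d\<Psi>: "has_partial_deriv i (\<Psi> (\<lambda>_. 0)) (\<Psi> ?\<epsilon>)"
  proof -
    have "midx_order (\<lambda>_ :: 'a. 0) < Suc n" by (simp add: midx_order_def)
    then show ?thesis using \<Psi> unfolding classical_derivs_def by fastforce
  qed
  have van: "vanishes_near_boundary \<delta> (\<Psi> ?\<epsilon>)"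
    by (rule vanishes_near_boundary_deriv[OF d\<Psi> Suc.prems(3)])
  \<comment> \<open>The induction hypothesis is applied to the i-th partial derivative of the test
    function with the smaller index \<open>\<beta>\<close>; one integration by parts in direction i
    then remains.\<close>
  have "(LINT x:unit_cube|lborel. F (\<lambda>_. 0) x * \<Psi> \<alpha> x) = (-1) ^ n * (LINT x:unit_cube|lborel. F \<beta> x * \<Psi> ?\<epsilon> x)"
    using Suc.hyps(1)[of \<beta> "\<lambda>\<gamma>. \<Psi> (\<gamma>(i := Suc (\<gamma> i)))"] \<beta> Suc.prems(1) Suc.hyps(2) van
      classical_derivs_shift[OF \<Psi>, of i] by simp
  also have "(LINT x:unit_cube|lborel. F \<beta> x * \<Psi> ?\<epsilon> x) = - (LINT x:unit_cube|lborel. F \<alpha> x * \<Psi> (\<lambda>_. 0) x)"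
  proof (rule partial_integration[OF _ d\<Psi>])
    show "has_partial_deriv i (F \<beta>) (F \<alpha>)"
      using assms(1) Suc.prems(1) Suc.hyps(2) \<beta> unfolding classical_derivs_def by auto
    show "continuous_on unit_cube (F \<beta>)" "continuous_on unit_cube (F \<alpha>)"
      using assms(1) Suc.prems(1) Suc.hyps(2) \<beta>(2) unfolding classical_derivs_def by auto
    have "midx_order (\<lambda>_ :: 'a. 0) \<le> Suc n" "midx_order ?\<epsilon> \<le> Suc n"
      using midx_order_Suc[of "\<lambda>_ :: 'a. 0" i] by (auto simp: midx_order_def)
    then show "continuous_on unit_cube (\<Psi> (\<lambda>_. 0))" "continuous_on unit_cube (\<Psi> ?\<epsilon>)"
      using \<Psi> unfolding classical_derivs_def by auto
  qed (use assms Suc.prems in auto)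
  finally show ?case using Suc.hyps(2) by (simp flip: Suc.hyps(2))
qed

lemma compact_in_box:
  fixes K :: "(real ^ 'd::finite) set"
  assumes "compact K" "K \<subseteq> box 0 1"
  obtains \<delta> where "0 < \<delta>" "\<delta> \<le> 1/4" "K \<subseteq> inner_cube \<delta>"
proof -
  obtain e where e: "e > 0" "(\<Union>x\<in>K. cball x e) \<subseteq> box 0 (1 :: real ^ 'd)"
    using compact_subset_open_imp_cball_epsilon_subset[OF assms(1) open_box assms(2)] by blast
  have "K \<subseteq> cbox (vec (min e (1/4))) (vec (1 - min e (1/4)))"
  proof
    fix x assume x: "x \<in> K"
    have "min e (1/4) \<le> x $ i \<and> x $ i \<le> 1 - min e (1/4)" for i
    proof -
      have "x + e *\<^sub>R axis i 1 \<in> cball x e" "x + (- e) *\<^sub>R axis i 1 \<in> cball x e"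
        using e by (auto simp: dist_norm norm_axis_1)
      then have "x + e *\<^sub>R axis i 1 \<in> box 0 1" "x + (- e) *\<^sub>R axis i 1 \<in> box 0 1"
        using e(2) x by blast+
      then have "(x + e *\<^sub>R axis i 1) $ i < 1" "0 < (x + (- e) *\<^sub>R axis i 1) $ i"
        unfolding mem_box_cart by (metis one_index, metis zero_index)
      then have "x $ i + e < 1" "e < x $ i" by simp_all
      then show ?thesis by linarith
    qed
    then show "x \<in> cbox (vec (min e (1/4))) (vec (1 - min e (1/4)))"
      by (simp only: mem_box_cart vec_component) blast
  qed
  then show ?thesis by (intro that[of "min e (1/4)"]) (use e in auto)
qed

lemma compact_supp: "compact (supp f)"
proof -
  have "supp f \<subseteq> unit_cube"
    unfolding supp_def by (rule closure_minimal) (auto simp: unit_cube_def)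
  then show ?thesis
    unfolding compact_eq_bounded_closed
    by (metis bounded_cbox bounded_subset closed_closure supp_def unit_cube_def)
qed

lemma supp_vanishes:
  assumes "supp f \<subseteq> box 0 1"
  obtains \<delta> where "0 < \<delta>" "\<delta> \<le> 1/4" "vanishes_near_boundary \<delta> f"
proof -
  obtain \<delta> where \<delta>: "0 < \<delta>" "\<delta> \<le> 1/4" "supp f \<subseteq> inner_cube \<delta>"
    using compact_in_box[OF compact_supp assms] by blast
  have "{x \<in> unit_cube. f x \<noteq> 0} \<subseteq> supp f"
    unfolding supp_def by (rule closure_subset)
  with \<delta> show ?thesis
    by (intro that[of \<delta>]) (auto simp: vanishes_near_boundary_def)
qed

lemma sets_unit_cube [measurable, simp]: "unit_cube \<in> sets borel"
  by (simp add: unit_cube_def)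

section \<open>Square integrable functions and weak derivatives\<close>

lemma continuous_on_L2:
  assumes "continuous_on unit_cube g"
  shows "g \<in> L2"
  unfolding L2_def
proof (intro CollectI conjI)
  show "set_borel_measurable lborel unit_cube g"
    unfolding set_borel_measurable_def
    using borel_measurable_continuous_on_indicator[OF sets_unit_cube assms] by simp
  show "set_integrable lborel unit_cube (\<lambda>x. (g x)\<^sup>2)"
    by (intro continuous_on_unit_cube_integrable continuous_intros assms)
qed

lemma classical_deriv_some:
  assumes "f \<in> C_k (midx_order \<alpha>)"
  obtains F where "classical_derivs (midx_order \<alpha>) f F" "classical_deriv \<alpha> f = F \<alpha>"
proof
  have "\<exists>F. classical_derivs (midx_order \<alpha>) f F"
    using assms by (simp add: C_k_def)
  then show "classical_derivs (midx_order \<alpha>) f (SOME F. classical_derivs (midx_order \<alpha>) f F)"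
    by (rule someI_ex)
  show "classical_deriv \<alpha> f = (SOME F. classical_derivs (midx_order \<alpha>) f F) \<alpha>"
    by (simp add: classical_deriv_def)
qed

lemma classical_derivs_self:
  assumes "classical_derivs k f F"
  shows "classical_derivs k (F (\<lambda>_. 0)) F" "\<And>x. x \<in> unit_cube \<Longrightarrow> F (\<lambda>_. 0) x = f x"
  using assms unfolding classical_derivs_def by auto

lemma continuous_on_classical_deriv:
  assumes "f \<in> C_k (midx_order \<alpha>)"
  shows "continuous_on unit_cube (classical_deriv \<alpha> f)"
  using classical_deriv_some[OF assms] unfolding classical_derivs_def by (metis order_refl)

lemma continuous_on_C_k:
  assumes "f \<in> C_k k"
  shows "continuous_on unit_cube f"
proof -
  obtain F where F: "classical_derivs k f F" using assms by (auto simp: C_k_def)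
  have "midx_order (\<lambda>_ :: 'a. 0) \<le> k" by (simp add: midx_order_def)
  then have "continuous_on unit_cube (F (\<lambda>_. 0))"
    using F unfolding classical_derivs_def by blast
  then show ?thesis
    using classical_derivs_self(2)[OF F] by (metis (no_types, lifting) continuous_on_cong)
qed

text \<open>Reconciles the two branches of \<open>deriv_D\<close>: with it, \<open>deriv_D\<close>
  yields a weak derivative in either case, as soon as one exists.\<close>

lemma classical_deriv_weak:
  assumes "f \<in> C_k (midx_order \<alpha>)"
  shows "L2_weak_deriv \<alpha> f (classical_deriv \<alpha> f)"
  unfolding L2_weak_deriv_def
proof (intro conjI ballI)
  show "classical_deriv \<alpha> f \<in> L2"
    by (intro continuous_on_L2 continuous_on_classical_deriv assms)
  fix \<phi> :: "real ^ 'a \<Rightarrow> real" assume \<phi>: "\<phi> \<in> test_functions"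
  then have \<phi>C: "\<phi> \<in> C_k (midx_order \<alpha>)" and \<phi>s: "supp \<phi> \<subseteq> box 0 1"
    by (auto simp: test_functions_def)
  obtain \<delta> where \<delta>: "0 < \<delta>" "vanishes_near_boundary \<delta> \<phi>"
    using supp_vanishes[OF \<phi>s] by blast
  obtain F where F: "classical_derivs (midx_order \<alpha>) f F" "classical_deriv \<alpha> f = F \<alpha>"
    using classical_deriv_some[OF assms] .
  obtain \<Phi> where \<Phi>: "classical_derivs (midx_order \<alpha>) \<phi> \<Phi>" "classical_deriv \<alpha> \<phi> = \<Phi> \<alpha>"
    using classical_deriv_some[OF \<phi>C] .
  have "vanishes_near_boundary \<delta> (\<Phi> (\<lambda>_. 0))"
    using \<delta>(2) classical_derivs_self(2)[OF \<Phi>(1)] by (simp add: vanishes_near_boundary_def)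
  from classical_derivs_partial_integration[OF classical_derivs_self(1)[OF F(1)] order_refl classical_derivs_self(1)[OF \<Phi>(1)] \<delta>(1) this]
  have "(LINT x:unit_cube|lborel. F (\<lambda>_. 0) x * \<Phi> \<alpha> x) =
    (-1) ^ midx_order \<alpha> * (LINT x:unit_cube|lborel. F \<alpha> x * \<Phi> (\<lambda>_. 0) x)" .
  moreover have "(LINT x:unit_cube|lborel. F (\<lambda>_. 0) x * \<Phi> \<alpha> x) = (LINT x:unit_cube|lborel. f x * classical_deriv \<alpha> \<phi> x)"
    using classical_derivs_self(2)[OF F(1)] \<Phi>(2) by (intro set_lebesgue_integral_cong) auto
  moreover have "(LINT x:unit_cube|lborel. F \<alpha> x * \<Phi> (\<lambda>_. 0) x) = (LINT x:unit_cube|lborel. classical_deriv \<alpha> f x * \<phi> x)"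
    using classical_derivs_self(2)[OF \<Phi>(1)] F(2) by (intro set_lebesgue_integral_cong) auto
  ultimately show "(LINT x:unit_cube|lborel. f x * classical_deriv \<alpha> \<phi> x) =
    (-1) ^ midx_order \<alpha> * (LINT x:unit_cube|lborel. classical_deriv \<alpha> f x * \<phi> x)" by simp
qed

lemma deriv_D_weak:
  assumes "\<exists>g. L2_weak_deriv \<alpha> f g"
  shows "L2_weak_deriv \<alpha> f (deriv_D \<alpha> f)"
  unfolding deriv_D_def using classical_deriv_weak someI_ex[OF assms] by auto

lemma L2_mult_integrable:
  assumes g: "g \<in> L2" and \<phi>: "\<phi> \<in> L2"
  shows "set_integrable lborel unit_cube (\<lambda>x. g x * \<phi> x)"
  unfolding set_integrable_def
proof (rule Bochner_Integration.integrable_bound)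
  have gm: "(\<lambda>x. indicator unit_cube x *\<^sub>R g x) \<in> borel_measurable lborel"
    and \<phi>m: "(\<lambda>x. indicator unit_cube x *\<^sub>R \<phi> x) \<in> borel_measurable lborel"
    using g \<phi> by (auto simp: L2_def set_borel_measurable_def)
  have "set_integrable lborel unit_cube (\<lambda>x. (g x)\<^sup>2 + (\<phi> x)\<^sup>2)"
    using g \<phi> by (intro set_integral_add) (auto simp: L2_def)
  then show "integrable lborel (\<lambda>x. indicator unit_cube x *\<^sub>R ((g x)\<^sup>2 + (\<phi> x)\<^sup>2))"
    by (simp only: set_integrable_def)
  have "(\<lambda>x. indicator unit_cube x *\<^sub>R (g x * \<phi> x)) = (\<lambda>x. (indicator unit_cube x *\<^sub>R g x) * (indicator unit_cube x *\<^sub>R \<phi> x))"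
    by (auto simp: indicator_def)
  then show "(\<lambda>x. indicator unit_cube x *\<^sub>R (g x * \<phi> x)) \<in> borel_measurable lborel"
    using borel_measurable_times[OF gm \<phi>m] by simp
  have "\<bar>a * b\<bar> \<le> a\<^sup>2 + b\<^sup>2" for a b :: real
    using sum_squares_bound[of "\<bar>a\<bar>" "\<bar>b\<bar>"] abs_ge_zero[of "a * b"] by (simp only: abs_mult power2_abs)
  then show "AE x in lborel. norm (indicator unit_cube x *\<^sub>R (g x * \<phi> x)) \<le>
      norm (indicator unit_cube x *\<^sub>R ((g x)\<^sup>2 + (\<phi> x)\<^sup>2))"
    by (intro always_eventually allI) (auto simp: indicator_def)
qed

lemma L2_lincomb:
  assumes u: "u \<in> L2" and v: "v \<in> L2"
  shows "(\<lambda>x. a * u x + b * v x) \<in> L2"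
  unfolding L2_def
proof (intro CollectI conjI)
  have um: "(\<lambda>x. indicator unit_cube x *\<^sub>R u x) \<in> borel_measurable lborel"
    and vm: "(\<lambda>x. indicator unit_cube x *\<^sub>R v x) \<in> borel_measurable lborel"
    using u v by (auto simp: L2_def set_borel_measurable_def)
  have "(\<lambda>x. indicator unit_cube x *\<^sub>R (a * u x + b * v x)) =
      (\<lambda>x. a * (indicator unit_cube x *\<^sub>R u x) + b * (indicator unit_cube x *\<^sub>R v x))"
    by (auto simp: algebra_simps)
  then show "set_borel_measurable lborel unit_cube (\<lambda>x. a * u x + b * v x)"
    unfolding set_borel_measurable_def using um vm by simp
  have "set_integrable lborel unit_cube (\<lambda>x. a\<^sup>2 * (u x * u x) + ((2 * a * b) * (u x * v x) + b\<^sup>2 * (v x * v x)))"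
    by (intro set_integral_add set_integrable_mult_right L2_mult_integrable u v)
  then show "set_integrable lborel unit_cube (\<lambda>x. (a * u x + b * v x)\<^sup>2)"
    by (simp add: power2_eq_square algebra_simps)
qed

lemma L2_weak_deriv_lincomb:
  assumes f: "L2_weak_deriv \<alpha> f u" "continuous_on unit_cube f"
    and g: "L2_weak_deriv \<alpha> g v" "continuous_on unit_cube g"
  shows "L2_weak_deriv \<alpha> (\<lambda>x. a * f x + b * g x) (\<lambda>x. a * u x + b * v x)"
  unfolding L2_weak_deriv_def
proof (intro conjI ballI)
  have u: "u \<in> L2" and v: "v \<in> L2" using f g by (auto simp: L2_weak_deriv_def)
  then show "(\<lambda>x. a * u x + b * v x) \<in> L2" by (rule L2_lincomb)
  fix \<phi> :: "real ^ 'a \<Rightarrow> real" assume \<phi>: "\<phi> \<in> test_functions"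
  then have C: "\<phi> \<in> C_k k" for k by (simp add: test_functions_def)
  have \<phi>L: "\<phi> \<in> L2" by (rule continuous_on_L2[OF continuous_on_C_k[OF C]])
  have D\<phi>L: "classical_deriv \<alpha> \<phi> \<in> L2" by (rule continuous_on_L2[OF continuous_on_classical_deriv[OF C]])
  have lin: "(LINT x:unit_cube|lborel. (a * p x + b * q x) * \<psi> x) =
     a * (LINT x:unit_cube|lborel. p x * \<psi> x) + b * (LINT x:unit_cube|lborel. q x * \<psi> x)"
    if "p \<in> L2" "q \<in> L2" "\<psi> \<in> L2" for p q \<psi> :: "real ^ 'a \<Rightarrow> real"
  proof -
    have "(LINT x:unit_cube|lborel. (a * p x + b * q x) * \<psi> x) =
       (LINT x:unit_cube|lborel. a * (p x * \<psi> x) + b * (q x * \<psi> x))"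
      by (simp add: algebra_simps)
    also have "\<dots> = (LINT x:unit_cube|lborel. a * (p x * \<psi> x)) + (LINT x:unit_cube|lborel. b * (q x * \<psi> x))"
      by (intro set_integral_add(2) set_integrable_mult_right L2_mult_integrable that)
    finally show ?thesis by simp
  qed
  have "(LINT x:unit_cube|lborel. (a * f x + b * g x) * classical_deriv \<alpha> \<phi> x) =
      a * (LINT x:unit_cube|lborel. f x * classical_deriv \<alpha> \<phi> x) + b * (LINT x:unit_cube|lborel. g x * classical_deriv \<alpha> \<phi> x)"
    by (rule lin) (use D\<phi>L f g continuous_on_L2 in auto)
  also have "\<dots> = a * ((-1) ^ midx_order \<alpha> * (LINT x:unit_cube|lborel. u x * \<phi> x)) + b * ((-1) ^ midx_order \<alpha> * (LINT x:unit_cube|lborel. v x * \<phi> x))"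
    using f g \<phi> by (simp add: L2_weak_deriv_def)
  also have "\<dots> = (-1) ^ midx_order \<alpha> * (LINT x:unit_cube|lborel. (a * u x + b * v x) * \<phi> x)"
    by (subst lin[OF u v \<phi>L]) (simp add: algebra_simps)
  finally show "(LINT x:unit_cube|lborel. (a * f x + b * g x) * classical_deriv \<alpha> \<phi> x) =
    (-1) ^ midx_order \<alpha> * (LINT x:unit_cube|lborel. (a * u x + b * v x) * \<phi> x)" .
qed

lemma L2_norm_deriv_D_le: "\<alpha> \<in> mix_indices s \<Longrightarrow> L2_norm (deriv_D \<alpha> f) \<le> mix_norm s f"
  unfolding mix_norm_def
  by (intro real_le_rsqrt member_le_sum[of \<alpha> "mix_indices s" "\<lambda>\<alpha>. (L2_norm (deriv_D \<alpha> f))\<^sup>2"] finite_mix_indices) auto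

lemma L2_norm_le_imp_integral_le:
  assumes "L2_norm g \<le> 1"
  shows "(LINT x:unit_cube|lborel. (g x)\<^sup>2) \<le> 1"
  using assms unfolding L2_norm_def by simp

lemma midx_order_mix_indices:
  assumes "\<alpha> \<in> mix_indices s"
  shows "midx_order (\<alpha> :: 'd::finite \<Rightarrow> nat) \<le> s * CARD('d)"
proof -
  have "sum \<alpha> UNIV \<le> (\<Sum>i\<in>(UNIV :: 'd set). s)"
    using assms by (intro sum_mono) (simp add: mix_indices_def)
  then show ?thesis by (simp add: midx_order_def mult.commute)
qed

text \<open>A single approximant g from the ball at distance below 1 is enough: f = (f - g) + g, and
  both summands have weak derivatives of norm at most 1. The bound 4 comes from (u + v)^2 <= 2 u^2 +
  2 v^2.\<close>

lemma H_mix_weak_deriv: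
  assumes f: "f \<in> H_mix s" and \<alpha>: "\<alpha> \<in> mix_indices s"
  obtains w where "L2_weak_deriv \<alpha> f w" "(LINT x:unit_cube|lborel. (w x)\<^sup>2) \<le> 4"
proof -
  obtain g where g: "g \<in> mix_ball s" "mix_norm s (\<lambda>x. f x - g x) < 1"
    using f zero_less_one unfolding H_mix_def by blast
  obtain wf where wf: "L2_weak_deriv \<alpha> f wf" and fc: "continuous_on unit_cube f"
    using f \<alpha> by (auto simp: H_mix_def mix_space_def)
  have gC: "g \<in> C_k (midx_order \<alpha>)" and gn: "mix_norm s g \<le> 1"
    using g(1) C_k_mono midx_order_mix_indices[OF \<alpha>] by (auto simp: mix_ball_def)
  have gc: "continuous_on unit_cube g" by (rule continuous_on_C_k[OF gC])
  have gw: "L2_weak_deriv \<alpha> g (classical_deriv \<alpha> g)" by (rule classical_deriv_weak[OF gC])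
  \<comment> \<open>The norm of f - g speaks about the derivative chosen by \<open>deriv_D\<close>;
    this existence statement ensures that the choice is a genuine weak derivative.\<close>
  have "L2_weak_deriv \<alpha> (\<lambda>x. 1 * f x + -1 * g x) (\<lambda>x. 1 * wf x + -1 * classical_deriv \<alpha> g x)"
    by (rule L2_weak_deriv_lincomb[OF wf fc gw gc])
  then have "L2_weak_deriv \<alpha> (\<lambda>x. f x - g x) (\<lambda>x. wf x - classical_deriv \<alpha> g x)"
    by simp
  then have d: "L2_weak_deriv \<alpha> (\<lambda>x. f x - g x) (deriv_D \<alpha> (\<lambda>x. f x - g x))" (is "L2_weak_deriv _ _ ?u")
    by (intro deriv_D_weak exI)
  have dg: "L2_weak_deriv \<alpha> g (deriv_D \<alpha> g)" (is "L2_weak_deriv _ _ ?v")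
    using gw by (intro deriv_D_weak exI)
  have u: "?u \<in> L2" and v: "?v \<in> L2" using d dg by (auto simp: L2_weak_deriv_def)
  have w: "L2_weak_deriv \<alpha> (\<lambda>x. 1 * (f x - g x) + 1 * g x) (\<lambda>x. 1 * ?u x + 1 * ?v x)"
    by (intro L2_weak_deriv_lincomb d dg gc continuous_intros fc)
  have "(LINT x:unit_cube|lborel. (?u x + ?v x)\<^sup>2) \<le> (LINT x:unit_cube|lborel. 2 * (?u x)\<^sup>2 + 2 * (?v x)\<^sup>2)"
  proof (rule set_integral_mono)
    show "set_integrable lborel unit_cube (\<lambda>x. (?u x + ?v x)\<^sup>2)"
      using L2_lincomb[OF u v, of 1 1] by (simp add: L2_def)
    show "set_integrable lborel unit_cube (\<lambda>x. 2 * (?u x)\<^sup>2 + 2 * (?v x)\<^sup>2)"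
      using u v by (intro set_integral_add set_integrable_mult_right) (auto simp: L2_def)
    show "(?u x + ?v x)\<^sup>2 \<le> 2 * (?u x)\<^sup>2 + 2 * (?v x)\<^sup>2" for x
      using sum_squares_bound[of "?u x" "?v x"] by (simp add: power2_sum)
  qed
  also have "\<dots> = 2 * (LINT x:unit_cube|lborel. (?u x)\<^sup>2) + 2 * (LINT x:unit_cube|lborel. (?v x)\<^sup>2)"
    using u v by (subst set_integral_add(2)) (auto simp: L2_def intro!: set_integrable_mult_right)
  also have "\<dots> \<le> 2 * 1 + 2 * 1"
    using L2_norm_deriv_D_le[OF \<alpha>] g(2) gn
    by (intro add_mono mult_left_mono L2_norm_le_imp_integral_le) (auto intro: order_trans less_imp_le)
  finally show ?thesis using w by (intro that[of "\<lambda>x. ?u x + ?v x"]) auto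
qed

section \<open>Cutoffs and pairing with plane waves\<close>

text \<open>The derivative is hidden behind an existential quantifier, so closure under products,
  inverses and substitutions follows by induction without formulas for higher derivatives.
  Smoothness is the statement for all n.\<close>

primrec times_differentiable :: "nat \<Rightarrow> (real \<Rightarrow> 'a::real_normed_vector) \<Rightarrow> bool" where
  "times_differentiable 0 f = True"
| "times_differentiable (Suc n) f = (\<exists>f'. (\<forall>t. (f has_vector_derivative f' t) (at t)) \<and> times_differentiable n f')"

lemma times_differentiable_SucI:
  "(\<And>t. (f has_vector_derivative f' t) (at t)) \<Longrightarrow> times_differentiable n f' \<Longrightarrow> times_differentiable (Suc n) f"
  by auto

lemma times_differentiable_Suc_imp: "times_differentiable (Suc n) f \<Longrightarrow> times_differentiable n f"
proof (induction n arbitrary: f)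
  case (Suc n)
  then obtain f' where "\<forall>t. (f has_vector_derivative f' t) (at t)" "times_differentiable (Suc n) f'"
    by (metis times_differentiable.simps(2))
  with Suc.IH show ?case by (auto simp del: times_differentiable.simps(2) simp: times_differentiable.simps(2)[of n f])
qed simp

lemma times_differentiable_const: "times_differentiable n (\<lambda>t. c)"
proof (induction n arbitrary: c)
  case (Suc n)
  then show ?case by (auto intro!: exI[of _ "\<lambda>t. 0"])
qed simp

lemma times_differentiable_add:
  "times_differentiable n f \<Longrightarrow> times_differentiable n g \<Longrightarrow> times_differentiable n (\<lambda>t. f t + g t)"
proof (induction n arbitrary: f g)
  case (Suc n)
  then obtain f' g' where "\<forall>t. (f has_vector_derivative f' t) (at t)" "times_differentiable n f'"
    "\<forall>t. (g has_vector_derivative g' t) (at t)" "times_differentiable n g'" by auto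
  with Suc.IH show ?case
    by (auto intro!: exI[of _ "\<lambda>t. f' t + g' t"] has_vector_derivative_add)
qed simp

lemma times_differentiable_mult:
  fixes f g :: "real \<Rightarrow> 'a::real_normed_algebra"
  shows "times_differentiable n f \<Longrightarrow> times_differentiable n g \<Longrightarrow> times_differentiable n (\<lambda>t. f t * g t)"
proof (induction n arbitrary: f g)
  case (Suc n)
  then obtain f' g' where d: "\<forall>t. (f has_vector_derivative f' t) (at t)" "times_differentiable n f'"
    "\<forall>t. (g has_vector_derivative g' t) (at t)" "times_differentiable n g'" by auto
  have "times_differentiable n (\<lambda>t. f t * g' t + f' t * g t)"
    using times_differentiable_Suc_imp[OF Suc.prems(1)] times_differentiable_Suc_imp[OF Suc.prems(2)] d
    by (intro times_differentiable_add Suc.IH)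
  with d show ?case
    by (auto intro!: exI[of _ "\<lambda>t. f t * g' t + f' t * g t"] has_vector_derivative_mult)
qed simp

lemma times_differentiable_affine:
  fixes f :: "real \<Rightarrow> real"
  shows "times_differentiable n f \<Longrightarrow> times_differentiable n (\<lambda>t. f (a * t + b))"
proof (induction n arbitrary: f)
  case (Suc n)
  then obtain f' where d: "\<And>t. (f has_real_derivative f' t) (at t)" "times_differentiable n f'"
    by (auto simp: has_real_derivative_iff_has_vector_derivative)
  have "((\<lambda>t. f (a * t + b)) has_real_derivative f' (a * t + b) * a) (at t)" for t
    by (rule DERIV_chain2[OF d(1)]) (auto intro!: derivative_eq_intros)
  moreover have "times_differentiable n (\<lambda>t. f' (a * t + b) * a)"
    by (rule times_differentiable_mult[OF Suc.IH[OF d(2)] times_differentiable_const])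
  ultimately show ?case
    unfolding has_real_derivative_iff_has_vector_derivative by (rule times_differentiable_SucI)
qed simp

lemma times_differentiable_inverse:
  fixes f :: "real \<Rightarrow> real"
  assumes nz: "\<And>t. f t \<noteq> 0"
  shows "times_differentiable n f \<Longrightarrow> times_differentiable n (\<lambda>t. inverse (f t))"
proof (induction n)
  case (Suc n)
  then obtain f' where d: "\<And>t. (f has_real_derivative f' t) (at t)" "times_differentiable n f'"
    by (auto simp: has_real_derivative_iff_has_vector_derivative)
  have "((\<lambda>t. inverse (f t)) has_real_derivative (- 1) * (inverse (f t) * f' t * inverse (f t))) (at t)" for t
    using DERIV_inverse'[OF d(1) nz[of t]] by simp
  moreover have "times_differentiable n (\<lambda>t. (- 1) * (inverse (f t) * f' t * inverse (f t)))"
    using Suc.IH[OF times_differentiable_Suc_imp[OF Suc.prems]]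
    by (intro times_differentiable_mult d(2) times_differentiable_const)
  ultimately show ?case
    unfolding has_real_derivative_iff_has_vector_derivative by (rule times_differentiable_SucI)
qed simp

lemma times_differentiable_of_real:
  fixes f :: "real \<Rightarrow> real"
  shows "times_differentiable n f \<Longrightarrow> times_differentiable n (\<lambda>t. complex_of_real (f t))"
proof (induction n arbitrary: f)
  case (Suc n)
  then obtain f' where d: "\<And>t. (f has_real_derivative f' t) (at t)" "times_differentiable n f'"
    by (auto simp: has_real_derivative_iff_has_vector_derivative)
  then have "((\<lambda>t. complex_of_real (f t)) has_vector_derivative complex_of_real (f' t)) (at t)" for t
    by (intro has_vector_derivative_of_real)
  then show ?case using Suc.IH[OF d(2)] by (rule times_differentiable_SucI)
qed simp

lemma times_differentiable_cis: "times_differentiable n (\<lambda>t. cis (w * t))"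
proof (induction n)
  case (Suc n)
  have "times_differentiable n (\<lambda>t. \<i> * of_real w * cis (w * t))"
    by (intro times_differentiable_mult times_differentiable_const Suc)
  with cis_has_vector_derivative show ?case by (rule times_differentiable_SucI)
qed simp

text \<open>The functions p(1/t) exp(-1/t), extended by 0 to t <= 0. Carrying the polynomial along
  makes the family closed under differentiation: with u = 1/t the derivative replaces p by u^2 (p -
  p').\<close>

definition flat :: "real poly \<Rightarrow> real \<Rightarrow> real" where
  "flat p t = (if t > 0 then poly p (inverse t) * exp (- inverse t) else 0)"

lemma poly_times_exp_minus_tendsto_0: "((\<lambda>u :: real. poly p u * exp (- u)) \<longlongrightarrow> 0) at_top"
proof -
  have "((\<lambda>u. \<Sum>i\<le>degree p. coeff p i * (u ^ i / exp u)) \<longlongrightarrow> (\<Sum>i\<le>degree p. coeff p i * 0)) at_top"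
    by (intro tendsto_sum tendsto_mult tendsto_const tendsto_power_div_exp_0)
  then show ?thesis
    by (simp add: poly_altdef sum_distrib_right exp_minus divide_inverse mult.assoc)
qed

lemma flat_deriv: "(flat p has_real_derivative flat ([:0, 0, 1:] * (p - pderiv p)) t) (at t)"
proof -
  consider "t > 0" | "t < 0" | "t = 0" by linarith
  then show ?thesis
  proof cases
    case 1
    have "((\<lambda>t. poly p (inverse t) * exp (- inverse t)) has_real_derivative
      flat ([:0, 0, 1:] * (p - pderiv p)) t) (at t)"
      using 1 by (auto intro!: derivative_eq_intros DERIV_chain2[OF poly_DERIV] simp: flat_def algebra_simps power2_eq_square)
    then show ?thesis
      by (rule has_field_derivative_transform_within_open[where S = "{0<..}"]) (use 1 in \<open>auto simp: flat_def\<close>)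
  next
    case 2
    have "((\<lambda>t. 0) has_real_derivative flat ([:0, 0, 1:] * (p - pderiv p)) t) (at t)"
      using 2 by (simp add: flat_def)
    then show ?thesis
      by (rule has_field_derivative_transform_within_open[where S = "{..<0}"]) (use 2 in \<open>auto simp: flat_def\<close>)
  next
    case 3
    \<comment> \<open>At 0 the difference quotient from the right is the same kind of function with
      p multiplied by u, so exponential decay wins again.\<close>
    have "((\<lambda>y. (flat p y - flat p 0) / (y - 0)) \<longlongrightarrow> 0) (at 0)"
    proof (rule filterlim_split_at)
      have "((\<lambda>y :: real. 0 :: real) \<longlongrightarrow> 0) (at_left 0)" by simp
      then show "((\<lambda>y. (flat p y - flat p 0) / (y - 0)) \<longlongrightarrow> 0) (at_left 0)"
        by (rule Lim_transform_eventually) (auto simp: eventually_at_filter flat_def intro!: always_eventually)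
      have "((\<lambda>y. poly (pCons 0 p) (inverse y) * exp (- inverse y)) \<longlongrightarrow> 0) (at_right 0)"
        by (rule filterlim_compose[OF poly_times_exp_minus_tendsto_0 filterlim_inverse_at_top_right])
      then show "((\<lambda>y. (flat p y - flat p 0) / (y - 0)) \<longlongrightarrow> 0) (at_right 0)"
        by (rule Lim_transform_eventually)
          (auto simp: eventually_at_filter flat_def divide_inverse mult_ac intro!: always_eventually)
    qed
    then show ?thesis using 3 by (simp add: has_field_derivative_iff flat_def)
  qed
qed

lemma times_differentiable_flat: "times_differentiable n (flat p)"
proof (induction n arbitrary: p)
  case (Suc n)
  from flat_deriv[unfolded has_real_derivative_iff_has_vector_derivative] this show ?case
    by (rule times_differentiable_SucI)
qed simp

text \<open>The denominator is positive because t and 1 - t are never both nonpositive. The form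
  \<open>- 1 * t + 1\<close> matches \<open>times_differentiable_affine\<close>.\<close>

definition smooth_step :: "real \<Rightarrow> real" where
  "smooth_step t = flat 1 t * inverse (flat 1 t + flat 1 (- 1 * t + 1))"

lemma flat_1_nonneg: "flat 1 t \<ge> 0" and flat_1_pos: "t > 0 \<Longrightarrow> flat 1 t > 0" and flat_nonpos: "t \<le> 0 \<Longrightarrow> flat p t = 0"
  by (auto simp: flat_def)

lemma smooth_step_denominator: "flat 1 t + flat 1 (- 1 * t + 1) > 0"
proof (cases "t > 0")
  case True
  then show ?thesis using flat_1_pos[of t] flat_1_nonneg[of "- 1 * t + 1"] by linarith
next
  case False
  then show ?thesis using flat_1_nonneg[of t] flat_1_pos[of "- 1 * t + 1"] by linarith
qed

lemma times_differentiable_smooth_step: "times_differentiable n smooth_step"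
proof -
  have "times_differentiable n (\<lambda>t. flat 1 t * inverse (flat 1 t + flat 1 (- 1 * t + 1)))"
    using smooth_step_denominator
    by (intro times_differentiable_mult times_differentiable_inverse times_differentiable_add
        times_differentiable_affine[where f = "flat 1"] times_differentiable_flat) (metis less_irrefl)
  then show ?thesis by (simp add: smooth_step_def[abs_def])
qed

lemma smooth_step_bounds: "0 \<le> smooth_step t" "smooth_step t \<le> 1"
  using smooth_step_denominator[of t] flat_1_nonneg[of t] flat_1_nonneg[of "- 1 * t + 1"]
  by (auto simp: smooth_step_def divide_inverse[symmetric] divide_le_eq)

lemma smooth_step_eq: "t \<le> 0 \<Longrightarrow> smooth_step t = 0" "t \<ge> 1 \<Longrightarrow> smooth_step t = 1"
  using smooth_step_denominator[of t] by (auto simp: smooth_step_def flat_nonpos)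

lemma smooth_cutoff:
  fixes \<delta> :: real
  assumes "0 < \<delta>" "\<delta> \<le> 1/4"
  obtains \<kappa> :: "real \<Rightarrow> real" where "\<And>n. times_differentiable n \<kappa>" "\<And>t. 0 \<le> \<kappa> t" "\<And>t. \<kappa> t \<le> 1"
    "\<And>t. \<delta> / 2 \<le> t \<Longrightarrow> t \<le> 1 - \<delta> / 2 \<Longrightarrow> \<kappa> t = 1"
    "\<And>t. \<kappa> t \<noteq> 0 \<Longrightarrow> \<delta> / 4 \<le> t \<and> t \<le> 1 - \<delta> / 4"
proof
  \<comment> \<open>The first argument is 0 at \<open>\<delta> / 4\<close> and 1 at
    \<open>\<delta> / 2\<close>; the second is its mirror image under t -> 1 - t. For an f vanishing
    outside \<open>inner_cube \<delta>\<close>, the plateau then leaves room for an open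
    neighbourhood of that cube.\<close>
  let ?\<kappa> = "\<lambda>t. smooth_step (4 / \<delta> * t + (- 1)) * smooth_step (- 4 / \<delta> * t + (4 / \<delta> - 1))"
  show "times_differentiable n ?\<kappa>" for n
    by (intro times_differentiable_mult times_differentiable_affine[OF times_differentiable_smooth_step])
  show "0 \<le> ?\<kappa> t" "?\<kappa> t \<le> 1" for t
    by (auto intro!: mult_nonneg_nonneg mult_le_one smooth_step_bounds)
  show "?\<kappa> t = 1" if "\<delta> / 2 \<le> t" "t \<le> 1 - \<delta> / 2" for t
  proof -
    have "2 \<le> 4 / \<delta> * t" "2 \<le> 4 / \<delta> * (1 - t)"
      using assms that by (simp_all add: pos_le_divide_eq)
    then have "4 / \<delta> * t + (- 1) \<ge> 1" "- 4 / \<delta> * t + (4 / \<delta> - 1) \<ge> 1"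
      by (simp_all add: right_diff_distrib)
    then show ?thesis by (simp only: smooth_step_eq)
  qed
  show "\<delta> / 4 \<le> t \<and> t \<le> 1 - \<delta> / 4" if "?\<kappa> t \<noteq> 0" for t
  proof -
    have "4 / \<delta> * t + (- 1) > 0" "- 4 / \<delta> * t + (4 / \<delta> - 1) > 0"
      using that smooth_step_eq(1) by (metis mult_eq_0_iff not_less)+
    then have "1 < 4 / \<delta> * t" "1 < 4 / \<delta> * (1 - t)"
      by (simp_all add: right_diff_distrib)
    then show ?thesis using assms by (simp_all add: pos_less_divide_eq)
  qed
qed

text \<open>An explicit iterate, because \<open>classical_derivs\<close> asks for a named family of
  derivatives; it has the expected meaning for smooth functions.\<close>

definition nth_derivative :: "nat \<Rightarrow> (real \<Rightarrow> complex) \<Rightarrow> real \<Rightarrow> complex" where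
  "nth_derivative n f = ((\<lambda>g t. vector_derivative g (at t)) ^^ n) f"

lemma nth_derivative_0 [simp]: "nth_derivative 0 f = f"
  by (simp add: nth_derivative_def)

lemma nth_derivative_Suc: "nth_derivative (Suc n) f = (\<lambda>t. vector_derivative (nth_derivative n f) (at t))"
  by (simp add: nth_derivative_def)

lemma smooth_nth_derivative:
  assumes "\<And>n. times_differentiable n f"
  shows "times_differentiable m (nth_derivative n f)"
proof (induction n arbitrary: m)
  case (Suc n)
  from Suc[of "Suc m"] obtain f' where f': "\<forall>t. (nth_derivative n f has_vector_derivative f' t) (at t)" "times_differentiable m f'"
    by auto
  then have "nth_derivative (Suc n) f = f'"
    by (auto simp: nth_derivative_Suc fun_eq_iff intro: vector_derivative_at)
  then show ?case using f'(2) by simp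
qed (use assms in auto)

lemma nth_derivative_has_vector_derivative:
  assumes "\<And>n. times_differentiable n f"
  shows "(nth_derivative n f has_vector_derivative nth_derivative (Suc n) f t) (at t)"
proof -
  from smooth_nth_derivative[OF assms, of "Suc 0" n]
  have "nth_derivative n f differentiable at t"
    by (auto intro: differentiableI_vector)
  then show ?thesis
    by (simp add: nth_derivative_Suc vector_derivative_works)
qed

lemma continuous_on_nth_derivative:
  assumes "\<And>n. times_differentiable n f"
  shows "continuous_on S (nth_derivative n f)"
  by (rule continuous_on_subset[of UNIV])
    (auto intro!: continuous_at_imp_continuous_on has_vector_derivative_continuous
      nth_derivative_has_vector_derivative assms)

text \<open>Differentiation is local: where the cutoff is 1 the modulated function is a plain
  exponential. Openness of the set is what lets the induction differentiate the equation.\<close>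

lemma nth_derivative_local:
  assumes f: "\<And>n. times_differentiable n f" and "open S" "t \<in> S"
    and eq: "\<And>t. t \<in> S \<Longrightarrow> f t = cis (w * t)"
  shows "nth_derivative n f t = (\<i> * of_real w) ^ n * cis (w * t)"
  using \<open>t \<in> S\<close>
proof (induction n arbitrary: t)
  case (Suc n)
  have "((\<lambda>t. (\<i> * of_real w) ^ n * cis (w * t)) has_vector_derivative (\<i> * of_real w) ^ n * (\<i> * of_real w * cis (w * t))) (at t)"
    by (intro has_vector_derivative_mult_right cis_has_vector_derivative)
  then have "(nth_derivative n f has_vector_derivative (\<i> * of_real w) ^ n * (\<i> * of_real w * cis (w * t))) (at t)"
    by (rule has_vector_derivative_transform_within_open[OF _ \<open>open S\<close> Suc.prems]) (simp add: Suc.IH)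
  then show ?case
    by (simp add: nth_derivative_Suc vector_derivative_at mult_ac)
qed (simp add: eq)

text \<open>A tensor product is differentiated factor by factor. The factors are complex for the
  sake of exponentials; the real part, with a free constant \<open>c\<close>, returns real-valued
  functions and still reaches any phase.\<close>

lemma product_classical_derivs:
  fixes g :: "'d::finite \<Rightarrow> real \<Rightarrow> complex"
  assumes g: "\<And>i n. times_differentiable n (g i)"
  shows "classical_derivs k (\<lambda>x. Re (c * (\<Prod>i\<in>UNIV. g i (x $ i))))
    (\<lambda>\<alpha> x. Re (c * (\<Prod>i\<in>UNIV. nth_derivative (\<alpha> i) (g i) (x $ i))))"
  unfolding classical_derivs_def
proof (intro conjI allI impI)
  fix \<alpha> :: "'d \<Rightarrow> nat"
  show "continuous_on unit_cube (\<lambda>x. Re (c * (\<Prod>i\<in>UNIV. nth_derivative (\<alpha> i) (g i) (x $ i))))"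
    by (intro continuous_intros continuous_on_compose2[OF continuous_on_nth_derivative[OF g, of UNIV]]) auto
  fix i
  show "has_partial_deriv i (\<lambda>x. Re (c * (\<Prod>i\<in>UNIV. nth_derivative (\<alpha> i) (g i) (x $ i))))
      (\<lambda>x. Re (c * (\<Prod>j\<in>UNIV. nth_derivative ((\<alpha>(i := Suc (\<alpha> i))) j) (g j) (x $ j))))"
    unfolding has_partial_deriv_def
  proof
    fix x :: "real ^ 'd"
    define P where "P = (\<Prod>j\<in>UNIV - {i}. nth_derivative (\<alpha> j) (g j) (x $ j))"
    have split: "(\<Prod>j\<in>UNIV. nth_derivative (\<alpha> j) (g j) ((x + t *\<^sub>R axis i 1) $ j)) =
        nth_derivative (\<alpha> i) (g i) (x $ i + t) * P" for t
    proof -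
      have "(\<Prod>j\<in>UNIV - {i}. nth_derivative (\<alpha> j) (g j) ((x + t *\<^sub>R axis i 1) $ j)) = P"
        unfolding P_def by (rule prod.cong) (auto simp: axis_def)
      then show ?thesis by (subst prod.remove[of _ i]) (auto simp: axis_def)
    qed
    have split': "(\<Prod>j\<in>UNIV. nth_derivative ((\<alpha>(i := Suc (\<alpha> i))) j) (g j) (x $ j)) =
        nth_derivative (Suc (\<alpha> i)) (g i) (x $ i) * P"
    proof -
      have "(\<Prod>j\<in>UNIV - {i}. nth_derivative ((\<alpha>(i := Suc (\<alpha> i))) j) (g j) (x $ j)) = P"
        unfolding P_def by (rule prod.cong) auto
      then show ?thesis by (subst prod.remove[of _ i]) auto
    qed
    have "((\<lambda>t. nth_derivative (\<alpha> i) (g i) (x $ i + t)) has_vector_derivative nth_derivative (Suc (\<alpha> i)) (g i) (x $ i)) (at 0)"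
    proof -
      have "((\<lambda>t. x $ i + t) has_vector_derivative 1) (at 0)"
        by (auto intro!: derivative_eq_intros simp: has_real_derivative_iff_has_vector_derivative[symmetric])
      from vector_diff_chain_at[OF this nth_derivative_has_vector_derivative[OF g, of "\<alpha> i" i "x $ i + 0"]]
      show ?thesis by (simp add: o_def)
    qed
    then have "((\<lambda>t. Re (c * (nth_derivative (\<alpha> i) (g i) (x $ i + t) * P))) has_vector_derivative
        Re (c * (nth_derivative (Suc (\<alpha> i)) (g i) (x $ i) * P))) (at 0)"
      by (intro bounded_linear.has_vector_derivative[OF bounded_linear_Re]
          has_vector_derivative_mult_right has_vector_derivative_mult_left)
    then show "((\<lambda>t. Re (c * (\<Prod>j\<in>UNIV. nth_derivative (\<alpha> j) (g j) ((x + t *\<^sub>R axis i 1) $ j)))) has_real_derivative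
        Re (c * (\<Prod>j\<in>UNIV. nth_derivative ((\<alpha>(i := Suc (\<alpha> i))) j) (g j) (x $ j))))
        (at 0 within {t. x + t *\<^sub>R axis i 1 \<in> unit_cube})"
      unfolding split split' has_real_derivative_iff_has_vector_derivative
      by (rule has_vector_derivative_at_within)
  qed
qed simp

lemma times_differentiable_continuous:
  assumes "times_differentiable (Suc 0) f"
  shows "continuous_on S f"
proof -
  from assms obtain f' where "\<And>t. (f has_vector_derivative f' t) (at t)" by auto
  then have "continuous_on UNIV f"
    by (intro continuous_at_imp_continuous_on ballI has_vector_derivative_continuous)
  then show ?thesis by (rule continuous_on_subset) simp
qed

lemma L2_mult_bounded:
  assumes g: "g \<in> L2" and \<psi>: "continuous_on unit_cube \<psi>" "\<And>x. \<bar>\<psi> x\<bar> \<le> 1"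
  shows "(\<lambda>x. g x * \<psi> x) \<in> L2"
    "(LINT x:unit_cube|lborel. (g x * \<psi> x)\<^sup>2) \<le> (LINT x:unit_cube|lborel. (g x)\<^sup>2)"
proof -
  have le: "(g x * \<psi> x)\<^sup>2 \<le> (g x)\<^sup>2" for x
    using \<psi>(2)[of x] by (simp add: power_mult_distrib mult_left_le abs_square_le_1)
  have gm: "(\<lambda>x. indicator unit_cube x *\<^sub>R g x) \<in> borel_measurable lborel"
    using g by (auto simp: L2_def set_borel_measurable_def)
  have \<psi>m: "(\<lambda>x. indicator unit_cube x *\<^sub>R \<psi> x) \<in> borel_measurable lborel"
    using borel_measurable_continuous_on_indicator[OF sets_unit_cube \<psi>(1)] by simp
  have eq: "(\<lambda>x. indicator unit_cube x *\<^sub>R (g x * \<psi> x)) = (\<lambda>x. (indicator unit_cube x *\<^sub>R g x) * (indicator unit_cube x *\<^sub>R \<psi> x))"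
    by (auto simp: indicator_def)
  have eq2: "(\<lambda>x. indicator unit_cube x *\<^sub>R (g x * \<psi> x)\<^sup>2) = (\<lambda>x. ((indicator unit_cube x *\<^sub>R g x) * (indicator unit_cube x *\<^sub>R \<psi> x))\<^sup>2)"
    by (auto simp: indicator_def)
  have m: "set_borel_measurable lborel unit_cube (\<lambda>x. g x * \<psi> x)"
    unfolding set_borel_measurable_def eq by (rule borel_measurable_times[OF gm \<psi>m])
  have gi: "set_integrable lborel unit_cube (\<lambda>x. (g x)\<^sup>2)"
    using g by (simp add: L2_def)
  have i: "set_integrable lborel unit_cube (\<lambda>x. (g x * \<psi> x)\<^sup>2)"
    unfolding set_integrable_def
  proof (rule Bochner_Integration.integrable_bound[OF gi[unfolded set_integrable_def]])
    show "(\<lambda>x. indicator unit_cube x *\<^sub>R (g x * \<psi> x)\<^sup>2) \<in> borel_measurable lborel"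
      unfolding eq2 by (intro borel_measurable_power borel_measurable_times gm \<psi>m)
    show "AE x in lborel. norm (indicator unit_cube x *\<^sub>R (g x * \<psi> x)\<^sup>2) \<le> norm (indicator unit_cube x *\<^sub>R (g x)\<^sup>2)"
      using le by (intro always_eventually allI) (auto simp: indicator_def)
  qed
  show "(\<lambda>x. g x * \<psi> x) \<in> L2" using m i by (simp add: L2_def)
  show "(LINT x:unit_cube|lborel. (g x * \<psi> x)\<^sup>2) \<le> (LINT x:unit_cube|lborel. (g x)\<^sup>2)"
    by (rule set_integral_mono[OF i gi le])
qed

abbreviation plane_wave :: "real ^ 'd::finite \<Rightarrow> real ^ 'd \<Rightarrow> complex" where
  "plane_wave k x \<equiv> cis (2 * pi * (k \<bullet> x))"

text \<open>The test functions are the plane waves multiplied by a cutoff that is 1 near the support of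
  \<^term>\<open>f\<close>; the cutoff is then absorbed into the weak derivative.\<close>

lemma H_mix_ring_pairing:
  fixes f :: "real ^ 'd::finite \<Rightarrow> real"
  assumes f: "f \<in> H_mix_ring s" and \<alpha>: "\<alpha> \<in> mix_indices s"
  obtains v where "v \<in> L2" "(LINT x:unit_cube|lborel. (v x)\<^sup>2) \<le> 4"
    "\<And>c k. (LINT x:unit_cube|lborel. f x * Re (c * (\<Prod>i\<in>UNIV. (\<i> * of_real (2 * pi * k $ i)) ^ \<alpha> i) * plane_wave k x)) =
      (-1) ^ midx_order \<alpha> * (LINT x:unit_cube|lborel. v x * Re (c * plane_wave k x))"
proof -
  have fH: "f \<in> H_mix s" and fs: "supp f \<subseteq> box 0 1" using f by (auto simp: H_mix_ring_def)
  obtain w where w: "L2_weak_deriv \<alpha> f w" "(LINT x:unit_cube|lborel. (w x)\<^sup>2) \<le> 4"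
    using H_mix_weak_deriv[OF fH \<alpha>] .
  have wL: "w \<in> L2" using w(1) by (simp add: L2_weak_deriv_def)
  obtain \<delta> where \<delta>: "0 < \<delta>" "\<delta> \<le> 1/4" "vanishes_near_boundary \<delta> f"
    using supp_vanishes[OF fs] .
  obtain \<kappa> :: "real \<Rightarrow> real" where \<kappa>: "\<And>n. times_differentiable n \<kappa>" "\<And>t. 0 \<le> \<kappa> t" "\<And>t. \<kappa> t \<le> 1"
    "\<And>t. \<delta> / 2 \<le> t \<Longrightarrow> t \<le> 1 - \<delta> / 2 \<Longrightarrow> \<kappa> t = 1"
    "\<And>t. \<kappa> t \<noteq> 0 \<Longrightarrow> \<delta> / 4 \<le> t \<and> t \<le> 1 - \<delta> / 4"
    using smooth_cutoff[OF \<delta>(1,2)] by blast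
  define \<psi> where "\<psi> x = (\<Prod>i\<in>UNIV. \<kappa> (x $ i))" for x :: "real ^ 'd"
  have \<psi>c: "continuous_on unit_cube \<psi>"
    unfolding \<psi>_def
    by (intro continuous_intros continuous_on_compose2[OF times_differentiable_continuous[OF \<kappa>(1), of UNIV]]) auto
  have \<psi>b: "\<bar>\<psi> x\<bar> \<le> 1" for x
    unfolding \<psi>_def abs_prod using \<kappa>(2,3) by (intro prod_le_1) auto
  \<comment> \<open>The witness is the weak derivative times the cutoff. It is fixed before
    \<open>c\<close> and \<open>k\<close>, so that one function serves all frequencies sharing the
    multi-index.\<close>
  show ?thesis
  proof (rule that[of "\<lambda>x. w x * \<psi> x"])
    show "(\<lambda>x. w x * \<psi> x) \<in> L2" by (rule L2_mult_bounded[OF wL \<psi>c \<psi>b])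
    show "(LINT x:unit_cube|lborel. (w x * \<psi> x)\<^sup>2) \<le> 4"
      using L2_mult_bounded(2)[OF wL \<psi>c \<psi>b] w(2) by linarith
    fix c :: complex and k :: "real ^ 'd"
    define g where "g i t = complex_of_real (\<kappa> t) * cis (2 * pi * k $ i * t)" for i t
    have g: "times_differentiable n (g i)" for n i
      unfolding g_def
      by (intro times_differentiable_mult times_differentiable_of_real \<kappa>(1) times_differentiable_cis)
    define \<phi> where "\<phi> x = Re (c * (\<Prod>i\<in>UNIV. g i (x $ i)))" for x
    have cis: "plane_wave k x = (\<Prod>i\<in>UNIV. cis (2 * pi * k $ i * x $ i))" for x :: "real ^ 'd"
      by (simp add: inner_vec_def sum_distrib_left cis_sum[symmetric] mult.assoc)
    have \<phi>: "\<phi> x = \<psi> x * Re (c * plane_wave k x)" for x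
    proof -
      have "c * (\<Prod>i\<in>UNIV. g i (x $ i)) = of_real (\<psi> x) * (c * plane_wave k x)"
        by (simp add: g_def \<psi>_def cis prod.distrib)
      moreover have "Re (of_real r * z) = r * Re z" for r z by simp
      ultimately show ?thesis by (simp only: \<phi>_def)
    qed
    define F where "F \<alpha> x = Re (c * (\<Prod>i\<in>UNIV. nth_derivative (\<alpha> i) (g i) (x $ i)))" for \<alpha> x
    have F: "classical_derivs n \<phi> F" for n
      using product_classical_derivs[OF g, where c = c and k = n] unfolding \<phi>_def[abs_def] F_def[abs_def] .
    have "supp \<phi> \<subseteq> cbox (vec (\<delta> / 4)) (vec (1 - \<delta> / 4))"
      unfolding supp_def
    proof (rule closure_minimal)
      show "{x \<in> unit_cube. \<phi> x \<noteq> 0} \<subseteq> cbox (vec (\<delta> / 4)) (vec (1 - \<delta> / 4))"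
      proof
        fix x assume "x \<in> {x \<in> unit_cube. \<phi> x \<noteq> 0}"
        then have "\<psi> x \<noteq> 0" by (auto simp: \<phi>)
        then have "\<kappa> (x $ i) \<noteq> 0" for i by (auto simp: \<psi>_def)
        then show "x \<in> cbox (vec (\<delta> / 4)) (vec (1 - \<delta> / 4))"
          using \<kappa>(5) by (simp only: mem_box_cart vec_component) blast
      qed
    qed (rule closed_cbox)
    also have "\<dots> \<subseteq> box 0 1"
    proof
      fix x assume x: "x \<in> cbox (vec (\<delta> / 4)) (vec (1 - \<delta> / 4) :: real ^ 'd)"
      have "0 < x $ i \<and> x $ i < 1" for i
      proof -
        have "\<delta> / 4 \<le> x $ i" "x $ i \<le> 1 - \<delta> / 4" using x by (auto simp: mem_box_cart)
        then show ?thesis using \<delta>(1) by linarith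
      qed
      then show "x \<in> box 0 1" by (simp add: mem_box_cart)
    qed
    finally have test: "\<phi> \<in> test_functions"
      using F by (auto simp: test_functions_def C_k_def)
    then have \<phi>C: "\<phi> \<in> C_k (midx_order \<alpha>)" by (simp add: test_functions_def)
    have D: "classical_deriv \<alpha> \<phi> x = F \<alpha> x" if "x \<in> unit_cube" for x
      using classical_deriv_some[OF \<phi>C] classical_derivs_unique[OF _ F order_refl that] by metis
    \<comment> \<open>On the inner cube the cutoff is 1 in a neighbourhood, so every derivative
      falls on the exponentials; elsewhere f is 0 and the derivatives of the cutoff do not
      matter.\<close>
    have "f x * Re (c * (\<Prod>i\<in>UNIV. (\<i> * of_real (2 * pi * k $ i)) ^ \<alpha> i) * plane_wave k x) = f x * classical_deriv \<alpha> \<phi> x"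
      if x: "x \<in> unit_cube" for x
    proof (cases "x \<in> inner_cube \<delta>")
      case True
      have "nth_derivative (\<alpha> i) (g i) (x $ i) = (\<i> * of_real (2 * pi * k $ i)) ^ \<alpha> i * cis (2 * pi * k $ i * x $ i)" for i
      proof (rule nth_derivative_local[OF g, where S = "{\<delta> / 2<..<1 - \<delta> / 2}"])
        have "\<delta> \<le> x $ i" "x $ i \<le> 1 - \<delta>" using True by (auto simp: mem_box_cart)
        then show "x $ i \<in> {\<delta> / 2<..<1 - \<delta> / 2}" using \<delta>(1) by auto
      qed (auto simp: g_def \<kappa>(4))
      then show ?thesis
        unfolding D[OF x] F_def cis by (simp add: prod.distrib mult.assoc)
    next
      case False
      then have "f x = 0" using \<delta>(3) x by (simp add: vanishes_near_boundary_def)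
      then show ?thesis by simp
    qed
    then have "(LINT x:unit_cube|lborel. f x * Re (c * (\<Prod>i\<in>UNIV. (\<i> * of_real (2 * pi * k $ i)) ^ \<alpha> i) * plane_wave k x)) =
       (LINT x:unit_cube|lborel. f x * classical_deriv \<alpha> \<phi> x)"
      by (intro set_lebesgue_integral_cong) auto
    also have "\<dots> = (-1) ^ midx_order \<alpha> * (LINT x:unit_cube|lborel. w x * \<phi> x)"
      using w(1) test by (simp add: L2_weak_deriv_def)
    finally show "(LINT x:unit_cube|lborel. f x * Re (c * (\<Prod>i\<in>UNIV. (\<i> * of_real (2 * pi * k $ i)) ^ \<alpha> i) * plane_wave k x)) =
      (-1) ^ midx_order \<alpha> * (LINT x:unit_cube|lborel. w x * \<psi> x * Re (c * plane_wave k x))"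
      by (simp add: \<phi> mult.assoc)
  qed
qed

section \<open>The error bound\<close>

abbreviation dilate :: "real \<Rightarrow> real ^ 'd::finite ^ 'd \<Rightarrow> real ^ 'd \<Rightarrow> real ^ 'd" where
  "dilate a A x \<equiv> a *\<^sub>R (transpose A *v x)"

definition int_vec :: "('d::finite \<Rightarrow> int) \<Rightarrow> real ^ 'd" where
  "int_vec m = (\<chi> i. of_int (m i))"

lemma character_linear:
  "character m (dilate a A x) = plane_wave (a *\<^sub>R (A *v int_vec m)) x"
proof -
  have "(\<Sum>i\<in>UNIV. of_int (m i) * (dilate a A x) $ i) = (dilate a A x) \<bullet> int_vec m"
    by (simp add: inner_vec_def int_vec_def mult_ac)
  also have "\<dots> = a * ((x v* A) \<bullet> int_vec m)"
    by (simp add: transpose_matrix_vector)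
  also have "\<dots> = (a *\<^sub>R (A *v int_vec m)) \<bullet> x"
    unfolding dot_lmul_matrix by (simp add: inner_commute)
  finally show ?thesis by (simp add: character_def)
qed

text \<open>A weighted arithmetic-geometric mean inequality in place of Cauchy-Schwarz: |v p| <=
  (t/2) v^2 + p^2/(2t) with t the square root of \<open>\<beta>\<close> integrates to at most 2t +
  t/2, whence the factor 5/2.\<close>

lemma L2_pairing_le:
  assumes v: "v \<in> L2" "(LINT x:unit_cube|lborel. (v x)\<^sup>2) \<le> 4"
    and p: "continuous_on unit_cube p" "(LINT x:unit_cube|lborel. (p x)\<^sup>2) \<le> \<beta>" and "\<beta> > 0"
  shows "\<bar>LINT x:unit_cube|lborel. v x * p x\<bar> \<le> 5 / 2 * sqrt \<beta>"
proof -
  define t where "t = sqrt \<beta>"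
  have t: "t > 0" "\<beta> = t * t" using assms by (auto simp: t_def)
  have pL: "p \<in> L2" by (rule continuous_on_L2[OF p(1)])
  have int: "set_integrable lborel unit_cube (\<lambda>x. v x * p x)" by (rule L2_mult_integrable[OF v(1) pL])
  have int2: "set_integrable lborel unit_cube (\<lambda>x. t / 2 * (v x)\<^sup>2)" "set_integrable lborel unit_cube (\<lambda>x. 1 / (2 * t) * (p x)\<^sup>2)"
    using v pL by (auto simp only: L2_def intro!: set_integrable_mult_right)
  have "\<bar>LINT x:unit_cube|lborel. v x * p x\<bar> \<le> (LINT x:unit_cube|lborel. \<bar>v x * p x\<bar>)"
    using set_integral_norm_bound[OF int] by (simp only: real_norm_def)
  also have "\<dots> \<le> (LINT x:unit_cube|lborel. t / 2 * (v x)\<^sup>2 + 1 / (2 * t) * (p x)\<^sup>2)"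
  proof (rule set_integral_mono)
    show "set_integrable lborel unit_cube (\<lambda>x. \<bar>v x * p x\<bar>)"
      using set_integrable_norm[OF int] by (simp only: real_norm_def)
    show "set_integrable lborel unit_cube (\<lambda>x. t / 2 * (v x)\<^sup>2 + 1 / (2 * t) * (p x)\<^sup>2)"
      by (intro set_integral_add int2)
    show "\<bar>v x * p x\<bar> \<le> t / 2 * (v x)\<^sup>2 + 1 / (2 * t) * (p x)\<^sup>2" for x
    proof -
      have "0 \<le> (t * \<bar>v x\<bar> - \<bar>p x\<bar>)\<^sup>2" by simp
      then have "2 * t * \<bar>v x * p x\<bar> \<le> t\<^sup>2 * (v x)\<^sup>2 + (p x)\<^sup>2"
        by (simp add: power2_diff power_mult_distrib abs_mult mult_ac)
      then have "2 * t * \<bar>v x * p x\<bar> / (2 * t) \<le> (t\<^sup>2 * (v x)\<^sup>2 + (p x)\<^sup>2) / (2 * t)"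
        using t by (intro divide_right_mono) auto
      moreover have "(t\<^sup>2 * (v x)\<^sup>2 + (p x)\<^sup>2) / (2 * t) = t / 2 * (v x)\<^sup>2 + 1 / (2 * t) * (p x)\<^sup>2"
        using t(1) by (simp add: add_divide_distrib power2_eq_square)
      ultimately show ?thesis using t by simp
    qed
  qed
  also have "\<dots> = t / 2 * (LINT x:unit_cube|lborel. (v x)\<^sup>2) + 1 / (2 * t) * (LINT x:unit_cube|lborel. (p x)\<^sup>2)"
    by (subst set_integral_add(2)[OF int2]) (simp only: set_integral_mult_right)
  also have "\<dots> \<le> t / 2 * 4 + 1 / (2 * t) * \<beta>"
    using v p t by (intro add_mono mult_left_mono) auto
  also have "1 / (2 * t) * \<beta> = t / 2"
    using t assms(5) by (simp add: field_simps)
  finally show ?thesis by (simp add: t_def)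
qed

lemma transpose_mult_bound:
  fixes A :: "real ^ 'd::finite ^ 'd"
  assumes "x \<in> unit_cube"
  shows "\<bar>(transpose A *v x) $ i\<bar> \<le> (\<Sum>i\<in>UNIV. \<Sum>j\<in>UNIV. \<bar>A $ j $ i\<bar>)"
proof -
  have "\<bar>(transpose A *v x) $ i\<bar> \<le> (\<Sum>j\<in>UNIV. \<bar>A $ j $ i * x $ j\<bar>)"
    by (simp add: matrix_vector_mult_def transpose_def)
  also have "\<dots> \<le> (\<Sum>j\<in>UNIV. \<bar>A $ j $ i\<bar>)"
    using assms by (intro sum_mono) (simp add: abs_mult mem_unit_cube mult_left_le)
  also have "\<dots> \<le> (\<Sum>i\<in>UNIV. \<Sum>j\<in>UNIV. \<bar>A $ j $ i\<bar>)"
    by (rule member_le_sum) (auto intro: sum_nonneg)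
  finally show ?thesis .
qed

text \<open>The frequencies form a group, so the lower bound on the norm form yields both the size
  of each point and the separation of any two, as \<open>sparse_set_sum_bound\<close> requires. The
  choice a^d = 2^l makes both bounds powers of two.\<close>

lemma sum_norm_form_bound:
  fixes A :: "real ^ 'd::finite ^ 'd"
  assumes form: "\<And>m :: 'd \<Rightarrow> int. m \<noteq> (\<lambda>_. 0) \<Longrightarrow> abs_norm_form A m \<ge> 1"
    and s: "s \<ge> 1"
  obtains C :: real where "C > 0"
    "\<And>(l :: nat) (a :: real) M. a > 0 \<Longrightarrow> a ^ CARD('d) = 2 ^ l \<Longrightarrow> finite M \<Longrightarrow> (\<lambda>_. 0) \<notin> M \<Longrightarrow>
      (\<Sum>m\<in>M. 1 / max_one_prod (a *\<^sub>R (A *v int_vec m)) ^ (2 * s)) \<le>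
      C * real (l + 1) ^ (CARD('d) - 1) / 2 ^ (2 * s * l)"
proof -
  obtain C where C: "C > 0"
    "\<And>L (K :: (real ^ 'd::finite) set). finite K \<Longrightarrow>
      (\<And>x. x \<in> K \<Longrightarrow> (\<Prod>i\<in>UNIV. \<bar>x $ i\<bar>) \<ge> 2 ^ L) \<Longrightarrow>
      (\<And>x y. x \<in> K \<Longrightarrow> y \<in> K \<Longrightarrow> x \<noteq> y \<Longrightarrow> (\<Prod>i\<in>UNIV. \<bar>x $ i - y $ i\<bar>) \<ge> 2 ^ L) \<Longrightarrow>
      (\<Sum>x\<in>K. 1 / max_one_prod x ^ (2 * s)) \<le> C * real (L + 1) ^ (CARD('d) - 1) / 2 ^ (2 * s * L)"
    using sparse_set_sum_bound[OF s, where ?'d = 'd] by blast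
  show ?thesis
  proof (rule that[OF C(1)])
    fix l :: nat and a :: real and M :: "('d \<Rightarrow> int) set"
    assume a: "a > 0" "a ^ CARD('d) = 2 ^ l" and M: "finite M" "(\<lambda>_. 0) \<notin> M"
    define k where "k m = a *\<^sub>R (A *v int_vec m)" for m
    have kdiff: "k m - k m' = k (\<lambda>i. m i - m' i)" for m m'
    proof -
      have "int_vec m - int_vec m' = int_vec (\<lambda>i. m i - m' i)"
        by (simp add: int_vec_def vec_eq_iff)
      then show ?thesis
        by (simp add: k_def flip: scaleR_diff_right matrix_vector_mult_diff_distrib)
    qed
    have kprod: "(\<Prod>i\<in>UNIV. \<bar>k m $ i\<bar>) \<ge> 2 ^ l" if "m \<noteq> (\<lambda>_. 0)" for m
    proof -
      have "(\<Prod>i\<in>UNIV. \<bar>k m $ i\<bar>) = a ^ CARD('d) * abs_norm_form A m"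
        using a(1) by (simp add: k_def abs_mult prod.distrib abs_prod matrix_vector_mult_def int_vec_def)
      also have "\<dots> \<ge> 2 ^ l * 1"
        unfolding a(2) by (intro mult_left_mono form that) auto
      finally show ?thesis by simp
    qed
    have diff: "(\<Prod>i\<in>UNIV. \<bar>k m $ i - k m' $ i\<bar>) \<ge> 2 ^ l" if "m \<noteq> m'" for m m'
    proof -
      have "(\<lambda>i. m i - m' i) \<noteq> (\<lambda>_. 0)" using that by (auto simp: fun_eq_iff)
      from kprod[OF this] show ?thesis by (simp flip: kdiff)
    qed
    have inj: "inj_on k M"
    proof (rule inj_onI, rule ccontr)
      fix m m' assume "k m = k m'" "m \<noteq> m'"
      then have "(2::real) ^ l \<le> 0" using diff[of m m'] by (simp add: power_0_left)
      then show False using zero_less_power[of "2::real" l] by linarith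
    qed
    have "(\<Sum>m\<in>M. 1 / max_one_prod (k m) ^ (2 * s)) = (\<Sum>x\<in>k ` M. 1 / max_one_prod x ^ (2 * s))"
      by (simp add: sum.reindex[OF inj])
    also have "\<dots> \<le> C * real (l + 1) ^ (CARD('d) - 1) / 2 ^ (2 * s * l)"
    proof (rule C(2))
      show "finite (k ` M)" using M by simp
      show "(\<Prod>i\<in>UNIV. \<bar>x $ i\<bar>) \<ge> 2 ^ l" if x: "x \<in> k ` M" for x
      proof -
        obtain m where m: "m \<in> M" "x = k m" using x by blast
        then have "m \<noteq> (\<lambda>_. 0)" using M(2) by metis
        from kprod[OF this] show ?thesis unfolding m(2) .
      qed
      show "(\<Prod>i\<in>UNIV. \<bar>x $ i - y $ i\<bar>) \<ge> 2 ^ l" if xy: "x \<in> k ` M" "y \<in> k ` M" "x \<noteq> y" for x y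
      proof -
        obtain m m' where m: "x = k m" "y = k m'" using xy by blast
        then have "m \<noteq> m'" using xy by metis
        from diff[OF this] show ?thesis unfolding m .
      qed
    qed
    finally show "(\<Sum>m\<in>M. 1 / max_one_prod (a *\<^sub>R (A *v int_vec m)) ^ (2 * s)) \<le>
      C * real (l + 1) ^ (CARD('d) - 1) / 2 ^ (2 * s * l)" by (simp only: k_def)
  qed
qed

text \<open>The linear map sends the cube into a box of integer side 2R proportional to a. Parseval
  on that box costs a factor (2R)^d, and the change of variables returns a^(-d), so the constant
  does not depend on a.\<close>

lemma trig_poly_L2_bound:
  fixes A :: "real ^ 'd::finite ^ 'd"
  assumes det: "det A \<noteq> 0"
  obtains C :: real where "C > 0"
    "\<And>(a :: real) M c. a \<ge> 1 \<Longrightarrow> finite M \<Longrightarrow>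
      (LINT x:unit_cube|lborel. (norm (\<Sum>m\<in>M. c m * character m (dilate a A x)))\<^sup>2)
        \<le> C * (\<Sum>m\<in>M. (norm (c m :: complex))\<^sup>2)"
proof -
  have lin: "linear ((*v) (transpose A))" by (rule matrix_vector_mul_linear)
  have bij: "bij ((*v) (transpose A))"
    using det invertible_eq_bij[of "transpose A"] by (simp add: invertible_det_nz det_transpose)
  obtain c0 where c0: "c0 > 0"
    "\<And>(f :: real ^ 'd \<Rightarrow> real) a. integrable lborel f \<Longrightarrow> a > 0 \<Longrightarrow>
      has_bochner_integral lborel (\<lambda>x. f (dilate a A x)) (c0 / a ^ DIM(real ^ 'd) * integral\<^sup>L lborel f)"
    using integral_scaled_linear[OF lin bij] by blast
  define \<Gamma> where "\<Gamma> = (\<Sum>i\<in>UNIV. \<Sum>j\<in>UNIV. \<bar>A $ j $ i\<bar>)"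
  have \<Gamma>: "\<Gamma> \<ge> 0" unfolding \<Gamma>_def by (intro sum_nonneg) auto
  show ?thesis
  proof
    show "c0 * (2 * \<Gamma> + 4) ^ CARD('d) > 0" using c0 \<Gamma> by simp
    fix a :: real and M :: "('d \<Rightarrow> int) set" and c :: "('d \<Rightarrow> int) \<Rightarrow> complex"
    assume a: "a \<ge> 1" and M: "finite M"
    \<comment> \<open>The added 1 gives the strict inequality needed for a half-open box; a >= 1
      absorbs the rounding into the constant \<open>2 * \<Gamma> + 4\<close>.\<close>
    define R where "R = nat \<lceil>a * \<Gamma>\<rceil> + 1"
    have R: "a * \<Gamma> < real R" "2 * real R \<le> a * (2 * \<Gamma> + 4)"
      using a \<Gamma> unfolding R_def by (auto simp: algebra_simps) linarith+
    let ?B = "hbox (- vec (real R)) (real (2 * R)) :: (real ^ 'd) set"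
    let ?P = "\<lambda>y. \<Sum>m\<in>M. c m * character m y"
    let ?L = "\<lambda>x. dilate a A x"
    have in_box: "?L x \<in> ?B" if "x \<in> unit_cube" for x
    proof -
      have lt: "\<bar>?L x $ i\<bar> < real R" for i
      proof -
        have "\<bar>?L x $ i\<bar> \<le> a * \<Gamma>"
          using transpose_mult_bound[OF that, of A i] a by (simp add: abs_mult \<Gamma>_def mult_left_mono)
        then show ?thesis using R(1) by linarith
      qed
      have "- real R \<le> ?L x $ i \<and> ?L x $ i < - real R + 2 * real R" for i
        using lt[of i] by linarith
      then show ?thesis by (simp add: hbox_def)
    qed
    have hb: "has_bochner_integral lborel (\<lambda>y. indicator ?B y * (norm (?P y))\<^sup>2) (real (2 * R) ^ CARD('d) * (\<Sum>m\<in>M. (norm (c m))\<^sup>2))"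
      by (rule integral_norm_trig_poly[OF M])
    have hL: "has_bochner_integral lborel (\<lambda>x. indicator ?B (?L x) * (norm (?P (?L x)))\<^sup>2)
        (c0 / a ^ DIM(real ^ 'd) * (real (2 * R) ^ CARD('d) * (\<Sum>m\<in>M. (norm (c m))\<^sup>2)))"
      using c0(2)[OF integrable.intros[OF hb], of a] has_bochner_integral_integral_eq[OF hb] a by simp
    have cont: "continuous_on unit_cube (\<lambda>x. (norm (?P (?L x)))\<^sup>2)"
      by (intro continuous_intros continuous_on_compose2[OF continuous_on_character[of UNIV]]
          linear_continuous_on linear_compose_scale_right lin linear_conv_bounded_linear[THEN iffD1]) auto
    have "(LINT x:unit_cube|lborel. (norm (?P (?L x)))\<^sup>2) \<le> (LINT x|lborel. indicator ?B (?L x) * (norm (?P (?L x)))\<^sup>2)"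
      unfolding set_lebesgue_integral_def
    proof (rule integral_mono)
      show "integrable lborel (\<lambda>x. indicator unit_cube x *\<^sub>R (norm (?P (?L x)))\<^sup>2)"
        using continuous_on_unit_cube_integrable[OF cont] by (simp only: set_integrable_def)
      show "integrable lborel (\<lambda>x. indicator ?B (?L x) * (norm (?P (?L x)))\<^sup>2)"
        by (rule integrable.intros[OF hL])
      show "indicator unit_cube x *\<^sub>R (norm (?P (?L x)))\<^sup>2 \<le> indicator ?B (?L x) * (norm (?P (?L x)))\<^sup>2" for x
        using in_box[of x] by (cases "x \<in> unit_cube") auto
    qed
    also have "\<dots> = c0 / a ^ CARD('d) * (real (2 * R) ^ CARD('d) * (\<Sum>m\<in>M. (norm (c m))\<^sup>2))"
      using has_bochner_integral_integral_eq[OF hL] by simp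
    also have "\<dots> \<le> c0 / a ^ CARD('d) * ((a * (2 * \<Gamma> + 4)) ^ CARD('d) * (\<Sum>m\<in>M. (norm (c m))\<^sup>2))"
      using R c0 a by (intro mult_left_mono mult_right_mono power_mono sum_nonneg) auto
    also have "\<dots> = c0 * (2 * \<Gamma> + 4) ^ CARD('d) * (\<Sum>m\<in>M. (norm (c m))\<^sup>2)"
      using a by (simp add: power_mult_distrib)
    finally show "(LINT x:unit_cube|lborel. (norm (?P (?L x)))\<^sup>2) \<le> c0 * (2 * \<Gamma> + 4) ^ CARD('d) * (\<Sum>m\<in>M. (norm (c m))\<^sup>2)" .
  qed
qed

lemma set_integral_sum:
  fixes g :: "'i \<Rightarrow> 'a \<Rightarrow> real"
  assumes "\<And>i. i \<in> I \<Longrightarrow> set_integrable M S (g i)"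
  shows "(LINT x:S|M. (\<Sum>i\<in>I. g i x)) = (\<Sum>i\<in>I. LINT x:S|M. g i x)"
proof -
  have "(LINT x|M. (\<Sum>i\<in>I. indicator S x *\<^sub>R g i x)) = (\<Sum>i\<in>I. LINT x|M. indicator S x *\<^sub>R g i x)"
    by (rule Bochner_Integration.integral_sum) (use assms in \<open>simp only: set_integrable_def\<close>)
  then show ?thesis
    by (simp only: set_lebesgue_integral_def scaleR_sum_right)
qed

lemma continuous_on_plane_wave:
  "continuous_on S (\<lambda>x. Re (c * plane_wave k x))"
  by (intro continuous_intros)

text \<open>In each class of frequencies the pairing moves the derivative of order s onto f, leaving
  one trigonometric polynomial whose coefficients have been divided by the symbol of the derivative.
  Its norm is controlled by Parseval and the lattice sum. The bound holds for every N with the same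
  constant.\<close>

lemma kernel_error_bound:
  fixes A :: "real ^ 'd::finite ^ 'd"
  assumes det: "det A \<noteq> 0"
    and form: "\<And>m :: 'd \<Rightarrow> int. m \<noteq> (\<lambda>_. 0) \<Longrightarrow> abs_norm_form A m \<ge> 1"
    and s: "s \<ge> 1"
  obtains C :: real where "C > 0"
    "\<And>(l :: nat) (a :: real) f N. a \<ge> 1 \<Longrightarrow> a ^ CARD('d) = 2 ^ l \<Longrightarrow> f \<in> H_mix_ring s \<Longrightarrow>
      \<bar>LINT x:unit_cube|lborel. f x * (prod_kernel N (dilate a A x) - 1)\<bar> \<le>
      C * sqrt (real (l + 1) ^ (CARD('d) - 1)) / 2 ^ (s * l)"
proof -
  obtain C1 where C1: "C1 > 0"
    "\<And>(l :: nat) (a :: real) M. a > 0 \<Longrightarrow> a ^ CARD('d) = 2 ^ l \<Longrightarrow> finite M \<Longrightarrow> (\<lambda>_. 0) \<notin> M \<Longrightarrow>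
      (\<Sum>m\<in>M. 1 / max_one_prod (a *\<^sub>R (A *v int_vec m)) ^ (2 * s)) \<le>
      C1 * real (l + 1) ^ (CARD('d) - 1) / 2 ^ (2 * s * l)"
    using sum_norm_form_bound[OF form s] by blast
  obtain C2 where C2: "C2 > 0"
    "\<And>(a :: real) M c. a \<ge> 1 \<Longrightarrow> finite M \<Longrightarrow>
      (LINT x:unit_cube|lborel. (norm (\<Sum>m\<in>M. c m * character m (dilate a A x)))\<^sup>2)
        \<le> C2 * (\<Sum>m\<in>M. (norm (c m :: complex))\<^sup>2)"
    using trig_poly_L2_bound[OF det] by blast
  \<comment> \<open>Only the extreme orders 0 and s occur: in each coordinate one integrates by
    parts either s times or not at all.\<close>
  define Q where "Q = {\<alpha> :: 'd \<Rightarrow> nat. \<forall>i. \<alpha> i \<in> {0, s}}"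
  have Q_sub: "Q \<subseteq> mix_indices s" 
  proof
    fix \<alpha> assume "\<alpha> \<in> Q"
    then have "\<alpha> i = 0 \<or> \<alpha> i = s" for i by (simp add: Q_def)
    then have "\<alpha> i \<le> s" for i by (metis le0 order_refl)
    then show "\<alpha> \<in> mix_indices s" by (simp add: mix_indices_def)
  qed
  have Q_fin: "finite Q" by (rule finite_subset[OF Q_sub finite_mix_indices])
  have Q_ne: "card Q > 0"
    using Q_fin by (auto simp: card_gt_0_iff Q_def intro: exI[of _ "\<lambda>_. 0"])
  show ?thesis
  proof
    show "real (card Q) * (5 / 2 * sqrt (C1 * C2)) > 0"
      using Q_ne C1(1) C2(1) by simp
    fix l :: nat and a :: real and f :: "real ^ 'd \<Rightarrow> real" and N :: nat
    assume a: "a \<ge> 1" "a ^ CARD('d) = 2 ^ l" and f: "f \<in> H_mix_ring s"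
    have fc: "continuous_on unit_cube f"
      using f by (auto simp: H_mix_ring_def H_mix_def mix_space_def)
    define k where "k m = a *\<^sub>R (A *v int_vec m)" for m
    define \<beta> where "\<beta> = C2 * (C1 * real (l + 1) ^ (CARD('d) - 1) / 2 ^ (2 * s * l))"
    have \<beta>: "\<beta> > 0" using C1(1) C2(1) by (simp add: \<beta>_def)
    have sqrt_\<beta>: "sqrt \<beta> = sqrt (C1 * C2) * sqrt (real (l + 1) ^ (CARD('d) - 1)) / 2 ^ (s * l)"
    proof -
      have "(2::real) ^ (2 * s * l) = (2 ^ (s * l))\<^sup>2"
        by (simp add: power_mult[symmetric] mult_ac)
      then show ?thesis
        by (simp add: \<beta>_def real_sqrt_divide real_sqrt_mult)
    qed
    define M where "M = kernel_freqs N - {(\<lambda>_ :: 'd. 0)}"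
    have M: "finite M" "(\<lambda>_. 0) \<notin> M" by (auto simp: M_def)
    \<comment> \<open>Differentiating only where |k_i| >= 1 keeps the symbol \<open>D\<close> away
      from zero and makes its modulus at least the product of the factors max(1, |k_i|)^s.\<close>
    define al where "al m i = (if \<bar>k m $ i\<bar> \<ge> 1 then s else 0)" for m i
    define S where "S \<alpha> = {m \<in> M. al m = \<alpha>}" for \<alpha>
    have S_fin: "finite (S \<alpha>)" for \<alpha> using M by (simp add: S_def)
    define D where "D \<alpha> m = (\<Prod>i\<in>UNIV. (\<i> * of_real (2 * pi * k m $ i)) ^ \<alpha> i)" for \<alpha> m
    define c where "c m = of_real (prod_kernel_coeff N m) / D (al m) m" for m
    have D_nz: "D (al m) m \<noteq> 0" for m
      by (auto simp: D_def al_def)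
    have c_le: "(norm (c m))\<^sup>2 \<le> 1 / max_one_prod (k m) ^ (2 * s)" for m
    proof -
      have "max_one_prod (k m) ^ s = (\<Prod>i\<in>UNIV. max 1 \<bar>k m $ i\<bar> ^ s)"
        by (simp add: prod_power_distrib)
      also have "\<dots> \<le> (\<Prod>i\<in>UNIV. norm ((\<i> * of_real (2 * pi * k m $ i)) ^ al m i))"
      proof (rule prod_mono)
        fix i
        have "max 1 \<bar>k m $ i\<bar> ^ s \<le> norm ((\<i> * of_real (2 * pi * k m $ i)) ^ al m i)"
        proof (cases "\<bar>k m $ i\<bar> \<ge> 1")
          case True
          have "1 * \<bar>k m $ i\<bar> \<le> (2 * pi) * \<bar>k m $ i\<bar>"
            using pi_gt3 by (intro mult_right_mono) auto
          then have "\<bar>k m $ i\<bar> ^ s \<le> (2 * pi * \<bar>k m $ i\<bar>) ^ s"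
            by (intro power_mono) auto
          then show ?thesis using True by (simp add: al_def norm_power norm_mult abs_mult max_def)
        next
          case False
          then show ?thesis by (simp add: al_def max_def)
        qed
        then show "0 \<le> max 1 \<bar>k m $ i\<bar> ^ s \<and> max 1 \<bar>k m $ i\<bar> ^ s \<le> norm ((\<i> * of_real (2 * pi * k m $ i)) ^ al m i)"
          by simp
      qed
      also have "\<dots> = norm (D (al m) m)" by (simp only: D_def prod_norm)
      finally have le: "max_one_prod (k m) ^ s \<le> norm (D (al m) m)" .
      have pos: "max_one_prod (k m) > 0" by (intro prod_pos) auto
      have "norm (c m) \<le> 1 / max_one_prod (k m) ^ s"
        unfolding c_def norm_divide using le pos prod_kernel_coeff(1,2)[of N m]
        by (intro frac_le) auto
      then have "(norm (c m))\<^sup>2 \<le> (1 / max_one_prod (k m) ^ s)\<^sup>2"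
        by (intro power_mono) auto
      then show ?thesis by (simp add: power_divide power_mult[symmetric] mult.commute)
    qed
    have expand: "prod_kernel N (dilate a A x) - 1 =
        (\<Sum>\<alpha>\<in>Q. \<Sum>m\<in>S \<alpha>. Re (c m * D \<alpha> m * plane_wave (k m) x))" for x
    proof -
      let ?y = "dilate a A x"
      \<comment> \<open>Frequency 0 has coefficient exactly 1 and is cancelled by the subtracted 1,
        which represents the exact integral.\<close>
      have "complex_of_real (prod_kernel N ?y) = 1 + (\<Sum>m\<in>M. of_real (prod_kernel_coeff N m) * character m ?y)"
        unfolding prod_kernel_expand M_def
        by (subst sum.remove[of _ "\<lambda>_. 0"]) (auto simp: prod_kernel_coeff)
      then have "complex_of_real (prod_kernel N ?y) - 1 = (\<Sum>m\<in>M. of_real (prod_kernel_coeff N m) * character m ?y)"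
        by simp
      then have "Re (complex_of_real (prod_kernel N ?y) - 1) = Re (\<Sum>m\<in>M. of_real (prod_kernel_coeff N m) * character m ?y)"
        by simp
      then have "prod_kernel N ?y - 1 = (\<Sum>m\<in>M. Re (of_real (prod_kernel_coeff N m) * character m ?y))"
        by simp
      also have "\<dots> = (\<Sum>\<alpha>\<in>Q. \<Sum>m\<in>S \<alpha>. Re (of_real (prod_kernel_coeff N m) * character m ?y))"
        unfolding S_def by (rule sum.group[symmetric]) (use M Q_fin in \<open>auto simp: Q_def al_def\<close>)
      also have "\<dots> = (\<Sum>\<alpha>\<in>Q. \<Sum>m\<in>S \<alpha>. Re (c m * D \<alpha> m * plane_wave (k m) x))"
      proof (intro sum.cong refl)
        fix \<alpha> m assume "m \<in> S \<alpha>"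
        then have "c m * D \<alpha> m = of_real (prod_kernel_coeff N m)"
          using D_nz[of m] by (auto simp: S_def c_def)
        then show "Re (of_real (prod_kernel_coeff N m) * character m ?y) = Re (c m * D \<alpha> m * plane_wave (k m) x)"
          by (simp only: character_linear k_def)
      qed
      finally show ?thesis .
    qed
    have part: "\<bar>\<Sum>m\<in>S \<alpha>. LINT x:unit_cube|lborel. f x * Re (c m * D \<alpha> m * plane_wave (k m) x)\<bar> \<le> 5 / 2 * sqrt \<beta>"
      if \<alpha>: "\<alpha> \<in> Q" for \<alpha>
    proof -
      obtain v :: "real ^ 'd \<Rightarrow> real" where v: "v \<in> L2" "(LINT x:unit_cube|lborel. (v x)\<^sup>2) \<le> 4"
        "\<And>(c :: complex) (k :: real ^ 'd). (LINT x:unit_cube|lborel. f x * Re (c * (\<Prod>i\<in>UNIV. (\<i> * of_real (2 * pi * k $ i)) ^ \<alpha> i) * plane_wave k x)) =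
          (-1) ^ midx_order \<alpha> * (LINT x:unit_cube|lborel. v x * Re (c * plane_wave k x))"
        using H_mix_ring_pairing[OF f subsetD[OF Q_sub \<alpha>]] by blast
      let ?p = "\<lambda>x. \<Sum>m\<in>S \<alpha>. Re (c m * plane_wave (k m) x)"
      let ?P = "\<lambda>x. norm (\<Sum>m\<in>S \<alpha>. c m * character m (dilate a A x))"
      have pc: "continuous_on unit_cube ?p"
        by (intro continuous_on_sum continuous_on_plane_wave)
      have char: "character m (dilate a A x) = plane_wave (k m) x" for m x
        unfolding k_def by (rule character_linear)
      have P: "?P x = norm (\<Sum>m\<in>S \<alpha>. c m * plane_wave (k m) x)" for x
        by (simp only: char)
      have Pc: "continuous_on unit_cube (\<lambda>x. (?P x)\<^sup>2)"
        unfolding P by (intro continuous_intros)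
      \<comment> \<open>Bounding the real part by the modulus makes the orthogonality estimate for
        complex polynomials applicable.\<close>
      have "(LINT x:unit_cube|lborel. (?p x)\<^sup>2) \<le> (LINT x:unit_cube|lborel. (?P x)\<^sup>2)"
      proof (rule set_integral_mono)
        show "set_integrable lborel unit_cube (\<lambda>x. (?p x)\<^sup>2)"
          by (intro continuous_on_unit_cube_integrable continuous_on_power pc)
        show "set_integrable lborel unit_cube (\<lambda>x. (?P x)\<^sup>2)"
          by (intro continuous_on_unit_cube_integrable Pc)
        show "(?p x)\<^sup>2 \<le> (?P x)\<^sup>2" for x
        proof -
          have "\<bar>?p x\<bar> \<le> ?P x"
            unfolding P using abs_Re_le_cmod[of "\<Sum>m\<in>S \<alpha>. c m * plane_wave (k m) x"] by (simp only: Re_sum)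
          from power_mono[OF this abs_ge_zero, of 2] show ?thesis by (simp only: power2_abs)
        qed
      qed
      also have "\<dots> \<le> C2 * (\<Sum>m\<in>S \<alpha>. (norm (c m))\<^sup>2)"
        by (rule C2(2)[OF a(1) S_fin])
      also have "\<dots> \<le> C2 * (\<Sum>m\<in>M. (norm (c m))\<^sup>2)"
        using C2(1) M by (intro mult_left_mono sum_mono2) (auto simp: S_def)
      also have "\<dots> \<le> C2 * (\<Sum>m\<in>M. 1 / max_one_prod (k m) ^ (2 * s))"
        using C2(1) by (intro mult_left_mono sum_mono c_le) auto
      also have "\<dots> \<le> \<beta>"
        unfolding \<beta>_def k_def using C2(1) a M by (intro mult_left_mono C1(2)) auto
      finally have p\<beta>: "(LINT x:unit_cube|lborel. (?p x)\<^sup>2) \<le> \<beta>" .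
      have vi: "set_integrable lborel unit_cube (\<lambda>x. v x * Re (c m * plane_wave (k m) x))" for m
        by (intro L2_mult_integrable v(1) continuous_on_L2 continuous_on_plane_wave)
      have "(\<Sum>m\<in>S \<alpha>. LINT x:unit_cube|lborel. f x * Re (c m * D \<alpha> m * plane_wave (k m) x)) =
          (\<Sum>m\<in>S \<alpha>. (-1) ^ midx_order \<alpha> * (LINT x:unit_cube|lborel. v x * Re (c m * plane_wave (k m) x)))"
        unfolding D_def v(3) ..
      also have "\<dots> = (-1) ^ midx_order \<alpha> * (\<Sum>m\<in>S \<alpha>. LINT x:unit_cube|lborel. v x * Re (c m * plane_wave (k m) x))"
        by (simp only: sum_distrib_left)
      also have "(\<Sum>m\<in>S \<alpha>. LINT x:unit_cube|lborel. v x * Re (c m * plane_wave (k m) x)) = (LINT x:unit_cube|lborel. v x * ?p x)"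
        by (simp only: sum_distrib_left set_integral_sum[OF vi])
      finally have "\<bar>\<Sum>m\<in>S \<alpha>. LINT x:unit_cube|lborel. f x * Re (c m * D \<alpha> m * plane_wave (k m) x)\<bar> =
          \<bar>LINT x:unit_cube|lborel. v x * ?p x\<bar>"
        by (simp only: abs_mult power_abs abs_minus_cancel abs_one power_one mult_1)
      then show ?thesis
        using L2_pairing_le[OF v(1,2) pc p\<beta> \<beta>] by (simp only:)
    qed
    have fi: "set_integrable lborel unit_cube (\<lambda>x. f x * Re (c' * plane_wave (k') x))" for c' k'
      by (intro continuous_on_unit_cube_integrable continuous_on_mult fc continuous_on_plane_wave)
    have fi2: "set_integrable lborel unit_cube (\<lambda>x. \<Sum>m\<in>S \<alpha>. f x * Re (c m * D \<alpha> m * plane_wave (k m) x))" for \<alpha>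
      by (intro continuous_on_unit_cube_integrable continuous_on_sum continuous_on_mult fc continuous_on_plane_wave)
    have "(LINT x:unit_cube|lborel. f x * (prod_kernel N (dilate a A x) - 1)) =
        (\<Sum>\<alpha>\<in>Q. \<Sum>m\<in>S \<alpha>. LINT x:unit_cube|lborel. f x * Re (c m * D \<alpha> m * plane_wave (k m) x))"
      unfolding expand sum_distrib_left by (simp only: set_integral_sum[OF fi2] set_integral_sum[OF fi])
    also have "\<bar>\<dots>\<bar> \<le> (\<Sum>\<alpha>\<in>Q. \<bar>\<Sum>m\<in>S \<alpha>. LINT x:unit_cube|lborel. f x * Re (c m * D \<alpha> m * plane_wave (k m) x)\<bar>)"
      by (rule sum_abs)
    also have "\<dots> \<le> (\<Sum>\<alpha>\<in>Q. 5 / 2 * sqrt \<beta>)"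
      by (intro sum_mono part)
    also have "\<dots> = real (card Q) * (5 / 2 * sqrt (C1 * C2)) * sqrt (real (l + 1) ^ (CARD('d) - 1)) / 2 ^ (s * l)"
      by (simp add: sqrt_\<beta>)
    finally show "\<bar>LINT x:unit_cube|lborel. f x * (prod_kernel N (dilate a A x) - 1)\<bar> \<le>
      real (card Q) * (5 / 2 * sqrt (C1 * C2)) * sqrt (real (l + 1) ^ (CARD('d) - 1)) / 2 ^ (s * l)" .
  qed
qed

section \<open>The lattice rules\<close>

text \<open>Gluing along two closed sets, the cube and the complement of the open box: they meet in
  the boundary of the cube, where f is 0.\<close>

lemma zero_extension_continuous:
  fixes f :: "real ^ 'd::finite \<Rightarrow> real"
  assumes f: "continuous_on unit_cube f" and "0 < \<delta>" and van: "vanishes_near_boundary \<delta> f"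
  shows "continuous_on UNIV (\<lambda>x. indicator unit_cube x * f x)"
proof -
  have "continuous_on (unit_cube \<union> - box 0 1) (\<lambda>x. if x \<in> unit_cube then f x else 0)"
  proof (rule continuous_on_cases)
    show "closed (unit_cube :: (real ^ 'd) set)" unfolding unit_cube_def by (rule closed_cbox)
    show "closed (- box 0 1 :: (real ^ 'd) set)" by (simp add: closed_Compl open_box)
    have "f x = 0" if x: "x \<in> unit_cube" "x \<notin> box 0 1" for x
    proof -
      have "x \<notin> inner_cube \<delta>"
      proof
        assume "x \<in> inner_cube \<delta>"
        then have "0 < x $ i \<and> x $ i < 1" for i
          using \<open>0 < \<delta>\<close> by (auto simp: mem_box_cart intro: less_le_trans le_less_trans dest: spec[of _ i])
        then show False using x(2) by (simp add: mem_box_cart)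
      qed
      then show ?thesis using van x(1) by (simp add: vanishes_near_boundary_def)
    qed
    then show "\<forall>x. x \<in> unit_cube \<and> x \<notin> unit_cube \<or> x \<in> - box 0 1 \<and> x \<in> unit_cube \<longrightarrow> f x = 0"
      by blast
  qed (use f in auto)
  moreover have "unit_cube \<union> - box 0 1 = (UNIV :: (real ^ 'd) set)"
    using box_subset_cbox[of 0 "1 :: real ^ 'd"] unfolding unit_cube_def by blast
  moreover have "(\<lambda>x. if x \<in> unit_cube then f x else 0) = (\<lambda>x. indicator unit_cube x * f x)"
    by (auto simp: indicator_def)
  ultimately show ?thesis by (simp only:)
qed

text \<open>The boxes around integer points partition the space: rounding each coordinate, with ties
  upwards, picks the only box containing \<open>y\<close>.\<close>

lemma mem_hbox_int_vec: "y \<in> hbox (int_vec m - vec (1/2)) 1 \<longleftrightarrow> m = (\<lambda>i. \<lfloor>y $ i + 1/2\<rfloor>)"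
proof -
  have "y $ i \<in> {(int_vec m - vec (1/2)) $ i..<(int_vec m - vec (1/2)) $ i + 1} \<longleftrightarrow> \<lfloor>y $ i + 1/2\<rfloor> = m i" for i
    unfolding floor_eq_iff by (auto simp: int_vec_def)
  then show ?thesis by (simp only: hbox_def mem_Collect_eq fun_eq_iff eq_commute[of "m _"])
qed

lemma inj_int_vec: "inj int_vec"
  by (auto simp: inj_on_def int_vec_def vec_eq_iff fun_eq_iff)

definition int_box :: "nat \<Rightarrow> (real ^ 'd::finite) set" where
  "int_box R = int_vec ` PiE UNIV (\<lambda>_. {- int R..int R})"

lemma finite_int_box: "finite (int_box R)"
  and card_int_box: "card (int_box R :: (real ^ 'd::finite) set) = (2 * R + 1) ^ CARD('d)"
proof -
  show "finite (int_box R)"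
    unfolding int_box_def by (intro finite_imageI finite_PiE) auto
  have "card (int_box R :: (real ^ 'd) set) = card (PiE (UNIV :: 'd set) (\<lambda>_. {- int R..int R}))"
    unfolding int_box_def by (rule card_image) (rule inj_on_subset[OF inj_int_vec], simp)
  also have "\<dots> = card {- int R..int R} ^ CARD('d)"
    by (subst card_PiE) auto
  also have "card {- int R..int R} = 2 * R + 1"
    by simp
  finally show "card (int_box R :: (real ^ 'd) set) = (2 * R + 1) ^ CARD('d)" .
qed

lemma sum_indicator_int_box:
  fixes y :: "real ^ 'd::finite"
  assumes "\<And>i. \<bar>y $ i\<bar> < real R"
  shows "(\<Sum>z\<in>int_box R. indicator (hbox (z - vec (1/2)) 1) y * g) = (g :: real)"
proof -
  let ?m = "\<lambda>i. \<lfloor>y $ i + 1/2\<rfloor>"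
  have "?m i \<in> {- int R..int R}" for i
    using assms[of i] by (auto simp: le_floor_iff floor_le_iff)
  then have m: "?m \<in> PiE UNIV (\<lambda>_. {- int R..int R})" by (simp add: PiE_iff)
  have "(\<Sum>z\<in>int_box R. indicator (hbox (z - vec (1/2)) 1) y * g) =
      (\<Sum>m\<in>PiE UNIV (\<lambda>_. {- int R..int R}). indicator (hbox (int_vec m - vec (1/2)) 1) y * g)"
    unfolding int_box_def by (subst sum.reindex) (auto intro: inj_on_subset[OF inj_int_vec])
  also have "\<dots> = (\<Sum>m\<in>PiE UNIV (\<lambda>_. {- int R..int R}). if m = ?m then g else 0)"
    by (rule sum.cong) (auto simp: mem_hbox_int_vec indicator_def)
  also have "\<dots> = g"
    using m by (simp add: finite_PiE)
  finally show ?thesis .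
qed

text \<open>After the substitution y = a A^T x the kernel is integer-periodic. Cutting the space
  into unit boxes around integer points and letting the kernel concentrate in each gives the sum of
  f over the preimages of these points, with the Jacobian factor as common weight. Weight and nodes
  depend on \<open>a\<close> and \<open>A\<close> but not on f.\<close>

lemma lattice_rule_limit:
  fixes A :: "real ^ 'd::finite ^ 'd"
  assumes det: "det A \<noteq> 0"
  obtains G :: real where
    "\<And>a. a \<ge> 1 \<Longrightarrow> \<exists>(w :: real) X. finite X \<and> X \<subseteq> unit_cube \<and> real (card X) \<le> G * a ^ CARD('d) \<and>
      (\<forall>f. continuous_on unit_cube f \<longrightarrow> supp f \<subseteq> box 0 1 \<longrightarrow>
        (\<lambda>N. LINT x:unit_cube|lborel. f x * prod_kernel N (dilate a A x)) \<longlonglongrightarrow> w * (\<Sum>x\<in>X. f x))"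
proof -
  have lin: "linear ((*v) (transpose A))" by (rule matrix_vector_mul_linear)
  have inv: "invertible (transpose A)" using det by (simp add: invertible_det_nz det_transpose)
  have bij: "bij ((*v) (transpose A))"
    using inv invertible_eq_bij[of "transpose A"] by simp
  obtain c0 where c0: "c0 > 0"
    "\<And>(f :: real ^ 'd \<Rightarrow> real) a. integrable lborel f \<Longrightarrow> a > 0 \<Longrightarrow>
      has_bochner_integral lborel (\<lambda>x. f (dilate a A x)) (c0 / a ^ DIM(real ^ 'd) * integral\<^sup>L lborel f)"
    using integral_scaled_linear[OF lin bij] by blast
  obtain B where B: "transpose A ** B = mat 1" "B ** transpose A = mat 1"
    using inv by (auto simp: invertible_def)
  define \<Gamma> where "\<Gamma> = (\<Sum>i\<in>UNIV. \<Sum>j\<in>UNIV. \<bar>A $ j $ i\<bar>)"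
  have \<Gamma>: "\<Gamma> \<ge> 0" unfolding \<Gamma>_def by (intro sum_nonneg) auto
  show ?thesis
  proof (rule that[of "(2 * \<Gamma> + 5) ^ CARD('d)"])
    fix a :: real assume a: "a \<ge> 1"
    \<comment> \<open>Chosen so that the image of the cube has all coordinates strictly below R in
      absolute value; rounding them stays in \<open>int_box R\<close>. Its 2R + 1 points per
      direction explain the 5 in the count.\<close>
    define R where "R = nat \<lceil>a * \<Gamma>\<rceil> + 1"
    have R: "a * \<Gamma> < real R" "2 * real R + 1 \<le> a * (2 * \<Gamma> + 5)"
      using a \<Gamma> unfolding R_def by (auto simp: algebra_simps) linarith+
    define L where "L x = dilate a A x" for x
    define L' where "L' y = B *v (inverse a *\<^sub>R y)" for y
    have L'L: "L' (L x) = x" for x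
      using a B by (simp add: L_def L'_def matrix_vector_mul_assoc del: transpose_matrix_vector)
    have LL': "L (L' y) = y" for y
      using a B by (simp add: L_def L'_def matrix_vector_mul_assoc del: transpose_matrix_vector)
    have injL': "inj L'" by (metis LL' injI)
    have contL': "continuous_on S L'" for S
      unfolding L'_def
      by (intro continuous_on_compose2[OF linear_continuous_on[of "(*v) B" UNIV]] continuous_intros
          linear_conv_bounded_linear[THEN iffD1] matrix_vector_mul_linear) auto
    \<comment> \<open>Only lattice points inside the cube become nodes. The other preimages of
      points in \<open>int_box R\<close> lie where the zero extension of f vanishes, so dropping
      them changes nothing in the limit.\<close>
    define X where "X = L' ` {z \<in> int_box R. L' z \<in> unit_cube}"
    define w where "w = c0 / a ^ CARD('d)"
    have "finite X" unfolding X_def by (simp add: finite_int_box)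
    moreover have "X \<subseteq> unit_cube" unfolding X_def by auto
    moreover have "real (card X) \<le> (2 * \<Gamma> + 5) ^ CARD('d) * a ^ CARD('d)"
    proof -
      have "card X \<le> card (int_box R :: (real ^ 'd) set)"
        unfolding X_def by (rule order_trans[OF card_image_le card_mono]) (auto simp: finite_int_box)
      then have "real (card X) \<le> real ((2 * R + 1) ^ CARD('d))"
        unfolding card_int_box by (rule of_nat_mono)
      also have "\<dots> = (2 * real R + 1) ^ CARD('d)" by (simp add: add.commute)
      also have "\<dots> \<le> (a * (2 * \<Gamma> + 5)) ^ CARD('d)"
        by (intro power_mono R) auto
      finally show ?thesis by (simp add: power_mult_distrib mult.commute)
    qed
    moreover have "(\<lambda>N. LINT x:unit_cube|lborel. f x * prod_kernel N (L x)) \<longlonglongrightarrow> w * (\<Sum>x\<in>X. f x)"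
      if f: "continuous_on unit_cube f" "supp f \<subseteq> box 0 1" for f
    proof -
      obtain \<delta> where \<delta>: "0 < \<delta>" "vanishes_near_boundary \<delta> f"
        using supp_vanishes[OF f(2)] by blast
      define h where "h y = indicator unit_cube (L' y) * f (L' y)" for y
      have hc: "continuous_on UNIV h"
        unfolding h_def
        by (rule continuous_on_compose2[OF zero_extension_continuous[OF f(1) \<delta>] contL']) auto
      have h0: "\<bar>y $ i\<bar> < real R" if "h y \<noteq> 0" for y i
      proof -
        have "L' y \<in> unit_cube" using that by (auto simp: h_def indicator_def split: if_splits)
        then have "\<bar>(transpose A *v L' y) $ i\<bar> \<le> \<Gamma>"
          unfolding \<Gamma>_def by (rule transpose_mult_bound)
        then have "\<bar>L (L' y) $ i\<bar> \<le> a * \<Gamma>"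
          using a by (simp add: L_def abs_mult mult_left_mono)
        then show ?thesis using R(1) by (simp add: LL')
      qed
      let ?g = "\<lambda>N y. prod_kernel N y * h y"
      have gc: "continuous_on S (?g N)" for S N
        by (intro continuous_intros continuous_on_subset[OF hc]) auto
      have gi: "integrable lborel (?g N)" for N
      proof -
        have "integrable lborel (\<lambda>y. indicator (cbox (- vec (real R)) (vec (real R))) y *\<^sub>R ?g N y)"
          by (rule borel_integrable_compact) (auto intro: gc)
        also have "(\<lambda>y. indicator (cbox (- vec (real R)) (vec (real R))) y *\<^sub>R ?g N y) = ?g N"
        proof
          fix y :: "real ^ 'd"
          show "indicator (cbox (- vec (real R)) (vec (real R))) y *\<^sub>R ?g N y = ?g N y"
          proof (cases "h y = 0")
            case False
            then have "- real R \<le> y $ i \<and> y $ i \<le> real R" for i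
              using h0[of y i] by linarith
            then have "y \<in> cbox (- vec (real R)) (vec (real R))" by (simp add: mem_box_cart)
            then show ?thesis by simp
          qed simp
        qed
        finally show ?thesis .
      qed
      have int: "(LINT x:unit_cube|lborel. f x * prod_kernel N (L x)) =
          w * (\<Sum>z\<in>int_box R. LINT y|lborel. indicator (hbox (z - vec (1/2)) 1) y * ?g N y)" for N
      proof -
        have "(LINT x:unit_cube|lborel. f x * prod_kernel N (L x)) = (LINT x|lborel. ?g N (L x))"
          unfolding set_lebesgue_integral_def h_def L'L
          by (rule Bochner_Integration.integral_cong) (auto simp: mult_ac)
        also have "\<dots> = w * integral\<^sup>L lborel (?g N)"
          using has_bochner_integral_integral_eq[OF c0(2)[OF gi, of a]] a by (simp add: w_def L_def)
        also have "integral\<^sup>L lborel (?g N) = (LINT y|lborel. (\<Sum>z\<in>int_box R. indicator (hbox (z - vec (1/2)) 1) y * ?g N y))"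
        proof (rule Bochner_Integration.integral_cong[OF refl])
          fix y :: "real ^ 'd"
          show "?g N y = (\<Sum>z\<in>int_box R. indicator (hbox (z - vec (1/2)) 1) y * ?g N y)"
          proof (cases "h y = 0")
            case False
            show ?thesis by (rule sum_indicator_int_box[OF h0[OF False], symmetric])
          qed simp
        qed
        also have "\<dots> = (\<Sum>z\<in>int_box R. LINT y|lborel. indicator (hbox (z - vec (1/2)) 1) y * ?g N y)"
        proof (rule Bochner_Integration.integral_sum)
          fix z :: "real ^ 'd"
          have "hbox (z - vec (1/2)) 1 \<in> sets lborel" by simp
          from integrable_mult_indicator[OF this gi[of N]]
          show "integrable lborel (\<lambda>y. indicator (hbox (z - vec (1/2)) 1) y * ?g N y)"
            by simp
        qed
        finally show ?thesis .
      qed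
      have "(\<lambda>N. w * (\<Sum>z\<in>int_box R. LINT y|lborel. indicator (hbox (z - vec (1/2)) 1) y * ?g N y)) \<longlonglongrightarrow>
          w * (\<Sum>z\<in>int_box R. h z)"
        by (intro tendsto_mult tendsto_const tendsto_sum prod_kernel_concentration hc)
          (auto simp: int_box_def int_vec_def)
      moreover have "(\<Sum>z\<in>int_box R. h z) = (\<Sum>x\<in>X. f x)"
      proof -
        have "(\<Sum>z\<in>int_box R. h z) = (\<Sum>z\<in>{z \<in> int_box R. L' z \<in> unit_cube}. f (L' z))"
          by (rule sum.mono_neutral_cong_right) (auto simp: finite_int_box h_def)
        also have "\<dots> = (\<Sum>x\<in>X. f x)"
          unfolding X_def by (subst sum.reindex) (auto intro: inj_on_subset[OF injL'])
        finally show ?thesis .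
      qed
      ultimately show ?thesis by (simp only: int)
    qed
    ultimately show "\<exists>(w :: real) X. finite X \<and> X \<subseteq> unit_cube \<and> real (card X) \<le> (2 * \<Gamma> + 5) ^ CARD('d) * a ^ CARD('d) \<and>
      (\<forall>f. continuous_on unit_cube f \<longrightarrow> supp f \<subseteq> box 0 1 \<longrightarrow>
        (\<lambda>N. LINT x:unit_cube|lborel. f x * prod_kernel N (dilate a A x)) \<longlonglongrightarrow> w * (\<Sum>x\<in>X. f x))"
      unfolding L_def by (intro exI[of _ w] exI[of _ X]) simp
  qed
qed

text \<open>A rule must have exactly n nodes; the surplus ones are put at the origin, a point of the
  cube, with weight 0.\<close>

lemma cubature_of_finite_set:
  fixes X :: "(real ^ 'd::finite) set"
  assumes "finite X" "X \<subseteq> unit_cube" "card X \<le> n"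
  obtains a x where "\<And>j. x j \<in> (unit_cube :: (real ^ 'd) set)" "\<And>f. cubature n a x f = w * (\<Sum>x\<in>X. f x)"
proof -
  obtain h where h: "bij_betw h {1..card X} X"
    using ex_bij_betw_nat_finite_1[OF assms(1)] by blast
  define a where "a j = (if j \<in> {1..card X} then w else 0)" for j
  define x where "x j = (if j \<in> {1..card X} then h j else 0)" for j
  have "x j \<in> unit_cube" for j
    using bij_betwE[OF h] assms(2) by (cases "j \<in> {1..card X}") (auto simp only: x_def if_True if_False mem_unit_cube zero_index)
  moreover have "cubature n a x f = w * (\<Sum>x\<in>X. f x)" for f
  proof -
    have "cubature n a x f = (\<Sum>j=1..card X. w * f (h j))"
      unfolding cubature_def
      by (rule sum.mono_neutral_cong_right) (use assms(3) in \<open>auto simp: a_def x_def\<close>)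
    also have "\<dots> = w * (\<Sum>x\<in>X. f x)"
      by (simp only: sum_distrib_left[symmetric] sum.reindex_bij_betw[OF h])
    finally show ?thesis .
  qed
  ultimately show ?thesis by (rule that)
qed

text \<open>The pairing at frequency 0 without derivatives, against the constant 1. It serves the
  finitely many n for which the zero rule is used.\<close>

lemma H_mix_ring_integral_bound:
  fixes f :: "real ^ 'd::finite \<Rightarrow> real"
  assumes "f \<in> H_mix_ring s"
  shows "\<bar>cube_integral f\<bar> \<le> 5 / 2"
proof -
  have "(\<lambda>_. 0) \<in> (mix_indices s :: ('d \<Rightarrow> nat) set)" by (simp add: mix_indices_def)
  from H_mix_ring_pairing[OF assms this]
  obtain v :: "real ^ 'd \<Rightarrow> real" where v: "v \<in> L2" "(LINT x:unit_cube|lborel. (v x)\<^sup>2) \<le> 4"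
    "\<And>(c :: complex) (k :: real ^ 'd). (LINT x:unit_cube|lborel. f x * Re (c * (\<Prod>i\<in>UNIV. (\<i> * of_real (2 * pi * k $ i)) ^ 0) * plane_wave k x)) =
          (-1) ^ midx_order (\<lambda>_ :: 'd. 0) * (LINT x:unit_cube|lborel. v x * Re (c * plane_wave k x))"
    by blast
  have "cube_integral f = (LINT x:unit_cube|lborel. v x * 1)"
    using v(3)[of 1 0] by (simp add: cube_integral_def midx_order_def)
  moreover have "\<bar>LINT x:unit_cube|lborel. v x * 1\<bar> \<le> 5 / 2 * sqrt 1"
  proof (rule L2_pairing_le[OF v(1,2)])
    have "measure lborel (unit_cube :: (real ^ 'd) set) = 1"
    proof -
      have "(1 :: real ^ 'd) \<bullet> b = 1" if "b \<in> Basis" for b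
        using that by (auto simp: Basis_vec_def inner_axis)
      then show ?thesis
        unfolding unit_cube_def by (subst measure_lborel_cbox_eq) auto
    qed
    then show "(LINT x:(unit_cube :: (real ^ 'd) set)|lborel. 1\<^sup>2) \<le> (1 :: real)"
      by (simp add: set_lebesgue_integral_def)
  qed auto
  ultimately show ?thesis by simp
qed

text \<open>The kernel error is bounded independently of N, so its limit, the difference between
  cubature sum and integral, obeys the same bound.\<close>

lemma frolov_rule:
  fixes s :: nat
  assumes s: "s \<ge> 1"
  obtains C G :: real where "C > 0"
    "\<And>l. \<exists>(w :: real) (X :: (real ^ 'd::finite) set). finite X \<and> X \<subseteq> unit_cube \<and> real (card X) \<le> G * 2 ^ l \<and>
      (\<forall>f\<in>H_mix_ring s. \<bar>cube_integral f - w * (\<Sum>x\<in>X. f x)\<bar> \<le> C * sqrt (real (l + 1) ^ (CARD('d) - 1)) / 2 ^ (s * l))"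
proof -
  obtain A :: "real ^ 'd ^ 'd" where A: "det A \<noteq> 0"
    "\<And>m :: 'd \<Rightarrow> int. m \<noteq> (\<lambda>_. 0) \<Longrightarrow> abs_norm_form A m \<ge> 1"
    using norm_form_matrix by blast
  obtain C :: real where C: "C > 0"
    "\<And>(l :: nat) (a :: real) f N. a \<ge> 1 \<Longrightarrow> a ^ CARD('d) = 2 ^ l \<Longrightarrow> f \<in> H_mix_ring s \<Longrightarrow>
      \<bar>LINT x:unit_cube|lborel. f x * (prod_kernel N (dilate a A x) - 1)\<bar> \<le>
      C * sqrt (real (l + 1) ^ (CARD('d) - 1)) / 2 ^ (s * l)"
    using kernel_error_bound[OF A s] by blast
  obtain G :: real where G: "\<And>a. a \<ge> 1 \<Longrightarrow> \<exists>(w :: real) X. finite X \<and> X \<subseteq> unit_cube \<and> real (card X) \<le> G * a ^ CARD('d) \<and>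
      (\<forall>f. continuous_on unit_cube f \<longrightarrow> supp f \<subseteq> box 0 1 \<longrightarrow>
        (\<lambda>N. LINT x:unit_cube|lborel. f x * prod_kernel N (dilate a A x)) \<longlonglongrightarrow> w * (\<Sum>x\<in>X. f x))"
    using lattice_rule_limit[OF A(1)] by blast
  show ?thesis
  proof (rule that[OF C(1), of G])
    fix l :: nat
    \<comment> \<open>A real dilation with a^d = 2^l, so that every dyadic level is reached although
      2^l need not be a d-th power of an integer.\<close>
    define a where "a = 2 powr (real l / real CARD('d))"
    have a: "a \<ge> 1" by (simp add: a_def ge_one_powr_ge_zero)
    have ad: "a ^ CARD('d) = 2 ^ l"
      by (simp add: a_def powr_realpow[symmetric] powr_powr)
    obtain w X where X: "finite X" "X \<subseteq> unit_cube" "real (card X) \<le> G * a ^ CARD('d)"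
      and lim: "\<And>f. continuous_on unit_cube f \<Longrightarrow> supp f \<subseteq> box 0 1 \<Longrightarrow>
        (\<lambda>N. LINT x:unit_cube|lborel. f x * prod_kernel N (dilate a A x)) \<longlonglongrightarrow> w * (\<Sum>x\<in>X. f x)"
      using G[OF a] by blast
    let ?E = "C * sqrt (real (l + 1) ^ (CARD('d) - 1)) / 2 ^ (s * l)"
    have err: "\<bar>cube_integral f - w * (\<Sum>x\<in>X. f x)\<bar> \<le> ?E" if f: "f \<in> H_mix_ring s" for f
    proof -
      have fc: "continuous_on unit_cube f" and fs: "supp f \<subseteq> box 0 1"
        using f by (auto simp: H_mix_ring_def H_mix_def mix_space_def)
      let ?K = "\<lambda>N x. prod_kernel N (dilate a A x)"
      have Kc: "continuous_on unit_cube (?K N)" for N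
        by (intro continuous_on_compose2[OF continuous_on_prod_kernel[of UNIV]] continuous_intros
            linear_continuous_on linear_conv_bounded_linear[THEN iffD1] matrix_vector_mul_linear) auto
      have eq: "(LINT x:unit_cube|lborel. f x * (?K N x - 1)) = (LINT x:unit_cube|lborel. f x * ?K N x) - cube_integral f" for N
      proof -
        have "(LINT x:unit_cube|lborel. f x * ?K N x - f x) = (LINT x:unit_cube|lborel. f x * ?K N x) - (LINT x:unit_cube|lborel. f x)"
          by (intro set_integral_diff(2) continuous_on_unit_cube_integrable continuous_on_mult fc Kc)
        then show ?thesis by (simp add: cube_integral_def right_diff_distrib)
      qed
      have "(\<lambda>N. \<bar>(LINT x:unit_cube|lborel. f x * ?K N x) - cube_integral f\<bar>) \<longlonglongrightarrow> \<bar>w * (\<Sum>x\<in>X. f x) - cube_integral f\<bar>"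
        by (intro tendsto_rabs tendsto_diff tendsto_const lim fc fs)
      then have "\<bar>w * (\<Sum>x\<in>X. f x) - cube_integral f\<bar> \<le> ?E"
        by (rule LIMSEQ_le_const2) (use C(2)[OF a ad f] in \<open>auto simp only: eq\<close>)
      then show ?thesis by (simp add: abs_minus_commute)
    qed
    show "\<exists>(w :: real) (X :: (real ^ 'd) set). finite X \<and> X \<subseteq> unit_cube \<and> real (card X) \<le> G * 2 ^ l \<and>
      (\<forall>f\<in>H_mix_ring s. \<bar>cube_integral f - w * (\<Sum>x\<in>X. f x)\<bar> \<le> ?E)"
      using X(3) unfolding ad by (intro exI[of _ w] exI[of _ X] conjI ballI X(1,2) err)
  qed
qed

text \<open>Since 2^l <= n and n >= 2, l + 1 is at most twice the binary logarithm of n; since n <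
  2^(g + l + 1), passing from 2^(-sl) to n^(-s) costs at most 2^((g + 1) s).\<close>

lemma dyadic_rate_le:
  fixes n l g s d :: nat and e :: real
  assumes n: "n \<ge> 2" and lower: "2 ^ (g + l) \<le> n" and upper: "n < 2 ^ (g + l + 1)"
    and e: "e = real d / 2"
  shows "sqrt (real (l + 1) ^ d) / 2 ^ (s * l) \<le>
    (2 / ln 2) powr e * 2 ^ ((g + 1) * s) * (real n powr (- real s) * ln (real n) powr e)"
proof -
  have ln2: "ln 2 > (0::real)" by simp
  have lnn: "ln 2 \<le> ln (real n)" using n by simp
  have "2 ^ l \<le> real n"
  proof -
    have "(2::nat) ^ l \<le> 2 ^ (g + l)" by (intro power_increasing) auto
    then have "2 ^ l \<le> n" using lower by linarith
    then show ?thesis by (metis of_nat_le_iff of_nat_numeral of_nat_power)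
  qed
  then have "ln (2 ^ l) \<le> ln (real n)" using n by simp
  then have "real l * ln 2 \<le> ln (real n)" by (simp add: ln_realpow)
  then have "real (l + 1) * ln 2 \<le> 2 * ln (real n)" using lnn by (simp add: algebra_simps)
  then have l1: "real (l + 1) \<le> 2 / ln 2 * ln (real n)" using ln2 by (simp add: field_simps)
  have "sqrt (real (l + 1) ^ d) = real (l + 1) powr e"
    by (simp add: powr_half_sqrt[symmetric] powr_realpow[symmetric] powr_powr e)
  also have "\<dots> \<le> (2 / ln 2 * ln (real n)) powr e"
    using l1 e by (intro powr_mono2) auto
  also have "\<dots> = (2 / ln 2) powr e * ln (real n) powr e"
    by (rule powr_mult)
  finally have A: "sqrt (real (l + 1) ^ d) \<le> (2 / ln 2) powr e * ln (real n) powr e" .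
  have "real n \<le> 2 ^ (g + l + 1)"
    using upper by (metis less_imp_le of_nat_le_iff of_nat_numeral of_nat_power)
  then have "real n ^ s \<le> (2 ^ (g + l + 1)) ^ s" by (intro power_mono) auto
  also have "\<dots> = 2 ^ ((g + 1) * s) * 2 ^ (s * l)"
    by (simp add: power_mult[symmetric] power_add[symmetric] algebra_simps)
  finally have "1 / 2 ^ (s * l) \<le> 2 ^ ((g + 1) * s) / real n ^ s"
    using n by (simp add: field_simps)
  also have "\<dots> = 2 ^ ((g + 1) * s) * real n powr (- real s)"
    using n by (simp add: powr_minus powr_realpow divide_inverse)
  finally have B: "1 / 2 ^ (s * l) \<le> 2 ^ ((g + 1) * s) * real n powr (- real s)" .
  have "sqrt (real (l + 1) ^ d) * (1 / 2 ^ (s * l)) \<le>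
      ((2 / ln 2) powr e * ln (real n) powr e) * (2 ^ ((g + 1) * s) * real n powr (- real s))"
    by (intro mult_mono A B) auto
  then show ?thesis by (simp add: mult_ac)
qed

theorem theorem1:
  fixes s :: nat
  assumes "s \<ge> 1"
  shows "\<exists>(C::real) (a :: nat \<Rightarrow> nat \<Rightarrow> real) (x :: nat \<Rightarrow> nat \<Rightarrow> real ^ 'd::finite).
    \<forall>n\<ge>2. (\<forall>j\<in>{1..n}. x n j \<in> unit_cube) \<and>
      worst_case_error (cubature n (a n) (x n)) (H_mix_ring s)
        \<le> ereal (C * real n powr (- real s) * ln (real n) powr ((real CARD('d) - 1) / 2))"
proof -
  \<comment> \<open>From here on \<open>d\<close> is the dimension minus one. In dimension one
    \<open>e\<close> is 0, and the logarithmic factor is 1 because ln n > 0 for n >= 2.\<close>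
  define d where "d = CARD('d) - 1"
  define e where "e = real d / 2"
  have e_eq: "(real CARD('d) - 1) / 2 = e"
    by (simp add: e_def d_def of_nat_diff Suc_le_eq)
  obtain C G :: real where C: "C > 0" and rule:
    "\<And>l. \<exists>(w :: real) (X :: (real ^ 'd) set). finite X \<and> X \<subseteq> unit_cube \<and> real (card X) \<le> G * 2 ^ l \<and>
      (\<forall>f\<in>H_mix_ring s. \<bar>cube_integral f - w * (\<Sum>x\<in>X. f x)\<bar> \<le> C * sqrt (real (l + 1) ^ d) / 2 ^ (s * l))"
    using frolov_rule[OF assms, where ?'d = 'd] unfolding d_def by blast
  \<comment> \<open>With this g the rule of level l has at most 2^(g + l) nodes.\<close>
  obtain g where g: "G < 2 ^ g" using real_arch_pow[of 2 G] by auto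
  \<comment> \<open>Makes the claimed rate at least 5/2 for all 2 <= n < 2^g, where n^(-s) >=
    2^(-gs) and ln n >= ln 2. Then the zero rule suffices.\<close>
  define K1 where "K1 = 5 / 2 * 2 ^ (g * s) / ln 2 powr e"
  define K2 where "K2 = C * ((2 / ln 2) powr e * 2 ^ ((g + 1) * s))"
  define K where "K = max K1 K2"
  have "\<exists>(a :: nat \<Rightarrow> real) (x :: nat \<Rightarrow> real ^ 'd). (\<forall>j. x j \<in> unit_cube) \<and>
      (\<forall>f\<in>H_mix_ring s. \<bar>cube_integral f - cubature n a x f\<bar> \<le> K * (real n powr (- real s) * ln (real n) powr e))"
    if n: "n \<ge> 2" for n
  proof (cases "n < 2 ^ g")
    case True
    have "real n \<le> 2 ^ g"
      using True by (metis less_imp_le of_nat_le_iff of_nat_numeral of_nat_power)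
    then have "real n ^ s \<le> (2 ^ g) ^ s" by (intro power_mono) auto
    then have "1 / 2 ^ (g * s) \<le> 1 / real n ^ s"
      using n by (intro divide_left_mono) (auto simp: power_mult)
    then have 1: "1 / 2 ^ (g * s) \<le> real n powr (- real s)"
      using n by (simp add: powr_minus powr_realpow divide_inverse)
    have 2: "ln 2 powr e \<le> ln (real n) powr e"
      using n by (intro powr_mono2) (auto simp: e_def)
    have "5 / 2 = K1 * (1 / 2 ^ (g * s) * ln 2 powr e)"
      by (simp add: K1_def)
    also have "\<dots> \<le> K * (real n powr (- real s) * ln (real n) powr e)"
      using 1 2 by (intro mult_mono) (auto simp: K_def K1_def le_max_iff_disj)
    finally have bound: "5 / 2 \<le> K * (real n powr (- real s) * ln (real n) powr e)" .
    have "\<bar>cube_integral f - cubature n (\<lambda>_. 0) (\<lambda>_. 0) f\<bar> \<le> K * (real n powr (- real s) * ln (real n) powr e)"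
      if "f \<in> H_mix_ring s" for f :: "real ^ 'd \<Rightarrow> real"
      using order_trans[OF H_mix_ring_integral_bound[OF that] bound] by (simp add: cubature_def)
    moreover have "(0 :: real ^ 'd) \<in> unit_cube" by (simp add: mem_unit_cube)
    ultimately show ?thesis by (intro exI[of _ "\<lambda>_. 0"]) simp
  next
    case False
    \<comment> \<open>The level is l = p - g: its nodes are guaranteed to fit into n, while n stays
      below 2^(g + l + 1).\<close>
    obtain p where p: "2 ^ p \<le> n" "n < 2 ^ (p + 1)"
      using ex_power_ivl1[of 2 n] n by auto
    have "g \<le> p"
    proof -
      have "(2::nat) ^ g < 2 ^ (p + 1)" using False p by linarith
      then have "g < p + 1" by (subst (asm) power_strict_increasing_iff) auto
      then show ?thesis by simp
    qed
    then obtain l where l: "p = g + l" using le_Suc_ex by blast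
    obtain w and X :: "(real ^ 'd) set" where X: "finite X" "X \<subseteq> unit_cube" "real (card X) \<le> G * 2 ^ l"
      and err: "\<And>f. f \<in> H_mix_ring s \<Longrightarrow> \<bar>cube_integral f - w * (\<Sum>x\<in>X. f x)\<bar> \<le> C * sqrt (real (l + 1) ^ d) / 2 ^ (s * l)"
      using rule[of l] by blast
    have "real (card X) \<le> 2 ^ g * 2 ^ l"
      using X(3) g by (auto intro: order_trans mult_right_mono less_imp_le)
    also have "\<dots> = real (2 ^ p)" by (simp add: l power_add)
    finally have "card X \<le> n" using p(1) by (simp only: of_nat_le_iff)
    then obtain a and x :: "nat \<Rightarrow> real ^ 'd" where ax: "\<And>j. x j \<in> unit_cube" "\<And>f. cubature n a x f = w * (\<Sum>x\<in>X. f x)"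
      using cubature_of_finite_set[OF X(1,2)] by metis
    have "C * sqrt (real (l + 1) ^ d) / 2 ^ (s * l) = C * (sqrt (real (l + 1) ^ d) / 2 ^ (s * l))"
      by simp
    also have "\<dots> \<le> C * ((2 / ln 2) powr e * 2 ^ ((g + 1) * s) * (real n powr (- real s) * ln (real n) powr e))"
      using C p unfolding l by (intro mult_left_mono dyadic_rate_le n e_def) auto
    also have "\<dots> = K2 * (real n powr (- real s) * ln (real n) powr e)"
      by (simp add: K2_def)
    also have "\<dots> \<le> K * (real n powr (- real s) * ln (real n) powr e)"
      by (intro mult_right_mono) (auto simp: K_def)
    finally have bound: "C * sqrt (real (l + 1) ^ d) / 2 ^ (s * l) \<le> K * (real n powr (- real s) * ln (real n) powr e)" .
    have "\<bar>cube_integral f - cubature n a x f\<bar> \<le> K * (real n powr (- real s) * ln (real n) powr e)"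
      if "f \<in> H_mix_ring s" for f
      unfolding ax(2) by (rule order_trans[OF err[OF that] bound])
    with ax(1) show ?thesis by blast
  qed
  then obtain a and x :: "nat \<Rightarrow> nat \<Rightarrow> real ^ 'd" where ax: "\<And>n j. n \<ge> 2 \<Longrightarrow> x n j \<in> unit_cube"
    "\<And>n f. n \<ge> 2 \<Longrightarrow> f \<in> H_mix_ring s \<Longrightarrow>
      \<bar>cube_integral f - cubature n (a n) (x n) f\<bar> \<le> K * (real n powr (- real s) * ln (real n) powr e)"
    by metis
  show ?thesis
  proof (intro exI[of _ K] exI[of _ a] exI[of _ x] allI impI conjI ballI)
    fix n :: nat assume n: "n \<ge> 2"
    show "worst_case_error (cubature n (a n) (x n)) (H_mix_ring s)
        \<le> ereal (K * real n powr (- real s) * ln (real n) powr ((real CARD('d) - 1) / 2))"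
      unfolding worst_case_error_def e_eq
      by (rule SUP_least) (use ax(2)[OF n] in \<open>simp add: mult.assoc\<close>)
  qed (rule ax(1))
qed

end
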